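(* Let $A, X_1$ be operators on a complex Hilbert space $\mathcal{H}$. Then the following are equivalent: (1) $(A, X_1)$ is a $\mathbb{B}_2$-unitary; (2) $(A, X_1, X_1^*, I)$ is an $\mathbb{H}$-unitary; (3) $X_1$ is normal and $(A, X_1, |X_1|, U)$ is an $\mathbb{H}$-unitary, where $X_1=|X_1|U$ is the polar decomposition of $X_1$.
   Context: All operators are bounded linear maps on complex Hilbert spaces; $|T|=(T^*T)^{1/2}$; $\mathbb{D}$ is the open unit disc in $\mathbb{C}$; $\mathbb{B}_2$ is the open Euclidean unit ball of $\mathbb{C}^2$. The polar decomposition of a normal operator $N$ here means: a unitary $U$ on $\mathcal{H}$ such that $N=U|N|=|N|U$ and $U$ commutes with every operator that commutes with $N$ (such a $U$ exists; fix one). The tetrablock is $\mathbb{E}=\{(x_1,x_2,x_3)\in\mathbb{C}^3 : 1-x_1z_1-x_2z_2+x_3z_1z_2\neq 0 \text{ whenever } |z_1|\le 1, |z_2|\le 1\}$. The hexablock is $\mathbb{H}=\{(a,x_1,x_2,x_3)\in\mathbb{C}\times\mathbb{E} : \sup_{z_1,z_2\in\mathbb{D}}\left|\frac{a\sqrt{(1-|z_1|^2)(1-|z_2|^2)}}{1-x_1z_1-x_2z_2+x_3z_1z_2}\right|<1\}$. For a bounded domain $\Omega\subset\mathbb{C}^n$, the distinguished boundary $b\Omega$ is the smallest closed subset of $\overline{\Omega}$ on which every function continuous on $\overline{\Omega}$ and analytic in $\Omega$ attains its maximum modulus. For $\Omega\in\{\mathbb{H},\mathbb{B}_2\}$, an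 $\Omega$-unitary is a commuting tuple of normal operators whose Taylor joint spectrum is contained in $b\Omega$. *)

theory Defs
  imports "HOL-Analysis.Analysis"
begin

section \<open>Complex Hilbert spaces\<close>

text \<open>
  The inner product \<open>cinner\<close> is linear in its first argument. Its real part is the real inner
  product of the superclass, so the norm, the topology and completeness are those of the library,
  and positive definiteness of \<open>cinner\<close> follows from that of \<open>inner\<close>.
\<close>

class complex_hilbert = real_inner + complete_space +
  fixes scaleC :: "complex \<Rightarrow> 'a \<Rightarrow> 'a"  (infixr \<open>*\<^sub>C\<close> 75)
    and cinner :: "'a \<Rightarrow> 'a \<Rightarrow> complex"
  assumes scaleC_add_right: "c *\<^sub>C (x + y) = c *\<^sub>C x + c *\<^sub>C y"
    and scaleC_add_left: "(c + d) *\<^sub>C x = c *\<^sub>C x + d *\<^sub>C x"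
    and scaleC_scaleC: "c *\<^sub>C (d *\<^sub>C x) = (c * d) *\<^sub>C x"
    and scaleC_of_real: "of_real r *\<^sub>C x = r *\<^sub>R x"
    and cinner_commute: "cinner x y = cnj (cinner y x)"
    and cinner_add_left: "cinner (x + y) z = cinner x z + cinner y z"
    and cinner_scaleC_left: "cinner (c *\<^sub>C x) y = c * cinner x y"
    and Re_cinner: "Re (cinner x y) = inner x y"

section \<open>Operators\<close>

text \<open>
  Elements of \<^typ>\<open>'a \<Rightarrow>\<^sub>L 'a\<close> are only real linear and bounded; the operators of the theory
  are those satisfying \<open>clinear_op\<close>.
\<close>

definition clinear_op :: "('a::complex_hilbert \<Rightarrow>\<^sub>L 'a) \<Rightarrow> bool"
  where "clinear_op T \<longleftrightarrow> (\<forall>c x. T (c *\<^sub>C x) = c *\<^sub>C T x)"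

definition adj :: "('a::complex_hilbert \<Rightarrow>\<^sub>L 'a) \<Rightarrow> ('a \<Rightarrow>\<^sub>L 'a)"
  where "adj T = (THE S :: 'a \<Rightarrow>\<^sub>L 'a. \<forall>x y. cinner (T x) y = cinner x (S y))"

definition normal_op :: "('a::complex_hilbert \<Rightarrow>\<^sub>L 'a) \<Rightarrow> bool"
  where "normal_op T \<longleftrightarrow> clinear_op T \<and> adj T o\<^sub>L T = T o\<^sub>L adj T"

definition unitary_op :: "('a::complex_hilbert \<Rightarrow>\<^sub>L 'a) \<Rightarrow> bool"
  where "unitary_op U \<longleftrightarrow>
    clinear_op U \<and> adj U o\<^sub>L U = id_blinfun \<and> U o\<^sub>L adj U = id_blinfun"

definition positive_op :: "('a::complex_hilbert \<Rightarrow>\<^sub>L 'a) \<Rightarrow> bool"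
  where "positive_op P \<longleftrightarrow> clinear_op P \<and> (\<forall>x. cinner (P x) x \<in> \<real>\<^sub>\<ge>\<^sub>0)"

text \<open>\<open>abs_op T\<close> is the modulus of \<open>T\<close>, the unique positive square root of \<open>adj T o\<^sub>L T\<close>.\<close>

definition abs_op :: "('a::complex_hilbert \<Rightarrow>\<^sub>L 'a) \<Rightarrow> ('a \<Rightarrow>\<^sub>L 'a)"
  where "abs_op T = (THE P. positive_op P \<and> P o\<^sub>L P = adj T o\<^sub>L T)"

text \<open>
  \<open>polar_unitary N U\<close> says that \<open>U\<close> is an admissible unitary factor in the polar decomposition of
  the normal operator \<open>N\<close>. Such a \<open>U\<close> is not unique if \<open>N\<close> has a nontrivial kernel.
\<close>

definition polar_unitary ::
    "('a::complex_hilbert \<Rightarrow>\<^sub>L 'a) \<Rightarrow> ('a \<Rightarrow>\<^sub>L 'a) \<Rightarrow> bool"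
  where "polar_unitary N U \<longleftrightarrow>
    unitary_op U \<and> N = U o\<^sub>L abs_op N \<and> N = abs_op N o\<^sub>L U \<and>
    (\<forall>S. clinear_op S \<longrightarrow> S o\<^sub>L N = N o\<^sub>L S \<longrightarrow> S o\<^sub>L U = U o\<^sub>L S)"

section \<open>The Taylor joint spectrum\<close>

text \<open>
  The space of the Koszul complex is the tensor product of the Hilbert space with the exterior
  algebra on generators \<open>e\<^sub>i\<close>, \<open>i :: 'n\<close>. The function \<open>x :: 'n set \<Rightarrow> 'a\<close> stands for the
  sum over \<open>S\<close> of \<open>x S\<close> tensor \<open>e\<^sub>S\<close>, where \<open>e\<^sub>S\<close> is the wedge product of the \<open>e\<^sub>i\<close>, \<open>i \<in> S\<close>, in
  increasing order. The coboundary is the sum over \<open>i\<close> of \<open>T\<^sub>i - z\<^sub>i\<close> tensor left exterior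
  multiplication by \<open>e\<^sub>i\<close>; moving \<open>e\<^sub>i\<close> into its place in \<open>e\<^sub>S\<close> produces the sign. As the coboundary
  is homogeneous of degree one, kernel = range means exactness at every stage of the complex.
\<close>

definition koszul ::
    "('a::complex_hilbert \<Rightarrow>\<^sub>L 'a)^('n::{finite,linorder}) \<Rightarrow> complex^('n::{finite,linorder}) \<Rightarrow>
      ('n set \<Rightarrow> 'a) \<Rightarrow> ('n set \<Rightarrow> 'a)"
  where "koszul T z x S =
    (\<Sum>i\<in>S. (-1) ^ card {j\<in>S. j < i} *\<^sub>R ((T $ i) (x (S - {i})) - (z $ i) *\<^sub>C x (S - {i})))"

definition taylor_spectrum ::
    "('a::complex_hilbert \<Rightarrow>\<^sub>L 'a)^('n::{finite,linorder}) \<Rightarrow> (complex^('n::{finite,linorder})) set"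
  where "taylor_spectrum T = {z. {x. koszul T z x = (\<lambda>_. 0)} \<noteq> range (koszul T z)}"

section \<open>Distinguished boundary\<close>

text \<open>Analyticity on an open set, as Frechet differentiability with complex linear derivative.\<close>

definition analytic_several :: "(complex^'n \<Rightarrow> complex) \<Rightarrow> (complex^'n) set \<Rightarrow> bool"
  where "analytic_several f \<Omega> \<longleftrightarrow>
    (\<forall>z\<in>\<Omega>. \<exists>D. (f has_derivative D) (at z) \<and> (\<forall>c v. D (c *s v) = c * D v))"

definition distinguished_boundary :: "(complex^'n) set \<Rightarrow> (complex^'n) set"
  where "distinguished_boundary \<Omega> =
    (LEAST B. closed B \<and> B \<subseteq> closure \<Omega> \<and>
      (\<forall>f. continuous_on (closure \<Omega>) f \<longrightarrow> analytic_several f \<Omega> \<longrightarrow>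
        (\<exists>w\<in>B. \<forall>z\<in>closure \<Omega>. cmod (f z) \<le> cmod (f w))))"

section \<open>The domains\<close>

definition ball2 :: "(complex^2) set"
  where "ball2 = ball 0 1"

definition tetrablock :: "(complex^3) set"
  where "tetrablock = {x. \<forall>z1 z2. cmod z1 \<le> 1 \<longrightarrow> cmod z2 \<le> 1 \<longrightarrow>
    1 - x$1 * z1 - x$2 * z2 + x$3 * z1 * z2 \<noteq> 0}"

text \<open>
  The point \<open>(a, x\<^sub>1, x\<^sub>2, x\<^sub>3)\<close> has \<open>a\<close> as its component with index 1. The supremum is over a
  bounded set of reals, since the denominator does not vanish on the closed bidisc.
\<close>

definition hexablock :: "(complex^4) set"
  where "hexablock = {vector [a, x1, x2, x3] | a x1 x2 x3.
    vector [x1, x2, x3] \<in> tetrablock \<and>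
    (SUP (z1, z2) \<in> ball 0 1 \<times> ball 0 1.
      cmod (a * of_real (sqrt ((1 - (cmod z1)\<^sup>2) * (1 - (cmod z2)\<^sup>2))) /
            (1 - x1 * z1 - x2 * z2 + x3 * z1 * z2))) < 1}"

definition domain_unitary ::
    "(complex^('n::{finite,linorder})) set \<Rightarrow> ('a::complex_hilbert \<Rightarrow>\<^sub>L 'a)^('n::{finite,linorder}) \<Rightarrow> bool"
  where "domain_unitary \<Omega> T \<longleftrightarrow>
    (\<forall>i. normal_op (T $ i)) \<and> (\<forall>i j. T $ i o\<^sub>L T $ j = T $ j o\<^sub>L T $ i) \<and>
    taylor_spectrum T \<subseteq> distinguished_boundary \<Omega>"

end

theory Submission
  imports Defs "HOL-Complex_Analysis.Conformal_Mappings"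
begin

text \<open>
  For commuting normal operators the Taylor spectrum is the joint approximate point spectrum: the set
  of points \<open>z\<close> for which unit vectors \<open>x\<close> exist that make all \<open>T\<^sub>i x - z\<^sub>i x\<close> arbitrarily small. This is
  \<open>taylor_spectrum_doubly_commuting\<close>, combined with Fuglede's theorem (\<open>fuglede\<close>). Approximate eigenvectors
  are easily carried along: if \<open>X\<close> is normal and \<open>X x\<close> is close to \<open>\<xi> x\<close>, then \<open>X\<^sup>* x\<close> is close to \<open>cnj \<xi> x\<close>.
  So the approximate spectra of \<open>(A, X)\<close>, \<open>(A, X, X\<^sup>*, 1)\<close> and \<open>(A, X, |X|, U)\<close> correspond to each other,
  the points being \<open>(a, x)\<close>, \<open>(a, x, cnj x, 1)\<close> and \<open>(a, x, p, u)\<close> with \<open>p\<close> real, \<open>|u| = 1\<close> and \<open>x = p u\<close>. The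
  one delicate point is that every \<open>(a, x)\<close> extends to some \<open>(a, x, p, u)\<close>, even for \<open>x = 0\<close>; this is the
  projection property \<open>joint_approx_spectrum_extend\<close> for the unitary \<open>U\<close>.

  It remains to know the two distinguished boundaries. That of the ball is the sphere. That of the
  hexablock is the set \<open>hexablock_edge\<close> of the points with \<open>|x\<^sub>3| = 1\<close>, \<open>x\<^sub>1 = cnj x\<^sub>2 x\<^sub>3\<close> and
  \<open>|a|\<^sup>2 + |x\<^sub>1|\<^sup>2 = 1\<close> (\<open>distinguished_boundary_hexablock\<close>). On the points listed above both of the conditions
  say that \<open>|a|\<^sup>2 + |x|\<^sup>2 = 1\<close>, which proves the equivalences.

  The edge consists of the quadruples \<open>(a21, a11, a22, det)\<close> of unitary \<open>2 \<times> 2\<close> matrices. It is contained in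
  every closed boundary because an affine function peaks at each of its points. It is a boundary
  because every point of the hexablock can be moved, without decreasing the modulus of a given
  function, first to extremal radius in the coordinate \<open>a\<close>, and from there to the edge along a disc of
  matrices \<open>u v\<^sup>* + \<zeta> u' v'\<^sup>*\<close>. The matrix is explicit: its vectors come from the point of the unit disc at
  which the extremal radius is attained (\<open>extremal_on_unitary_disc\<close>).
\<close>

section \<open>Complex Hilbert spaces and adjoints\<close>

lemma scaleC_zero_left [simp]: "(0::complex) *\<^sub>C (x::'a::complex_hilbert) = 0"
  using scaleC_of_real[of 0 x] by simp

lemma scaleC_one [simp]: "(1::complex) *\<^sub>C (x::'a::complex_hilbert) = x"
  using scaleC_of_real[of 1 x] by simp

lemma scaleC_minus_left: "(- c) *\<^sub>C (x::'a::complex_hilbert) = - (c *\<^sub>C x)"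
  using scaleC_add_left[of "-c" c x] by (simp add: eq_neg_iff_add_eq_0)

lemma scaleC_zero_right [simp]: "c *\<^sub>C (0::'a::complex_hilbert) = 0"
  using scaleC_add_right[of c 0 0] by simp

lemma scaleC_minus_right: "c *\<^sub>C (- x::'a::complex_hilbert) = - (c *\<^sub>C x)"
  using scaleC_add_right[of c "-x" x] by (simp add: eq_neg_iff_add_eq_0)

lemma scaleC_diff_right: "c *\<^sub>C (x - y::'a::complex_hilbert) = c *\<^sub>C x - c *\<^sub>C y"
  using scaleC_add_right[of c x "-y"] by (simp add: scaleC_minus_right)

lemma scaleC_diff_left: "(c - d) *\<^sub>C (x::'a::complex_hilbert) = c *\<^sub>C x - d *\<^sub>C x"
  using scaleC_add_left[of c "-d" x] by (simp add: scaleC_minus_left)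

lemma scaleC_sum_right: "c *\<^sub>C (\<Sum>i\<in>I. f i) = (\<Sum>i\<in>I. c *\<^sub>C (f i :: 'a::complex_hilbert))"
  by (induction I rule: infinite_finite_induct) (simp_all add: scaleC_add_right)

lemma scaleC_scaleR: "c *\<^sub>C (r *\<^sub>R x) = r *\<^sub>R (c *\<^sub>C (x::'a::complex_hilbert))"
  by (metis mult.commute scaleC_of_real scaleC_scaleC)

lemma cinner_add_right: "cinner x (y + z) = cinner x y + cinner (x::'a::complex_hilbert) z"
  by (metis cinner_add_left cinner_commute complex_cnj_add)

lemma cinner_scaleC_right: "cinner x (c *\<^sub>C y) = cnj c * cinner (x::'a::complex_hilbert) y"
  by (metis cinner_scaleC_left cinner_commute complex_cnj_mult)

lemma cinner_zero_left [simp]: "cinner 0 (y::'a::complex_hilbert) = 0"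
  using cinner_add_left[of 0 0 y] by simp

lemma cinner_zero_right [simp]: "cinner (y::'a::complex_hilbert) 0 = 0"
  using cinner_add_right[of y 0 0] by simp

lemma cinner_sum_left: "cinner (\<Sum>i\<in>I. f i) y = (\<Sum>i\<in>I. cinner (f i :: 'a::complex_hilbert) y)"
  by (induction I rule: infinite_finite_induct) (simp_all add: cinner_add_left)

lemma cinner_sum_right: "cinner y (\<Sum>i\<in>I. f i) = (\<Sum>i\<in>I. cinner y (f i :: 'a::complex_hilbert))"
  by (induction I rule: infinite_finite_induct) (simp_all add: cinner_add_right)

lemma cinner_self: "cinner x (x::'a::complex_hilbert) = of_real ((norm x)\<^sup>2)"
proof (rule complex_eqI)
  have "cinner x x = cnj (cinner x x)" by (rule cinner_commute)
  then have "Im (cinner x x) = - Im (cinner x x)" by (metis cnj.simps(2))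
  then show "Im (cinner x x) = Im (of_real ((norm x)\<^sup>2))" by simp
qed (simp add: Re_cinner power2_norm_eq_inner)

lemma norm_scaleC: "norm (c *\<^sub>C x) = cmod c * norm (x::'a::complex_hilbert)"
proof -
  have "complex_of_real ((norm (c *\<^sub>C x))\<^sup>2) = of_real ((cmod c * norm x)\<^sup>2)"
    unfolding cinner_self[symmetric] cinner_scaleC_left cinner_scaleC_right
    by (simp add: cinner_self power_mult_distrib mult.assoc[symmetric] complex_norm_square[of c, simplified])
  then have "(norm (c *\<^sub>C x))\<^sup>2 = (cmod c * norm x)\<^sup>2"
    using of_real_eq_iff by blast
  then show ?thesis by (simp add: power2_eq_iff_nonneg)
qed

text \<open>
  The imaginary part of \<open>cinner\<close> is determined by its real part, so an identity of real inner
  products that is stable under multiplication by \<open>\<i>\<close> lifts to \<open>cinner\<close>.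
\<close>

lemma Im_cinner: "Im (cinner x y) = - inner (\<i> *\<^sub>C x) (y::'a::complex_hilbert)"
  by (simp add: Re_cinner[symmetric] cinner_scaleC_left)

text \<open>
  The minimiser of \<open>\<parallel>x\<parallel>\<^sup>2 - 2 f x\<close> represents \<open>f\<close>: a minimising sequence is Cauchy by the
  parallelogram law, and the first variation at the limit vanishes.
\<close>

lemma riesz_representation:
  fixes f :: "'a::{real_inner,complete_space} \<Rightarrow> real"
  assumes f: "bounded_linear f"
  obtains y where "\<And>x. f x = inner x y"
proof -
  interpret f: bounded_linear f by fact
  define J where "J x = (norm x)\<^sup>2 - 2 * f x" for x
  obtain K where K: "\<And>x. norm (f x) \<le> norm x * K" using f.bounded by blast
  have lower: "- K\<^sup>2 \<le> J x" for x
  proof -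
    have "f x \<le> norm x * K" using K[of x] by simp
    moreover have "0 \<le> (norm x - K)\<^sup>2" by simp
    ultimately show ?thesis unfolding J_def by (simp add: power2_eq_square algebra_simps)
  qed
  define m where "m = Inf (range J)"
  have m_le: "m \<le> J x" for x
    unfolding m_def by (rule cInf_lower) (auto intro!: bdd_belowI2 lower)
  have "\<exists>x. J x < m + inverse (real (Suc n))" for n
    using cInf_lessD[of "range J" "m + inverse (real (Suc n))"] by (auto simp: m_def)
  then obtain X where X: "\<And>n. J (X n) < m + inverse (real (Suc n))" by metis
  have par: "(norm (x - y))\<^sup>2 = 2 * J x + 2 * J y - 4 * J ((1/2) *\<^sub>R (x + y))" for x y
    by (simp add: J_def f.add f.scaleR power2_norm_eq_inner inner_simps inner_commute field_simps)
  have "Cauchy X"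
  proof (rule CauchyI)
    fix e :: real assume "e > 0"
    obtain M where M: "inverse (real (Suc M)) < e\<^sup>2 / 4"
      using reals_Archimedean[of "e\<^sup>2/4"] \<open>e > 0\<close> by auto
    have "norm (X k - X n) < e" if "k \<ge> M" "n \<ge> M" for k n
    proof -
      have "inverse (real (Suc k)) \<le> inverse (real (Suc M))" "inverse (real (Suc n)) \<le> inverse (real (Suc M))"
        using that by (auto intro!: le_imp_inverse_le)
      then have "(norm (X k - X n))\<^sup>2 < e\<^sup>2"
        unfolding par using X[of k] X[of n] m_le[of "(1/2) *\<^sub>R (X k + X n)"] M by linarith
      then show ?thesis using \<open>e > 0\<close> by (simp add: power2_less_imp_less)
    qed
    then show "\<exists>M. \<forall>k\<ge>M. \<forall>n\<ge>M. norm (X k - X n) < e" by blast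
  qed
  then obtain y where y: "X \<longlonglongrightarrow> y" using Cauchy_convergent convergent_def by blast
  have "(\<lambda>n. J (X n)) \<longlonglongrightarrow> J y"
    unfolding J_def by (intro tendsto_intros f.tendsto y)
  moreover have "(\<lambda>n. m + inverse (real (Suc n))) \<longlonglongrightarrow> m + 0"
    by (intro tendsto_intros LIMSEQ_inverse_real_of_nat)
  ultimately have "J y \<le> m"
    using LIMSEQ_le[of "\<lambda>n. J (X n)" "J y" "\<lambda>n. m + inverse (real (Suc n))" "m + 0"] X less_imp_le by auto
  then have min: "J y \<le> J x" for x using m_le[of x] by linarith
  have "f h = inner h y" for h
  proof -
    \<comment> \<open>test the minimality at \<open>y + s h\<close> with the optimal step \<open>s\<close>\<close>
    define d where "d = f h - inner h y"
    define s where "s = d / (1 + (norm h)\<^sup>2)"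
    have pos: "1 + (norm h)\<^sup>2 > 0" by (simp add: add_pos_nonneg)
    have "J (y + s *\<^sub>R h) = J y - 2 * s * d + s\<^sup>2 * (norm h)\<^sup>2"
      unfolding J_def d_def power2_norm_eq_inner
      by (simp add: f.add f.scaleR inner_simps inner_commute algebra_simps power2_eq_square)
    then have "2 * s * d \<le> s\<^sup>2 * (norm h)\<^sup>2" using min[of "y + s *\<^sub>R h"] by linarith
    also have "\<dots> \<le> s\<^sup>2 * (1 + (norm h)\<^sup>2)" by (intro mult_left_mono) auto
    also have "\<dots> = s * d" using pos by (simp add: s_def power2_eq_square)
    finally have "s * d \<le> 0" by linarith
    moreover have "s * d = d\<^sup>2 / (1 + (norm h)\<^sup>2)" by (simp add: s_def power2_eq_square)
    ultimately have "d\<^sup>2 \<le> 0" using pos by (simp add: divide_le_0_iff)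
    then show ?thesis by (simp add: d_def)
  qed
  then show ?thesis using that by blast
qed

lemma cinner_eq_inner_adjoint:
  assumes "clinear_op T" and "\<And>x y. inner (T x) y = inner x (S y)"
  shows "cinner (T x) y = cinner x (S y)"
  using assms by (intro complex_eqI) (simp_all add: Re_cinner Im_cinner clinear_op_def flip: assms(2))

lemma clinear_op_adjointI:
  fixes T S :: "'a::complex_hilbert \<Rightarrow>\<^sub>L 'a"
  assumes "\<And>x y. cinner (T x) y = cinner x (S y)"
  shows "clinear_op S"
proof -
  have "S (c *\<^sub>C y) = c *\<^sub>C S y" for c y
  proof -
    have "cinner x (S (c *\<^sub>C y)) = cinner x (c *\<^sub>C S y)" for x
      by (simp add: assms[symmetric] cinner_scaleC_right)
    then show ?thesis by (metis Re_cinner vector_eq_rdot inner_commute)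
  qed
  then show ?thesis by (simp add: clinear_op_def)
qed

lemma cinner_adj:
  assumes "clinear_op T"
  shows "cinner (T x) y = cinner x (adj T y)"
proof -
  have "\<exists>z. \<forall>x. inner (T x) y = inner x z" for y
  proof -
    have "bounded_linear (\<lambda>x. inner (T x) y)"
      using bounded_linear_compose[OF bounded_linear_inner_left blinfun.bounded_linear_right] .
    then show ?thesis by (metis riesz_representation)
  qed
  then obtain g where g: "\<And>x y. inner (T x) y = inner x (g y)" by metis
  have "bounded_linear g"
  proof (rule bounded_linear_intro[where K="norm T"])
    fix x y :: 'a and r :: real
    have "inner z (g (x + y)) = inner z (g x + g y)" for z
      by (simp add: g[symmetric] inner_simps)
    then show "g (x + y) = g x + g y" by (metis vector_eq_rdot inner_commute)
    have "inner z (g (r *\<^sub>R x)) = inner z (r *\<^sub>R g x)" for z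
      by (simp add: g[symmetric] inner_simps)
    then show "g (r *\<^sub>R x) = r *\<^sub>R g x" by (metis vector_eq_rdot inner_commute)
    have "(norm (g x))\<^sup>2 = inner (T (g x)) x"
      by (simp add: g power2_norm_eq_inner)
    also have "\<dots> \<le> (norm T * norm (g x)) * norm x"
      by (metis norm_blinfun norm_cauchy_schwarz order_trans mult_right_mono norm_ge_zero)
    finally have "norm (g x) * norm (g x) \<le> norm (g x) * (norm x * norm T)"
      by (simp add: power2_eq_square algebra_simps)
    then show "norm (g x) \<le> norm x * norm T"
      by (cases "g x = 0") (auto simp: mult_le_cancel_left)
  qed
  then have S: "\<exists>S. \<forall>x y. cinner (T x) y = cinner x (blinfun_apply S y)"
    using cinner_eq_inner_adjoint[OF assms] g
    by (intro exI[of _ "Blinfun g"]) (simp add: bounded_linear_Blinfun_apply)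
  have uniq: "S = S'" if "\<forall>x y. cinner (T x) y = cinner x (blinfun_apply S y)"
    "\<forall>x y. cinner (T x) y = cinner x (blinfun_apply S' y)" for S S'
  proof (rule blinfun_eqI)
    fix y
    have "inner x (S y) = inner x (S' y)" for x using that by (metis Re_cinner)
    then show "S y = S' y" by (metis vector_eq_rdot inner_commute)
  qed
  have "\<exists>!S. \<forall>x y. cinner (T x) y = cinner x (blinfun_apply S y)"
    using S uniq by (metis (no_types))
  from theI'[OF this] show ?thesis unfolding adj_def by blast
qed

lemma inner_adj: "clinear_op T \<Longrightarrow> inner (T x) y = inner x (adj T y)"
  by (metis Re_cinner cinner_adj)

lemma inner_adj': "clinear_op T \<Longrightarrow> inner (adj T x) y = inner x (T y)"
  by (metis inner_adj inner_commute)

lemma clinear_adj: "clinear_op T \<Longrightarrow> clinear_op (adj T)"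
  by (rule clinear_op_adjointI) (rule cinner_adj)

lemma adj_unique:
  fixes S T :: "'a::complex_hilbert \<Rightarrow>\<^sub>L 'a"
  assumes "clinear_op T" "\<And>x y. inner (T x) y = inner x (S y)"
  shows "adj T = S"
proof (rule blinfun_eqI)
  fix y
  have "inner x (adj T y) = inner x (S y)" for x using assms by (metis inner_adj)
  then show "adj T y = S y" by (metis vector_eq_rdot inner_commute)
qed

lemma adj_adj [simp]: "clinear_op T \<Longrightarrow> adj (adj T) = T"
  by (intro adj_unique clinear_adj inner_adj')

lemma clinear_id [simp]: "clinear_op id_blinfun"
  by (simp add: clinear_op_def)

lemma adj_id [simp]: "adj id_blinfun = (id_blinfun :: 'a::complex_hilbert \<Rightarrow>\<^sub>L 'a)"
  by (rule adj_unique) simp_all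

lemma clinear_compose: "clinear_op S \<Longrightarrow> clinear_op T \<Longrightarrow> clinear_op (S o\<^sub>L T)"
  by (simp add: clinear_op_def)

lemma commute_apply: "S o\<^sub>L T = T o\<^sub>L S \<Longrightarrow> S (T x) = T (S x)"
  by (metis blinfun_apply_blinfun_compose)

lemma commuteI:
  fixes S T :: "'a::real_normed_vector \<Rightarrow>\<^sub>L 'a"
  shows "(\<And>x. S (T x) = T (S x)) \<Longrightarrow> S o\<^sub>L T = T o\<^sub>L S"
  by (intro blinfun_eqI) simp

lemma normal_op_clinear: "normal_op N \<Longrightarrow> clinear_op N"
  by (simp add: normal_op_def)

lemma normal_op_commute: "normal_op N \<Longrightarrow> adj N (N x) = N (adj N x)"
  unfolding normal_op_def by (metis blinfun_apply_blinfun_compose)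

lemma normal_adj: "normal_op N \<Longrightarrow> normal_op (adj N)"
  by (auto simp: normal_op_def clinear_adj)

lemma normal_id: "normal_op id_blinfun"
  by (simp add: normal_op_def)

lemma selfadjoint_normal: "clinear_op P \<Longrightarrow> adj P = P \<Longrightarrow> normal_op P"
  by (simp add: normal_op_def)

lemma unitary_normal: "unitary_op U \<Longrightarrow> normal_op U"
  by (simp add: unitary_op_def normal_op_def)

lemma norm_unitary: 
  assumes "unitary_op U" shows "norm (U x) = norm x"
proof -
  have "adj U (U x) = x"
    using assms unfolding unitary_op_def by (metis blinfun_apply_blinfun_compose blinfun_apply_id_blinfun id_apply)
  then have "inner (U x) (U x) = inner x x"
    using assms by (simp add: inner_adj unitary_op_def)
  then show ?thesis by (simp add: norm_eq_sqrt_inner)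
qed

text \<open>
  If \<open>N\<close> is normal, then so is \<open>N - z\<close>, and a normal operator and its adjoint have the same norm at
  every vector. Hence approximate eigenvectors of \<open>N\<close> at \<open>z\<close> are approximate eigenvectors of the
  adjoint at the conjugate of \<open>z\<close>. This is how adjoints are moved through approximate spectra below.
\<close>

lemma normal_residual:
  assumes "normal_op N"
  shows "norm (adj N x - cnj z *\<^sub>C x) = norm (N x - z *\<^sub>C x)"
proof -
  note cl = normal_op_clinear[OF assms]
  have sh: "cinner (N x) (z *\<^sub>C x) = cinner (cnj z *\<^sub>C x) (adj N x)"
    by (simp add: cinner_scaleC_left cinner_scaleC_right cinner_adj[OF cl])
  have "inner (N x) (z *\<^sub>C x) = inner (adj N x) (cnj z *\<^sub>C x)"
    using sh by (metis Re_cinner inner_commute)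
  moreover have "inner (N x) (N x) = inner (adj N x) (adj N x)"
    by (simp add: inner_adj[OF cl] inner_adj'[OF cl] normal_op_commute[OF assms])
  moreover have "inner (z *\<^sub>C x) (z *\<^sub>C x) = inner (cnj z *\<^sub>C x) (cnj z *\<^sub>C x)"
    by (simp add: dot_square_norm norm_scaleC)
  ultimately show ?thesis
    by (simp add: norm_eq_sqrt_inner inner_simps inner_commute)
qed

section \<open>Parseval's identity over roots of unity\<close>

definition unity_root :: "nat \<Rightarrow> nat \<Rightarrow> complex"
  where "unity_root m k = exp (2 * of_real pi * \<i> * of_nat k / of_nat m)"

lemma unity_root_power: "unity_root m k ^ i = unity_root m (k * i)"
  unfolding unity_root_def by (simp add: exp_of_nat_mult[symmetric] algebra_simps)

lemma norm_unity_root [simp]: "cmod (unity_root m k) = 1"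
  unfolding unity_root_def by (simp add: norm_exp_eq_Re)

lemma unity_root_power_order: "m > 0 \<Longrightarrow> unity_root m k ^ m = 1"
  unfolding unity_root_def by (rule complex_root_unity) simp

lemma unity_root_orthogonal:
  assumes "i < m" "j < m"
  shows "(\<Sum>k<m. unity_root m k ^ i * cnj (unity_root m k ^ j)) = (if i = j then of_nat m else 0)"
proof -
  define q where "q = unity_root m i * cnj (unity_root m j)"
  have unit: "unity_root m l * cnj (unity_root m l) = 1" for l
    by (simp add: complex_norm_square[of _, simplified, symmetric])
  have sum: "(\<Sum>k<m. unity_root m k ^ i * cnj (unity_root m k ^ j)) = (\<Sum>k<m. q ^ k)"
    by (intro sum.cong refl)
      (simp add: q_def power_mult_distrib unity_root_power mult.commute flip: complex_cnj_power)
  have "q = 1 \<longleftrightarrow> unity_root m i = unity_root m j"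
    using unit[of j] by (metis mult.assoc mult.commute mult.right_neutral q_def)
  also have "\<dots> \<longleftrightarrow> i = j"
    using complex_root_unity_eq[of m i j] assms by (simp add: unity_root_def)
  finally have q1: "q = 1 \<longleftrightarrow> i = j" .
  have "q ^ m = 1"
    using assms by (simp add: q_def power_mult_distrib unity_root_power_order flip: complex_cnj_power)
  then show ?thesis unfolding sum using q1 by (auto simp: geometric_sum)
qed

text \<open>
  The values at the \<open>m\<close>-th roots of unity of a vector polynomial of degree below \<open>m\<close> determine the sum
  of the squares of its coefficients. The identity is used twice: as Cauchy's estimate for one
  coefficient in Fuglede's theorem, and to split a vector into approximate eigenvectors of a unitary.
\<close>

lemma discrete_parseval:
  fixes y :: "nat \<Rightarrow> 'a::complex_hilbert"
  shows "(\<Sum>k<m. (norm (\<Sum>j<m. unity_root m k ^ j *\<^sub>C y j))\<^sup>2) = real m * (\<Sum>j<m. (norm (y j))\<^sup>2)"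
proof -
  have "complex_of_real (\<Sum>k<m. (norm (\<Sum>j<m. unity_root m k ^ j *\<^sub>C y j))\<^sup>2)
    = (\<Sum>k<m. \<Sum>i<m. \<Sum>j<m. unity_root m k ^ i * cnj (unity_root m k ^ j) * cinner (y i) (y j))"
    by (simp add: cinner_self[symmetric] cinner_sum_left cinner_sum_right cinner_scaleC_left
        cinner_scaleC_right mult.left_commute sum_distrib_left mult.assoc flip: of_real_power)
      (rule sum.cong[OF refl], rule sum.swap)
  also have "\<dots> = (\<Sum>i<m. \<Sum>j<m. \<Sum>k<m. unity_root m k ^ i * cnj (unity_root m k ^ j) * cinner (y i) (y j))"
    by (subst sum.swap) (intro sum.cong refl sum.swap)
  also have "\<dots> = (\<Sum>i<m. \<Sum>j<m. (if i = j then of_nat m else 0) * cinner (y i) (y j))"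
    by (intro sum.cong refl) (simp only: sum_distrib_right[symmetric] unity_root_orthogonal lessThan_iff)
  also have "\<dots> = (\<Sum>i<m. of_nat m * cinner (y i) (y i))"
    by (intro sum.cong refl) (simp add: if_distrib[of "\<lambda>c. c * _"] cong: if_cong)
  also have "\<dots> = complex_of_real (real m * (\<Sum>j<m. (norm (y j))\<^sup>2))"
    by (simp add: cinner_self sum_distrib_left)
  finally show ?thesis using of_real_eq_iff by blast
qed

section \<open>Fuglede's theorem\<close>

text \<open>
  Fuglede's theorem says that \<open>D A = N\<^sup>* A - A N\<^sup>*\<close> vanishes when \<open>A\<close> commutes with \<open>N\<close>. The usual proof
  applies Liouville's theorem to \<open>exp (\<lambda> D) A\<close>, which is bounded because on the commutant of \<open>N\<close> the map
  \<open>\<lambda> D\<close> is the commutator with the skew operator \<open>S = \<lambda> N\<^sup>* - cnj \<lambda> N\<close>, so that \<open>exp S\<close> is unitary.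
  Here the exponential is replaced by \<open>(1 + \<lambda> D / n)\<^sup>n\<close>, which is a polynomial in \<open>\<lambda>\<close>: a single factor is
  almost contractive, and Liouville's theorem becomes an estimate of the linear coefficient.
  Members of the commutant are represented by plain functions, since the polynomial in \<open>\<lambda>\<close> is evaluated
  pointwise with complex scalars.
\<close>

definition commutant_bound ::
    "('a::complex_hilbert \<Rightarrow>\<^sub>L 'a) \<Rightarrow> real \<Rightarrow> ('a \<Rightarrow> 'a) \<Rightarrow> bool"
  where "commutant_bound N b B \<longleftrightarrow> (\<forall>x y. B (x + y) = B x + B y) \<and> (\<forall>c x. B (c *\<^sub>C x) = c *\<^sub>C B x) \<and>
    (\<forall>x. B (N x) = N (B x)) \<and> (\<forall>x. norm (B x) \<le> b * norm x)"

definition ad_step :: "('a::complex_hilbert \<Rightarrow>\<^sub>L 'a) \<Rightarrow> complex \<Rightarrow> ('a \<Rightarrow> 'a) \<Rightarrow> 'a \<Rightarrow> 'a"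
  where "ad_step N c B x = B x + c *\<^sub>C (adj N (B x) - B (adj N x))"

text \<open>
  With \<open>S = c N\<^sup>* - cnj c N\<close> the step equals \<open>(1 + S) B (1 - S) + S B S\<close>. As \<open>S\<close> is skew,
  \<open>\<parallel>(1 \<plusminus> S) x\<parallel>\<^sup>2 = \<parallel>x\<parallel>\<^sup>2 + \<parallel>S x\<parallel>\<^sup>2\<close>, so the norm grows only to second order in \<open>c\<close>.
\<close>

lemma ad_step_bound:
  assumes N: "normal_op N" and B: "commutant_bound N b B" and b: "b \<ge> 0"
  shows "commutant_bound N ((1 + 2 * (2 * cmod c * norm N)\<^sup>2) * b) (ad_step N c B)"
proof -
  note cl = normal_op_clinear[OF N]
  have Badd: "B (x + y) = B x + B y" and Bsc: "B (d *\<^sub>C x) = d *\<^sub>C B x"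
    and BN: "B (N x) = N (B x)" and Bb: "norm (B x) \<le> b * norm x" for x y d
    using B by (auto simp: commutant_bound_def)
  have B0: "B 0 = 0" using Bsc[of 0 0] by simp
  have Bneg: "B (- x) = - B x" for x using Badd[of x "-x"] B0 by (simp add: eq_neg_iff_add_eq_0 add.commute)
  have Bdiff: "B (x - y) = B x - B y" for x y using Badd[of x "-y"] Bneg by simp
  have Nsc: "N (d *\<^sub>C x) = d *\<^sub>C N x" and aNsc: "adj N (d *\<^sub>C x) = d *\<^sub>C adj N x" for d x
    using cl clinear_adj[OF cl] by (auto simp: clinear_op_def)
  define S where "S x = c *\<^sub>C adj N x - cnj c *\<^sub>C N x" for x
  define s where "s = 2 * cmod c * norm N"
  have s0: "s \<ge> 0" by (simp add: s_def)
  have Sadd: "S (x + y) = S x + S y" and Sdiff: "S (x - y) = S x - S y" for x y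
    by (simp_all add: S_def blinfun.add_right blinfun.diff_right scaleC_add_right scaleC_diff_right)
  have nadj: "norm (adj N x) = norm (N x)" for x
    using normal_residual[OF N, of x 0] by simp
  have Sn: "norm (S x) \<le> s * norm x" for x
  proof -
    have "norm (S x) \<le> cmod c * norm (adj N x) + cmod c * norm (N x)"
      unfolding S_def by (rule order_trans[OF norm_triangle_ineq4]) (simp add: norm_scaleC)
    also have "\<dots> = 2 * cmod c * norm (N x)" by (simp add: nadj)
    also have "\<dots> \<le> 2 * cmod c * (norm N * norm x)" by (intro mult_left_mono norm_blinfun) auto
    finally show ?thesis by (simp add: s_def mult.assoc)
  qed
  have skew: "inner (S x) x = 0" for x
  proof -
    have "cinner (c *\<^sub>C adj N x) x = cnj (cinner (cnj c *\<^sub>C N x) x)"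
      using cinner_adj[OF cl, of x x] cinner_commute[of "adj N x" x]
      by (simp add: cinner_scaleC_left)
    then have "inner (c *\<^sub>C adj N x) x = inner (cnj c *\<^sub>C N x) x"
      by (simp only: Re_cinner[symmetric] cnj.simps)
    then show ?thesis by (simp add: S_def inner_diff_left)
  qed
  have pyth: "norm (x + S x) \<le> (sqrt (1 + s\<^sup>2)) * norm x" "norm (x - S x) \<le> (sqrt (1 + s\<^sup>2)) * norm x" for x
  proof -
    have sq: "(norm (S x))\<^sup>2 \<le> (s * norm x)\<^sup>2" by (intro power_mono Sn) simp
    have "(norm (x + S x))\<^sup>2 = (norm x)\<^sup>2 + (norm (S x))\<^sup>2" "(norm (x - S x))\<^sup>2 = (norm x)\<^sup>2 + (norm (S x))\<^sup>2"
      using skew[of x] by (simp_all add: power2_norm_eq_inner inner_simps inner_commute)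
    then have "(norm (x + S x))\<^sup>2 \<le> (sqrt (1 + s\<^sup>2) * norm x)\<^sup>2" "(norm (x - S x))\<^sup>2 \<le> (sqrt (1 + s\<^sup>2) * norm x)\<^sup>2"
      using sq by (simp_all add: power_mult_distrib algebra_simps)
    then show "norm (x + S x) \<le> (sqrt (1 + s\<^sup>2)) * norm x" "norm (x - S x) \<le> (sqrt (1 + s\<^sup>2)) * norm x"
      by (auto intro: power2_le_imp_le)
  qed
  \<comment> \<open>on the commutant of \<open>N\<close> the commutator with \<open>c N\<^sup>*\<close> is that with the skew operator \<open>S\<close>\<close>
  have fact: "ad_step N c B x = (B (x - S x) + S (B (x - S x))) + S (B (S x))" for x
    unfolding ad_step_def Bdiff Sdiff
    by (simp add: S_def Bdiff Bsc BN scaleC_diff_right)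
  have bound: "norm (ad_step N c B x) \<le> ((1 + 2 * s\<^sup>2) * b) * norm x" for x
  proof -
    have "norm (ad_step N c B x) \<le> sqrt (1 + s\<^sup>2) * norm (B (x - S x)) + s * norm (B (S x))"
      unfolding fact by (rule norm_triangle_le) (intro add_mono pyth Sn)
    also have "\<dots> \<le> sqrt (1 + s\<^sup>2) * (b * (sqrt (1 + s\<^sup>2) * norm x)) + s * (b * (s * norm x))"
      using b s0 by (intro add_mono mult_left_mono order_trans[OF Bb] pyth Sn) auto
    also have "\<dots> = ((1 + 2 * s\<^sup>2) * b) * norm x"
      by (simp add: algebra_simps power2_eq_square[symmetric])
    finally show ?thesis .
  qed
  have comm: "adj N (N x) = N (adj N x)" for x by (rule normal_op_commute[OF N])
  show ?thesis
    unfolding commutant_bound_def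
    using bound unfolding s_def ad_step_def
    by (simp add: Badd Bsc BN Nsc aNsc blinfun.add_right blinfun.diff_right comm scaleC_add_right
        scaleC_diff_right scaleC_scaleC mult.commute algebra_simps)
qed

text \<open>
  The coefficients of \<open>(1 + c h D)\<^sup>k B\<close> as a polynomial in \<open>c\<close>, where \<open>D B = N\<^sup>* B - B N\<^sup>*\<close>.
\<close>

fun ad_coeff :: "('a::complex_hilbert \<Rightarrow>\<^sub>L 'a) \<Rightarrow> ('a \<Rightarrow> 'a) \<Rightarrow> real \<Rightarrow> nat \<Rightarrow> nat \<Rightarrow> 'a \<Rightarrow> 'a"
  where
    "ad_coeff N B h 0 j x = (if j = 0 then B x else 0)"
  | "ad_coeff N B h (Suc k) 0 x = ad_coeff N B h k 0 x"
  | "ad_coeff N B h (Suc k) (Suc j) x = ad_coeff N B h k (Suc j) x +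
      h *\<^sub>R (adj N (ad_coeff N B h k j x) - ad_coeff N B h k j (adj N x))"

lemma ad_coeff_high: "j > k \<Longrightarrow> ad_coeff N B h k j x = 0"
proof (induction k arbitrary: j x)
  case 0
  then show ?case by simp
next
  case (Suc k)
  then show ?case by (cases j) auto
qed

lemma ad_coeff_zero: "ad_coeff N B h k 0 x = B x"
  by (induction k) auto

lemma ad_coeff_one: "ad_coeff N B h k (Suc 0) x = (real k * h) *\<^sub>R (adj N (B x) - B (adj N x))"
  by (induction k) (auto simp: ad_coeff_zero algebra_simps)

lemma iterate_ad_step:
  assumes "clinear_op N"
  shows "((ad_step N (of_real h * c)) ^^ k) B x = (\<Sum>j<Suc k. c ^ j *\<^sub>C ad_coeff N B h k j x)"
proof (induction k arbitrary: x)
  case 0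
  then show ?case by simp
next
  case (Suc k)
  have lin: "adj N (\<Sum>j<n. c ^ j *\<^sub>C f j) = (\<Sum>j<n. c ^ j *\<^sub>C adj N (f j))" for f n
    using clinear_adj[OF assms] by (simp add: blinfun.sum_right clinear_op_def)
  have "((ad_step N (of_real h * c)) ^^ Suc k) B x
      = (\<Sum>j<Suc k. c ^ j *\<^sub>C ad_coeff N B h k j x) + (of_real h * c) *\<^sub>C
        (\<Sum>j<Suc k. c ^ j *\<^sub>C (adj N (ad_coeff N B h k j x) - ad_coeff N B h k j (adj N x)))"
    by (simp add: ad_step_def Suc lin sum_subtractf scaleC_diff_right del: sum.lessThan_Suc)
  also have "(of_real h * c) *\<^sub>C
        (\<Sum>j<Suc k. c ^ j *\<^sub>C (adj N (ad_coeff N B h k j x) - ad_coeff N B h k j (adj N x)))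
      = (\<Sum>j<Suc k. c ^ Suc j *\<^sub>C (h *\<^sub>R (adj N (ad_coeff N B h k j x) - ad_coeff N B h k j (adj N x))))"
    by (simp add: scaleC_sum_right scaleC_scaleC scaleC_of_real[symmetric] mult_ac del: sum.lessThan_Suc)
  also have "(\<Sum>j<Suc k. c ^ j *\<^sub>C ad_coeff N B h k j x)
      = (\<Sum>j<Suc (Suc k). c ^ j *\<^sub>C ad_coeff N B h k j x)"
    by (simp add: ad_coeff_high)
  finally show ?case
    unfolding sum.lessThan_Suc_shift[of _ "Suc k"]
    by (simp add: scaleC_add_right sum.distrib del: sum.lessThan_Suc)
qed

text \<open>
  The polynomial \<open>(1 + \<lambda> D / n)\<^sup>n A\<close> has linear coefficient \<open>D A\<close>. For \<open>|\<lambda>| = r\<close> and \<open>n \<ge> 8 r\<^sup>2 \<parallel>N\<parallel>\<^sup>2\<close> it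
  is bounded by \<open>e \<parallel>A\<parallel>\<close>, whence \<open>r \<parallel>D A\<parallel> \<le> e \<parallel>A\<parallel>\<close> for every \<open>r\<close>.
\<close>

theorem fuglede:
  assumes N: "normal_op N" and A: "clinear_op A" and AN: "A o\<^sub>L N = N o\<^sub>L A"
  shows "A o\<^sub>L adj N = adj N o\<^sub>L A"
proof (rule commuteI)
  fix x
  define D where "D = adj N (A x) - A (adj N x)"
  have key: "real r * norm D \<le> exp 1 * (norm A * norm x)" if r: "r > 0" for r :: nat
  proof -
    obtain n :: nat where n: "real n \<ge> 8 * (real r * norm N)\<^sup>2" "n > 0"
      using real_arch_simple[of "max 1 (8 * (real r * norm N)\<^sup>2)"] by fastforce
    define h where "h = real r / real n"
    define s where "s = 2 * h * norm N"
    define E where "E c = ((ad_step N (of_real h * c)) ^^ n) (blinfun_apply A) x" for c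
    have start: "commutant_bound N (norm A) (blinfun_apply A)"
      using A commute_apply[OF AN] by (auto simp: commutant_bound_def blinfun.add_right clinear_op_def norm_blinfun)
    have bound: "norm (E c) \<le> exp 1 * (norm A * norm x)" if "cmod c = 1" for c
    proof -
      have "commutant_bound N ((1 + 2 * s\<^sup>2) ^ k * norm A)
              (((ad_step N (of_real h * c)) ^^ k) (blinfun_apply A))" for k
      proof (induction k)
        case (Suc k)
        have "cmod (of_real h * c) = h" using that r by (simp add: norm_mult norm_divide h_def)
        with ad_step_bound[OF N Suc, of "of_real h * c"] show ?case
          by (simp add: s_def mult.assoc)
      qed (use start in simp)
      then have "norm (E c) \<le> (1 + 2 * s\<^sup>2) ^ n * norm A * norm x"
        unfolding E_def commutant_bound_def by blast
      moreover have "(1 + 2 * s\<^sup>2) ^ n \<le> exp 1"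
      proof -
        have "(1 + 2 * s\<^sup>2) ^ n \<le> exp (2 * s\<^sup>2) ^ n" by (intro power_mono exp_ge_add_one_self) simp
        also have "\<dots> = exp (real n * (2 * s\<^sup>2))" by (simp add: exp_of_nat_mult)
        also have "real n * (2 * s\<^sup>2) = 8 * (real r * norm N)\<^sup>2 / real n"
          using n by (simp add: s_def h_def power2_eq_square field_simps)
        also have "exp \<dots> \<le> exp 1" using n by (simp add: divide_le_eq)
        finally show ?thesis .
      qed
      ultimately show ?thesis
        by (smt (verit) mult.assoc mult_right_mono mult_nonneg_nonneg norm_ge_zero)
    qed
    \<comment> \<open>Cauchy's estimate for the linear coefficient \<open>r D\<close>, by averaging over roots of unity\<close>
    define m where "m = Suc n"
    define y where "y j = ad_coeff N (blinfun_apply A) h n j x" for j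
    have E: "E c = (\<Sum>j<m. c ^ j *\<^sub>C y j)" for c
      unfolding E_def m_def y_def by (rule iterate_ad_step[OF normal_op_clinear[OF N]])
    have y1: "y (Suc 0) = real r *\<^sub>R D" using n by (simp add: y_def ad_coeff_one D_def h_def)
    have "real m * (norm (y (Suc 0)))\<^sup>2 \<le> real m * (\<Sum>j<m. (norm (y j))\<^sup>2)"
      using n by (intro mult_left_mono member_le_sum) (auto simp: m_def)
    also have "\<dots> = (\<Sum>k<m. (norm (E (unity_root m k)))\<^sup>2)"
      unfolding E by (rule discrete_parseval[symmetric])
    also have "\<dots> \<le> (\<Sum>k<m. (exp 1 * (norm A * norm x))\<^sup>2)"
      by (intro sum_mono power_mono bound) auto
    finally have "(norm (y (Suc 0)))\<^sup>2 \<le> (exp 1 * (norm A * norm x))\<^sup>2"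
      by (simp add: m_def del: of_nat_Suc)
    then have "norm (y (Suc 0)) \<le> exp 1 * (norm A * norm x)"
      by (rule power2_le_imp_le) simp
    then show ?thesis by (simp add: y1)
  qed
  have "norm D = 0"
  proof (rule ccontr)
    assume "norm D \<noteq> 0"
    then have "norm D > 0" by simp
    then obtain r :: nat where "exp 1 * (norm A * norm x) < real r * norm D"
      using reals_Archimedean3 by blast
    moreover have "r > 0"
      using calculation by (cases r) (auto simp: not_less[symmetric] mult_less_0_iff dest: order.strict_trans1[rotated] )
    ultimately show False using key[of r] by simp
  qed
  then show "A (adj N x) = adj N (A x)" by (simp add: D_def)
qed

section \<open>The modulus of an operator\<close>

instance complex_hilbert \<subseteq> banach ..

text \<open>
  The defining description of \<open>abs_op\<close> is meaningful only once positive square roots are known to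
  exist and to be unique. For a contraction \<open>R = 1 - S\<close> the root of \<open>S\<close> is \<open>1 - Y\<close> with
  \<open>2 Y = R + Y\<^sup>2\<close>, and the iteration of this equation from \<open>0\<close> converges in norm, because its steps are
  dominated by those of the scalar iteration for \<open>R = 1\<close>.
\<close>

fun sqrt_iter :: "('a::real_normed_vector \<Rightarrow>\<^sub>L 'a) \<Rightarrow> nat \<Rightarrow> ('a \<Rightarrow>\<^sub>L 'a)"
  where
    "sqrt_iter R 0 = 0"
  | "sqrt_iter R (Suc n) = (1/2) *\<^sub>R (R + (sqrt_iter R n o\<^sub>L sqrt_iter R n))"

fun sqrt_majorant :: "nat \<Rightarrow> real"
  where
    "sqrt_majorant 0 = 0"
  | "sqrt_majorant (Suc n) = (1/2) * (1 + (sqrt_majorant n)\<^sup>2)"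

lemma sqrt_majorant_bounds: "0 \<le> sqrt_majorant n \<and> sqrt_majorant n \<le> 1"
proof (induction n)
  case (Suc n)
  then have "(sqrt_majorant n)\<^sup>2 \<le> 1" by (simp add: abs_square_le_1)
  then show ?case by simp
qed simp

lemma sqrt_iter_commute:
  assumes "V o\<^sub>L R = R o\<^sub>L V"
  shows "V o\<^sub>L sqrt_iter R n = sqrt_iter R n o\<^sub>L V"
proof (induction n)
  case (Suc n)
  then show ?case
    using commute_apply[OF assms] commute_apply[OF Suc]
    by (intro commuteI) (simp add: blinfun.bilinear_simps)
qed (simp add: commuteI)

text \<open>
  \<open>Y\<^sub>n\<^sub>+\<^sub>2 - Y\<^sub>n\<^sub>+\<^sub>1\<close> is half of \<open>(Y\<^sub>n\<^sub>+\<^sub>1 - Y\<^sub>n) (Y\<^sub>n\<^sub>+\<^sub>1 + Y\<^sub>n)\<close>, since the iterates commute; the scalar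
  majorant satisfies the same recursion with equality.
\<close>

lemma sqrt_iter_bounds:
  assumes R: "norm R \<le> 1"
  shows "norm (sqrt_iter R n) \<le> sqrt_majorant n
    \<and> norm (sqrt_iter R (Suc n) - sqrt_iter R n) \<le> sqrt_majorant (Suc n) - sqrt_majorant n"
proof (induction n)
  case 0
  then show ?case using R by simp
next
  case (Suc n)
  let ?Y = "sqrt_iter R" and ?y = sqrt_majorant
  have "norm (?Y (Suc n)) = norm ((?Y (Suc n) - ?Y n) + ?Y n)" by simp
  also have "\<dots> \<le> norm (?Y (Suc n) - ?Y n) + norm (?Y n)" by (rule norm_triangle_ineq)
  finally have 1: "norm (?Y (Suc n)) \<le> ?y (Suc n)" using Suc by linarith
  have comm: "?Y n (?Y (Suc n) x) = ?Y (Suc n) (?Y n x)" for x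
    by (intro commute_apply sqrt_iter_commute sym[OF sqrt_iter_commute]) simp
  have "?Y (Suc (Suc n)) - ?Y (Suc n) = (1/2) *\<^sub>R ((?Y (Suc n) - ?Y n) o\<^sub>L (?Y (Suc n) + ?Y n))"
  proof (rule blinfun_eqI)
    fix x
    have e: "?Y (Suc k) x = (1/2) *\<^sub>R (R x + ?Y k (?Y k x))" for k
      by (simp add: blinfun.bilinear_simps)
    show "(?Y (Suc (Suc n)) - ?Y (Suc n)) x = ((1/2) *\<^sub>R ((?Y (Suc n) - ?Y n) o\<^sub>L (?Y (Suc n) + ?Y n))) x"
      using arg_cong2[where f = minus, OF e[of "Suc n"] e[of n]] comm
      by (simp add: blinfun.bilinear_simps scaleR_diff_right[symmetric] scaleR_add_right[symmetric] del: sqrt_iter.simps)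
  qed
  then have "norm (?Y (Suc (Suc n)) - ?Y (Suc n)) \<le> (1/2) * (norm (?Y (Suc n) - ?Y n) * norm (?Y (Suc n) + ?Y n))"
    using norm_blinfun_compose[of "?Y (Suc n) - ?Y n" "?Y (Suc n) + ?Y n"] by (simp del: sqrt_iter.simps)
  also have "\<dots> \<le> (1/2) * ((?y (Suc n) - ?y n) * (?y (Suc n) + ?y n))"
    using Suc 1 norm_triangle_ineq[of "?Y (Suc n)" "?Y n"] norm_ge_zero[of "?Y (Suc n) - ?Y n"]
    by (intro mult_left_mono mult_mono) (linarith | simp del: sqrt_iter.simps sqrt_majorant.simps)+
  also have "\<dots> = ?y (Suc (Suc n)) - ?y (Suc n)"
    by (simp add: power2_eq_square algebra_simps)
  finally show ?case using 1 by blast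
qed

lemma sqrt_iter_convergent:
  fixes R :: "'a::banach \<Rightarrow>\<^sub>L 'a"
  assumes R: "norm R \<le> 1"
  shows "convergent (sqrt_iter R)"
proof -
  let ?Y = "sqrt_iter R" and ?y = sqrt_majorant
  have step: "norm (?Y (Suc n) - ?Y n) \<le> ?y (Suc n) - ?y n" for n
    using sqrt_iter_bounds[OF R] by blast
  have dom: "norm (?Y (k + n) - ?Y k) \<le> ?y (k + n) - ?y k" for k n
  proof (induction n)
    case (Suc n)
    have "norm (?Y (k + Suc n) - ?Y k) = norm ((?Y (Suc (k + n)) - ?Y (k + n)) + (?Y (k + n) - ?Y k))"
      by (simp del: sqrt_iter.simps)
    also have "\<dots> \<le> norm (?Y (Suc (k + n)) - ?Y (k + n)) + norm (?Y (k + n) - ?Y k)"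
      by (rule norm_triangle_ineq)
    finally show ?case using Suc step[of "k + n"] by (simp del: sqrt_iter.simps sqrt_majorant.simps)
  qed simp
  have "?y n \<le> ?y (Suc n)" for n
    using step[of n] norm_ge_zero[of "?Y (Suc n) - ?Y n"] by linarith
  then have "incseq ?y" by (rule incseq_SucI)
  moreover have "Bseq ?y"
    using sqrt_majorant_bounds by (intro BseqI'[of _ 1]) simp
  ultimately have "convergent ?y" by (simp add: Bseq_monoseq_convergent incseq_imp_monoseq)
  then have Cy: "Cauchy ?y" by (rule convergent_Cauchy)
  have "Cauchy ?Y"
  proof (rule CauchyI)
    fix e :: real assume "e > 0"
    then obtain M where M: "\<And>i j. i \<ge> M \<Longrightarrow> j \<ge> M \<Longrightarrow> norm (?y i - ?y j) < e"
      using CauchyD[OF Cy] by blast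
    have le: "norm (?Y i - ?Y j) < e" if "i \<ge> j" "j \<ge> M" for i j
      using dom[of j "i - j"] M[of i j] that by simp
    have "norm (?Y i - ?Y j) < e" if "i \<ge> M" "j \<ge> M" for i j
      using le[of i j] le[of j i] that by (cases "i \<ge> j") (auto simp: norm_minus_commute)
    then show "\<exists>M. \<forall>i\<ge>M. \<forall>j\<ge>M. norm (?Y i - ?Y j) < e" by blast
  qed
  then show ?thesis by (rule Cauchy_convergent)
qed

lemma contraction_sqrt_complement:
  fixes R :: "'a::complex_hilbert \<Rightarrow>\<^sub>L 'a"
  assumes R: "norm R \<le> 1" and cl: "clinear_op R" and sa: "\<And>x y. inner (R x) y = inner x (R y)"
  shows "\<exists>Y. clinear_op Y \<and> (\<forall>x y. inner (blinfun_apply Y x) y = inner x (Y y)) \<and> norm Y \<le> 1 \<and>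
    2 *\<^sub>R Y = R + (Y o\<^sub>L Y) \<and> (\<forall>V. V o\<^sub>L R = R o\<^sub>L V \<longrightarrow> V o\<^sub>L Y = Y o\<^sub>L V)"
proof -
  obtain Y where Y: "sqrt_iter R \<longlonglongrightarrow> Y"
    using sqrt_iter_convergent[OF R] convergent_def by blast
  have Yx: "(\<lambda>n. sqrt_iter R n x) \<longlonglongrightarrow> Y x" for x
    by (intro tendsto_intros Y)
  have bl: "bounded_linear (\<lambda>x::'a. c *\<^sub>C x)" for c
    by (rule bounded_linear_intro[of _ "cmod c"]) (simp_all add: scaleC_add_right scaleC_scaleR norm_scaleC)
  have "sqrt_iter R n (c *\<^sub>C x) = c *\<^sub>C sqrt_iter R n x" for n c x
    using cl by (induction n arbitrary: x)
      (simp_all add: clinear_op_def blinfun.bilinear_simps scaleC_scaleR scaleC_add_right)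
  then have 1: "Y (c *\<^sub>C x) = c *\<^sub>C Y x" for c x
    using Yx[of "c *\<^sub>C x"] bounded_linear.tendsto[OF bl Yx[of x], of c] LIMSEQ_unique by auto
  have "inner (sqrt_iter R n x) y = inner x (sqrt_iter R n y)" for n x y
    by (induction n arbitrary: x y) (simp_all add: blinfun.bilinear_simps inner_add_left inner_add_right sa)
  then have 2: "inner (Y x) y = inner x (Y y)" for x y
    using tendsto_inner[OF Yx[of x] tendsto_const[of y]] tendsto_inner[OF tendsto_const[of x] Yx[of y]]
      LIMSEQ_unique by auto
  have 3: "norm Y \<le> 1"
    using sqrt_iter_bounds[OF R] sqrt_majorant_bounds
    by (intro LIMSEQ_le_const2[OF tendsto_norm[OF Y]]) (meson order_trans)
  have "(\<lambda>n. sqrt_iter R (Suc n)) \<longlonglongrightarrow> (1/2) *\<^sub>R (R + (Y o\<^sub>L Y))"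
    unfolding sqrt_iter.simps
    by (intro tendsto_intros bounded_bilinear.tendsto[OF bounded_bilinear_blinfun_compose] Y)
  then have "Y = (1/2) *\<^sub>R (R + (Y o\<^sub>L Y))"
    using LIMSEQ_Suc[OF Y] LIMSEQ_unique by blast
  then have 4: "2 *\<^sub>R Y = R + (Y o\<^sub>L Y)"
    by (metis (no_types) divide_self_if one_neq_zero pth_1 scaleR_scaleR times_divide_eq_right mult.right_neutral zero_neq_numeral)
  have 5: "V o\<^sub>L Y = Y o\<^sub>L V" if "V o\<^sub>L R = R o\<^sub>L V" for V
  proof -
    have "(\<lambda>n. V o\<^sub>L sqrt_iter R n) \<longlonglongrightarrow> (V o\<^sub>L Y)" "(\<lambda>n. sqrt_iter R n o\<^sub>L V) \<longlonglongrightarrow> (Y o\<^sub>L V)"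
      by (intro bounded_bilinear.tendsto[OF bounded_bilinear_blinfun_compose] Y tendsto_const)+
    then show ?thesis using sqrt_iter_commute[OF that] LIMSEQ_unique by auto
  qed
  have 6: "clinear_op Y" using 1 by (simp add: clinear_op_def)
  show ?thesis by (intro exI[of _ Y] conjI allI impI 2 3 4 5 6)
qed

lemma positive_op_clinear: "positive_op P \<Longrightarrow> clinear_op P"
  by (simp add: positive_op_def)

lemma positive_op_inner: "positive_op P \<Longrightarrow> inner (P x) x \<ge> 0"
  by (metis Re_cinner complex_nonneg_Reals_iff positive_op_def)

text \<open>
  Polarization: the quadratic form is real at \<open>\<i> x + y\<close>.
\<close>

lemma positive_op_symmetric:
  assumes "positive_op P"
  shows "inner (P x) y = inner x (P y)"
proof -
  have cl: "P (c *\<^sub>C x) = c *\<^sub>C P x" for c x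
    using assms by (simp add: positive_op_def clinear_op_def)
  have Im: "Im (cinner (P x) x) = 0" for x
    by (metis assms complex_nonneg_Reals_iff positive_op_def)
  have "Im (cinner (P (\<i> *\<^sub>C x + y)) (\<i> *\<^sub>C x + y)) = 0" by (rule Im)
  then have "Re (cinner (P x) y) = Re (cinner (P y) x)"
    using Im[of x] Im[of y]
    by (simp add: blinfun.add_right cl cinner_add_left cinner_add_right cinner_scaleC_left cinner_scaleC_right)
  then show ?thesis by (simp add: Re_cinner inner_commute)
qed

lemma adj_positive_op: "positive_op P \<Longrightarrow> adj P = P"
  by (intro adj_unique positive_op_clinear positive_op_symmetric)

lemma positive_opI:
  assumes cl: "clinear_op P" and sa: "\<And>x y. inner (P x) y = inner x (P y)"
    and pos: "\<And>x. inner (P x) x \<ge> 0"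
  shows "positive_op P"
proof -
  have "Im (cinner (P x) x) = 0" for x
  proof -
    have "cinner (P x) x = cnj (cinner (P x) x)"
      using cinner_eq_inner_adjoint[OF cl sa] cinner_commute by metis
    then show ?thesis by (metis Im_complex_of_real complex_cnj_complex_of_real Reals_cnj_iff Reals_cases complex_is_Real_iff)
  qed
  then show ?thesis
    using cl pos by (auto simp: positive_op_def complex_nonneg_Reals_iff Re_cinner)
qed

text \<open>
  The form \<open>\<langle>P z, z\<rangle>\<close> is nonnegative along the line \<open>y - s P y\<close> and vanishes at \<open>s = 0\<close>, so its derivative
  \<open>- 2 \<parallel>P y\<parallel>\<^sup>2\<close> cannot be negative.
\<close>

lemma positive_op_null:
  assumes P: "positive_op P" and "inner (P y) y = 0"
  shows "P y = 0"
proof -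
  let ?h = "P y"
  have "0 \<le> inner (P (y - s *\<^sub>R ?h)) (y - s *\<^sub>R ?h)" for s by (rule positive_op_inner[OF P])
  then have q: "2 * s * (norm ?h)\<^sup>2 \<le> s\<^sup>2 * inner (P ?h) ?h" for s
    using assms(2) positive_op_symmetric[OF P, of ?h y]
    unfolding power2_norm_eq_inner
    by (simp add: blinfun.bilinear_simps inner_simps inner_commute power2_eq_square algebra_simps)
  define d where "d = inner (P ?h) ?h"
  have d: "d \<ge> 0" unfolding d_def by (rule positive_op_inner[OF P])
  define n where "n = (norm ?h)\<^sup>2"
  define s where "s = n / (1 + d)"
  have sd: "s * (1 + d) = n" using d by (simp add: s_def)
  have "2 * s * n \<le> s\<^sup>2 * d" using q[of s] by (simp add: d_def n_def)
  also have "\<dots> \<le> s\<^sup>2 * (1 + d)" by (intro mult_left_mono) auto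
  also have "\<dots> = s * n" using sd by (simp add: power2_eq_square mult.assoc)
  finally have "s * n \<le> 0" by linarith
  then have "n * n \<le> 0" using d by (simp add: s_def divide_le_0_iff)
  then have "n = 0" by (metis mult_eq_0_iff not_square_less_zero order_le_less)
  then show ?thesis by (simp add: n_def)
qed

text \<open>
  After division by \<open>c \<ge> \<parallel>T\<^sup>*\<parallel>\<^sup>2\<close> the operator \<open>T\<^sup>* T\<close> becomes \<open>1 - R\<close> with \<open>\<parallel>R\<parallel> \<le> 1\<close>. The last clause, that the
  root inherits the commutant of \<open>T\<^sup>* T\<close>, is what uniqueness rests on.
\<close>

lemma positive_sqrt_exists:
  fixes T :: "'a::complex_hilbert \<Rightarrow>\<^sub>L 'a"
  assumes T: "clinear_op T"
  obtains P where "positive_op P" "P o\<^sub>L P = adj T o\<^sub>L T"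
    "\<And>V. V o\<^sub>L (adj T o\<^sub>L T) = (adj T o\<^sub>L T) o\<^sub>L V \<Longrightarrow> V o\<^sub>L P = P o\<^sub>L V"
proof -
  define S where "S = adj T o\<^sub>L T"
  define c where "c = 1 + (norm (adj T))\<^sup>2"
  have c: "c > 0" by (simp add: c_def add_pos_nonneg)
  define R where "R = id_blinfun - (1 / c) *\<^sub>R S"
  have Rx: "R x = x - (1 / c) *\<^sub>R S x" for x by (simp add: R_def blinfun.bilinear_simps)
  have Sin: "inner (S x) y = inner (T x) (T y)" for x y
    by (simp add: S_def inner_adj'[OF T])
  have clS: "clinear_op S" unfolding S_def by (intro clinear_compose clinear_adj T)
  have clR: "clinear_op R"
    using clS by (simp add: clinear_op_def Rx scaleC_diff_right scaleC_scaleR)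
  have saS: "inner (S x) y = inner x (S y)" for x y
    using Sin[of x y] Sin[of y x] by (simp add: inner_commute)
  have saR: "inner (R x) y = inner x (R y)" for x y
    by (simp add: Rx inner_simps saS)
  have nR: "norm R \<le> 1"
  proof (rule norm_blinfun_bound)
    fix x
    have "norm (S x) \<le> norm (adj T) * norm (T x)" by (simp add: S_def norm_blinfun)
    then have "(norm (S x))\<^sup>2 \<le> (norm (adj T) * norm (T x))\<^sup>2" by (rule power_mono) simp
    also have "\<dots> \<le> c * (norm (T x))\<^sup>2" by (simp add: c_def power_mult_distrib algebra_simps)
    finally have "(norm (S x))\<^sup>2 / c\<^sup>2 \<le> (norm (T x))\<^sup>2 / c"
      using c by (simp add: field_simps power2_eq_square)
    moreover have "(norm (R x))\<^sup>2 = (norm x)\<^sup>2 - 2 * ((norm (T x))\<^sup>2 / c) + (norm (S x))\<^sup>2 / c\<^sup>2"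
      using Sin[of x x]
      unfolding power2_norm_eq_inner
      by (simp add: Rx inner_simps inner_commute power2_eq_square)
    moreover have "(norm (T x))\<^sup>2 / c \<ge> 0" using c by simp
    ultimately have "(norm (R x))\<^sup>2 \<le> (norm x)\<^sup>2" by linarith
    then have "norm (R x) \<le> norm x" by (rule power2_le_imp_le) simp
    then show "norm (R x) \<le> 1 * norm x" by simp
  qed simp
  obtain Y where ex: "clinear_op Y \<and> (\<forall>x y. inner (blinfun_apply Y x) y = inner x (Y y)) \<and> norm Y \<le> 1 \<and>
    2 *\<^sub>R Y = R + (Y o\<^sub>L Y) \<and> (\<forall>V. V o\<^sub>L R = R o\<^sub>L V \<longrightarrow> V o\<^sub>L Y = Y o\<^sub>L V)"
    using contraction_sqrt_complement[OF nR clR saR] ..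
  note Y = ex[THEN conjunct1] ex[THEN conjunct2, THEN conjunct1, rule_format]
    ex[THEN conjunct2, THEN conjunct2, THEN conjunct1]
    ex[THEN conjunct2, THEN conjunct2, THEN conjunct2, THEN conjunct1]
    ex[THEN conjunct2, THEN conjunct2, THEN conjunct2, THEN conjunct2, rule_format]
  define P where "P = sqrt c *\<^sub>R (id_blinfun - Y)"
  have Px: "P x = sqrt c *\<^sub>R (x - Y x)" for x by (simp add: P_def blinfun.bilinear_simps)
  have YY: "Y (Y x) = 2 *\<^sub>R Y x - R x" for x
    using arg_cong[OF Y(4), of "\<lambda>Z. blinfun_apply Z x"] by (simp add: blinfun.bilinear_simps)
  show ?thesis
  proof
    show "positive_op P"
    proof (rule positive_opI)
      show "clinear_op P" using Y(1) by (simp add: clinear_op_def Px scaleC_diff_right scaleC_scaleR)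
      show "inner (P x) y = inner x (P y)" for x y by (simp add: Px inner_simps Y(2))
      show "inner (P x) x \<ge> 0" for x
      proof -
        have "inner (Y x) x \<le> norm (Y x) * norm x" by (rule norm_cauchy_schwarz)
        also have "\<dots> \<le> norm x * norm x"
          using norm_blinfun[of Y x] mult_right_mono[OF Y(3), of "norm x"]
          by (intro mult_right_mono) auto
        finally have "inner (x - Y x) x \<ge> 0" by (simp add: inner_diff_left dot_square_norm power2_eq_square)
        then show ?thesis using c by (simp add: Px)
      qed
    qed
    show "P o\<^sub>L P = adj T o\<^sub>L T"
    proof (rule blinfun_eqI)
      fix x
      have "P (P x) = c *\<^sub>R (x - 2 *\<^sub>R Y x + Y (Y x))"
        using c by (simp add: Px blinfun.bilinear_simps scaleR_diff_right scaleR_2 algebra_simps)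
      also have "\<dots> = S x" using c by (simp add: YY Rx)
      finally show "(P o\<^sub>L P) x = (adj T o\<^sub>L T) x" by (simp add: S_def)
    qed
    fix V :: "'a \<Rightarrow>\<^sub>L 'a" assume "V o\<^sub>L (adj T o\<^sub>L T) = (adj T o\<^sub>L T) o\<^sub>L V"
    then have "V (S x) = S (V x)" for x using commute_apply S_def by blast
    then have "V o\<^sub>L R = R o\<^sub>L V" by (intro commuteI) (simp add: Rx blinfun.bilinear_simps)
    then have "V (Y x) = Y (V x)" for x using Y(5) commute_apply by blast
    then show "V o\<^sub>L P = P o\<^sub>L V" by (intro commuteI) (simp add: Px blinfun.bilinear_simps)
  qed
qed

text \<open>
  For \<open>y = (P - Q) x\<close> the sum \<open>\<langle>P y, y\<rangle> + \<langle>Q y, y\<rangle>\<close> is \<open>\<langle>(P\<^sup>2 - Q\<^sup>2) x, y\<rangle> = 0\<close>, so \<open>P y = Q y = 0\<close> and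
  \<open>\<parallel>y\<parallel>\<^sup>2 = \<langle>x, (P - Q) y\<rangle> = 0\<close>.
\<close>

lemma commuting_positive_sqrt_unique:
  fixes P Q :: "'a::complex_hilbert \<Rightarrow>\<^sub>L 'a"
  assumes P: "positive_op P" and Q: "positive_op Q" and sq: "P o\<^sub>L P = Q o\<^sub>L Q" and comm: "P o\<^sub>L Q = Q o\<^sub>L P"
  shows "P = Q"
proof (rule blinfun_eqI)
  fix x
  define y where "y = P x - Q x"
  have PP: "P (P z) = Q (Q z)" for z
    using arg_cong[OF sq, of "\<lambda>Z. blinfun_apply Z z"] by simp
  have "P y + Q y = 0"
    using PP commute_apply[OF comm] by (simp add: y_def blinfun.bilinear_simps)
  then have "inner (P y) y + inner (Q y) y = 0" by (simp add: inner_add_left[symmetric])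
  then have "inner (P y) y = 0" "inner (Q y) y = 0"
    using positive_op_inner[OF P, of y] positive_op_inner[OF Q, of y] by linarith+
  then have "P y = 0" "Q y = 0" using positive_op_null P Q by blast+
  then have "inner y y = 0"
    using positive_op_symmetric[OF P, of x y] positive_op_symmetric[OF Q, of x y]
    by (subst (1) y_def) (simp add: inner_diff_left)
  then show "P x = Q x" by (simp add: y_def)
qed

text \<open>
  Any other root commutes with its own square, hence with the constructed root.
\<close>

lemma abs_op_positive_square:
  assumes T: "clinear_op T"
  shows "positive_op (abs_op T) \<and> abs_op T o\<^sub>L abs_op T = adj T o\<^sub>L T"
proof -
  obtain P where P: "positive_op P" "P o\<^sub>L P = adj T o\<^sub>L T"
    "\<And>V. V o\<^sub>L (adj T o\<^sub>L T) = (adj T o\<^sub>L T) o\<^sub>L V \<Longrightarrow> V o\<^sub>L P = P o\<^sub>L V"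
    using positive_sqrt_exists[OF T] by blast
  have uniq: "Q = P" if Q: "positive_op Q" "Q o\<^sub>L Q = adj T o\<^sub>L T" for Q
  proof (rule commuting_positive_sqrt_unique[OF Q(1) P(1)])
    show "Q o\<^sub>L Q = P o\<^sub>L P" by (rule trans[OF Q(2) P(2)[symmetric]])
    show "Q o\<^sub>L P = P o\<^sub>L Q"
      by (rule P(3)) (simp add: Q(2)[symmetric] blinfun_eqI)
  qed
  have "\<exists>!P. positive_op P \<and> P o\<^sub>L P = adj T o\<^sub>L T"
  proof (rule ex1I[of _ P])
    show "positive_op P \<and> P o\<^sub>L P = adj T o\<^sub>L T" using P(1,2) by (rule conjI)
    fix Q assume Q: "positive_op Q \<and> Q o\<^sub>L Q = adj T o\<^sub>L T"
    show "Q = P" by (rule uniq[OF conjunct1[OF Q] conjunct2[OF Q]])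
  qed
  from theI'[OF this] show ?thesis unfolding abs_op_def .
qed

section \<open>The Taylor spectrum of doubly commuting normal operators\<close>

text \<open>
  The sign that results from moving \<open>e\<^sub>i\<close> into its place in \<open>e\<^sub>S\<close>.
\<close>

definition ksign :: "'n::{finite,linorder} \<Rightarrow> 'n set \<Rightarrow> real"
  where "ksign i S = (-1) ^ card {j\<in>S. j < i}"

lemma ksign_square [simp]: "ksign i S * ksign i S = 1"
  by (simp add: ksign_def flip: power_mult_distrib)

lemma ksign_insert_self [simp]: "ksign i (insert i S) = ksign i S"
  unfolding ksign_def by (rule arg_cong[where f="\<lambda>A. (-1) ^ card A"]) auto

lemma ksign_remove_self [simp]: "ksign i (S - {i}) = ksign i S"
  unfolding ksign_def by (rule arg_cong[where f="\<lambda>A. (-1) ^ card A"]) auto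

lemma ksign_insert:
  assumes "k \<notin> S"
  shows "ksign i (insert k S) = (if k < i then - ksign i S else ksign i S)"
proof (cases "k < i")
  case True
  have "{j \<in> insert k S. j < i} = insert k {j \<in> S. j < i}" using True by auto
  then show ?thesis using True assms by (simp add: ksign_def)
next
  case False
  then have "{j \<in> insert k S. j < i} = {j \<in> S. j < i}" by auto
  then show ?thesis using False by (simp add: ksign_def)
qed

lemma ksign_remove:
  assumes "k \<in> S"
  shows "ksign i (S - {k}) = (if k < i then - ksign i S else ksign i S)"
  using ksign_insert[of k "S - {k}" i] assms by (auto simp: insert_absorb split: if_splits)

lemma ksign_swap_insert:
  assumes "i \<in> S" "k \<notin> S"
  shows "ksign k S * ksign i (insert k S) = - (ksign i S * ksign k (S - {i}))"
  using assms by (cases k i rule: linorder_cases) (auto simp: ksign_insert ksign_remove)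

lemma ksign_swap_remove:
  assumes "i \<in> S" "k \<in> S" "i \<noteq> k"
  shows "ksign k S * ksign i (S - {k}) = - (ksign i S * ksign k (S - {i}))"
  using assms by (cases k i rule: linorder_cases) (auto simp: ksign_remove)

definition koszul_d :: "('n::{finite,linorder} \<Rightarrow> 'a \<Rightarrow> 'a::real_vector) \<Rightarrow> ('n set \<Rightarrow> 'a) \<Rightarrow> 'n set \<Rightarrow> 'a"
  where "koszul_d M x S = (\<Sum>i\<in>S. ksign i S *\<^sub>R M i (x (S - {i})))"

text \<open>
  For \<open>B\<^sub>i = M\<^sub>i\<^sup>*\<close> this is the Hilbert space adjoint of \<open>koszul_d M\<close>.
\<close>

definition koszul_h :: "('n::{finite,linorder} \<Rightarrow> 'a \<Rightarrow> 'a::real_vector) \<Rightarrow> ('n set \<Rightarrow> 'a) \<Rightarrow> 'n set \<Rightarrow> 'a"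
  where "koszul_h B x S = (\<Sum>i\<in>-S. ksign i S *\<^sub>R B i (x (insert i S)))"

text \<open>
  The terms of the two products that remove one index and insert another occur with opposite signs;
  what is left are the terms that insert and remove the same index.
\<close>

lemma koszul_homotopy:
  assumes M: "\<And>i. linear (M i)" and B: "\<And>i. linear (B i)"
    and comm: "\<And>i k v. B k (M i v) = M i (B k v)"
  shows "koszul_d M (koszul_h B x) S + koszul_h B (koszul_d M x) S = (\<Sum>i\<in>UNIV. B i (M i (x S)))"
proof -
  define g where "g i k = (ksign i S * ksign k (S - {i})) *\<^sub>R M i (B k (x (insert k (S - {i}))))" for i k
  have c: "- (S - {i}) = insert i (- S)" if "i \<in> S" for i using that by auto
  have 1: "koszul_d M (koszul_h B x) S = (\<Sum>i\<in>S. B i (M i (x S)) + (\<Sum>k\<in>-S. g i k))"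
    unfolding koszul_d_def koszul_h_def
    by (intro sum.cong refl)
      (simp add: c insert_absorb linear_add[OF M] linear_sum[OF M] linear_scale[OF M] g_def comm
        scaleR_add_right scaleR_sum_right)
  have ins: "insert k S - {i} = insert k (S - {i})" if "i \<in> S" "k \<in> - S" for i k using that by auto
  have 2: "koszul_h B (koszul_d M x) S = (\<Sum>k\<in>-S. B k (M k (x S)) + (\<Sum>i\<in>S. - g i k))"
    unfolding koszul_d_def koszul_h_def
  proof (intro sum.cong refl)
    fix k assume k: "k \<in> - S"
    have "(\<Sum>i\<in>S. ksign k S *\<^sub>R ksign i (insert k S) *\<^sub>R B k (M i (x (insert k S - {i})))) = (\<Sum>i\<in>S. - g i k)"
      using k by (intro sum.cong refl) (simp add: g_def ins comm ksign_swap_insert scaleR_minus_left[symmetric] del: scaleR_minus_left)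
    then show "ksign k S *\<^sub>R B k (\<Sum>i\<in>insert k S. ksign i (insert k S) *\<^sub>R M i (x (insert k S - {i})))
        = B k (M k (x S)) + (\<Sum>i\<in>S. - g i k)"
      using k scaleR_scaleR[of "ksign k S" "ksign k S"]
      by (simp add: linear_add[OF B] linear_sum[OF B] linear_scale[OF B] scaleR_add_right scaleR_sum_right del: scaleR_scaleR)
  qed
  have "(\<Sum>i\<in>S. \<Sum>k\<in>-S. g i k) = (\<Sum>k\<in>-S. \<Sum>i\<in>S. g i k)" by (rule sum.swap)
  moreover have "(\<Sum>i\<in>UNIV. B i (M i (x S))) = (\<Sum>i\<in>S. B i (M i (x S))) + (\<Sum>i\<in>-S. B i (M i (x S)))"
    by (subst sum.union_disjoint[symmetric]) (auto simp: Compl_partition)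
  ultimately show ?thesis unfolding 1 2 by (simp add: sum.distrib sum_negf sum_subtractf)
qed

lemma koszul_d_d:
  assumes M: "\<And>i. linear (M i)" and comm: "\<And>i k v. M k (M i v) = M i (M k v)"
  shows "koszul_d M (koszul_d M x) S = 0"
proof -
  define g where "g i k = (if i = k then 0 else
    (ksign i S * ksign k (S - {i})) *\<^sub>R M i (M k (x (S - {i} - {k}))))" for i k
  have "koszul_d M (koszul_d M x) S = (\<Sum>i\<in>S. \<Sum>k\<in>S. g i k)"
    unfolding koszul_d_def
  proof (intro sum.cong refl)
    fix i assume "i \<in> S"
    have "(\<Sum>k\<in>S. g i k) = (\<Sum>k\<in>S - {i}. g i k)"
      by (rule sum.mono_neutral_right) (auto simp: g_def)
    also have "\<dots> = (\<Sum>k\<in>S - {i}. (ksign i S * ksign k (S - {i})) *\<^sub>R M i (M k (x (S - {i} - {k}))))"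
      by (intro sum.cong refl) (auto simp: g_def)
    finally show "ksign i S *\<^sub>R M i (\<Sum>k\<in>S - {i}. ksign k (S - {i}) *\<^sub>R M k (x (S - {i} - {k}))) = (\<Sum>k\<in>S. g i k)"
      by (simp add: linear_sum[OF M] linear_scale[OF M] scaleR_sum_right)
  qed
  moreover have "(\<Sum>i\<in>S. \<Sum>k\<in>S. g i k) = - (\<Sum>i\<in>S. \<Sum>k\<in>S. g i k)"
  proof -
    have anti: "g k i = - g i k" if "i \<in> S" "k \<in> S" for i k
    proof (cases "i = k")
      case False
      have "S - {i} - {k} = S - {k} - {i}" by auto
      then show ?thesis
        using False ksign_swap_remove[OF that False] by (simp add: g_def comm[of k i])
    qed (simp add: g_def)
    have "(\<Sum>i\<in>S. \<Sum>k\<in>S. g i k) = (\<Sum>k\<in>S. \<Sum>i\<in>S. g i k)" by (rule sum.swap)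
    also have "\<dots> = (\<Sum>k\<in>S. \<Sum>i\<in>S. - g k i)" by (intro sum.cong refl) (metis anti)
    finally show ?thesis by (simp add: sum_negf)
  qed
  ultimately have "2 *\<^sub>R koszul_d M (koszul_d M x) S = 0"
    unfolding scaleR_2 by (metis add.right_inverse)
  then show ?thesis by simp
qed

text \<open>
  For small \<open>e > 0\<close> the map \<open>x \<mapsto> x - e (D x - y)\<close> is a contraction, and its fixed point solves
  \<open>D x = y\<close>.
\<close>

lemma coercive_surjective:
  fixes D :: "'a::{real_inner,complete_space} \<Rightarrow> 'a"
  assumes D: "bounded_linear D" and c: "c > 0" and coercive: "\<And>x. c * (norm x)\<^sup>2 \<le> inner (D x) x"
  shows "surj D"
proof -
  interpret D: bounded_linear D by fact
  obtain K where K: "K > 0" "\<And>x. norm (D x) \<le> norm x * K" using D.pos_bounded by blast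
  define L where "L = K + c"
  have L: "L > 0" "norm (D x) \<le> L * norm x" for x
    using K c by (auto simp: L_def algebra_simps intro: order_trans[OF K(2)])
  define e where "e = c / L\<^sup>2"
  have e: "e > 0" using c L by (simp add: e_def)
  have eL: "e\<^sup>2 * L\<^sup>2 = e * c" using L c by (simp add: e_def power2_eq_square)
  define q where "q = sqrt (max 0 (1 - e * c))"
  have q: "0 \<le> q" "q < 1" using e c by (auto simp: q_def max_def)
  have contr: "norm (x - e *\<^sub>R D x) \<le> q * norm x" for x
  proof (rule power2_le_imp_le)
    have "(norm (D x))\<^sup>2 \<le> (L * norm x)\<^sup>2" by (intro power_mono L) simp
    then have "e\<^sup>2 * (norm (D x))\<^sup>2 \<le> e\<^sup>2 * (L\<^sup>2 * (norm x)\<^sup>2)"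
      by (intro mult_left_mono) (auto simp: power_mult_distrib)
    then have 1: "e\<^sup>2 * (norm (D x))\<^sup>2 \<le> (e * c) * (norm x)\<^sup>2" using eL by (simp add: mult.assoc[symmetric])
    have 2: "e * (c * (norm x)\<^sup>2) \<le> e * inner (D x) x" using coercive[of x] e by (simp add: mult_left_mono)
    have "(norm (x - e *\<^sub>R D x))\<^sup>2 = (norm x)\<^sup>2 - 2 * (e * inner (D x) x) + e\<^sup>2 * (norm (D x))\<^sup>2"
      unfolding power2_norm_eq_inner by (simp add: inner_simps inner_commute power2_eq_square)
    also have "\<dots> \<le> (1 - e * c) * (norm x)\<^sup>2" using 1 2 by (simp add: algebra_simps)
    also have "\<dots> \<le> max 0 (1 - e * c) * (norm x)\<^sup>2" by (intro mult_right_mono) auto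
    finally show "(norm (x - e *\<^sub>R D x))\<^sup>2 \<le> (q * norm x)\<^sup>2" by (simp add: q_def power_mult_distrib)
  qed (use q in simp)
  have "\<exists>x. D x = y" for y
  proof -
    define f where "f x = x - e *\<^sub>R (D x - y)" for x
    have "dist (f x) (f x') \<le> q * dist x x'" for x x'
      using contr[of "x - x'"] by (simp add: f_def dist_norm D.diff algebra_simps)
    then obtain x where "f x = x" using banach_fix_type[OF q] by blast
    then show ?thesis using e by (auto simp: f_def)
  qed
  then show ?thesis by (metis surjI)
qed

text \<open>
  The uniform boundedness principle in the form needed here: vectors whose norms grow geometrically
  are not pointwise bounded as functionals. The witness is a series whose \<open>n\<close>-th term is a multiple
  of \<open>y n\<close> of norm \<open>3\<^sup>-\<^sup>n\<close>. Its sign is chosen so that it does not cancel the partial sum, which makes the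
  value at \<open>y n\<close> at least \<open>(4/3)\<^sup>n\<close>; all later terms together take away at most half of that.
\<close>

lemma gliding_hump:
  fixes y :: "nat \<Rightarrow> 'a::{real_inner,complete_space}"
  assumes y: "\<And>n. norm (y n) = 4 ^ n"
  obtains x where "\<And>K. \<exists>n. \<bar>inner (y n) x\<bar> > K"
proof -
  \<comment> \<open>\<open>s v n\<close> has norm \<open>4\<^sup>n / 12\<^sup>n\<close>, and its inner product with \<open>y n\<close> has the sign of that of \<open>v\<close>\<close>
  define s :: "'a \<Rightarrow> nat \<Rightarrow> 'a" where "s v n = (if inner (y n) v \<ge> 0 then (1/12) ^ n *\<^sub>R y n else - ((1/12) ^ n *\<^sub>R y n))" for v n
  define X where "X = rec_nat (0::'a) (\<lambda>n v. v + s v n)"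
  have X: "X (Suc n) = X n + s (X n) n" for n by (simp add: X_def)
  have pw: "(1/12) ^ n * (4::real) ^ n = (1/3) ^ n" for n by (simp flip: power_mult_distrib)
  have ns: "norm (s v n) = (1/3) ^ n" for v n by (simp add: s_def y pw)
  have sign: "\<bar>inner (y n) (X (Suc n))\<bar> \<ge> (4/3) ^ n" for n
  proof -
    have "(1/12) ^ n * inner (y n) (y n) = (1/12) ^ n * (4 ^ n * 4 ^ n)"
      by (simp add: dot_square_norm y power2_eq_square)
    also have "\<dots> = ((1/12) * (4 * 4)) ^ n" by (simp only: power_mult_distrib)
    also have "\<dots> = (4/3) ^ n" by simp
    finally have "(1/12) ^ n * inner (y n) (y n) = (4/3) ^ n" .
    moreover have "(0::real) \<le> (4/3) ^ n" by simp
    ultimately show ?thesis unfolding X by (auto simp: s_def inner_add_right abs_if simp del: zero_le_power)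
  qed
  have tail: "norm (X (n + k) - X n) \<le> (3/2) * (1/3) ^ n * (1 - (1/3) ^ k)" for n k
  proof (induction k)
    case (Suc k)
    have "norm (X (n + Suc k) - X n) = norm ((X (n + k) - X n) + s (X (n + k)) (n + k))"
      by (simp add: X algebra_simps)
    also have "\<dots> \<le> norm (X (n + k) - X n) + (1/3) ^ (n + k)"
      by (rule order_trans[OF norm_triangle_ineq]) (simp add: ns)
    also have "\<dots> \<le> (3/2) * (1/3) ^ n * (1 - (1/3) ^ k) + (1/3) ^ (n + k)" using Suc by simp
    also have "\<dots> = (3/2) * (1/3) ^ n * (1 - (1/3) ^ Suc k)" by (simp add: power_add field_simps)
    finally show ?case .
  qed simp
  have tail': "norm (X m - X n) \<le> (3/2) * (1/3) ^ n" if "m \<ge> n" for m n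
  proof -
    have "norm (X m - X n) \<le> (3/2) * (1/3) ^ n * (1 - (1/3) ^ (m - n))"
      using tail[of n "m - n"] that by simp
    also have "\<dots> \<le> (3/2) * (1/3) ^ n * 1" by (intro mult_left_mono) auto
    finally show ?thesis by simp
  qed
  have "Cauchy X"
  proof (rule CauchyI)
    fix e :: real assume "e > 0"
    then obtain M where M: "(1/3::real) ^ M < e / (3/2)"
      using real_arch_pow_inv[of "e / (3/2)" "1/3"] by auto
    then have M': "(3/2) * (1/3) ^ M < e" by (simp add: field_simps)
    have le: "norm (X i - X j) < e" if "i \<ge> j" "j \<ge> M" for i j
    proof -
      have "(1/3::real) ^ j \<le> (1/3) ^ M" using that by (intro power_decreasing) auto
      then show ?thesis using tail'[OF that(1)] M' by linarith
    qed
    have "norm (X i - X j) < e" if "i \<ge> M" "j \<ge> M" for i j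
      using le[of i j] le[of j i] that by (cases "i \<ge> j") (auto simp: norm_minus_commute)
    then show "\<exists>M. \<forall>i\<ge>M. \<forall>j\<ge>M. norm (X i - X j) < e" by blast
  qed
  then obtain x where x: "X \<longlonglongrightarrow> x" using Cauchy_convergent convergent_def by blast
  have lim: "norm (x - X (Suc n)) \<le> (1/2) * (1/3) ^ n" for n
  proof (rule LIMSEQ_le_const2)
    show "(\<lambda>m. norm (X m - X (Suc n))) \<longlonglongrightarrow> norm (x - X (Suc n))" by (intro tendsto_intros x)
    show "\<exists>N. \<forall>m\<ge>N. norm (X m - X (Suc n)) \<le> (1/2) * (1/3) ^ n"
      using tail'[of "Suc n"] by (intro exI[of _ "Suc n"]) simp
  qed
  have big: "\<bar>inner (y n) x\<bar> \<ge> (1/2) * (4/3) ^ n" for n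
  proof -
    have "\<bar>inner (y n) (x - X (Suc n))\<bar> \<le> norm (y n) * norm (x - X (Suc n))" by (rule Cauchy_Schwarz_ineq2)
    also have "\<dots> \<le> 4 ^ n * ((1/2) * (1/3) ^ n)" unfolding y by (intro mult_left_mono lim) simp
    also have "\<dots> = (1/2) * (4/3) ^ n" by (simp add: power_divide)
    finally show ?thesis using sign[of n] unfolding inner_diff_right by linarith
  qed
  show ?thesis
  proof
    fix K :: real
    obtain n where "2 * K < (4/3) ^ n" using real_arch_pow[of "4/3" "2 * K"] by auto
    then show "\<exists>n. \<bar>inner (y n) x\<bar> > K" using big[of n] by (intro exI[of _ n]) linarith
  qed
qed

definition joint_approx_spectrum :: "('a::complex_hilbert \<Rightarrow>\<^sub>L 'a)^'n::finite \<Rightarrow> (complex^'n) set"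
  where "joint_approx_spectrum T = {z. \<forall>e>0. \<exists>x. x \<noteq> 0 \<and> (\<forall>i. norm ((T $ i) x - z $ i *\<^sub>C x) \<le> e * norm x)}"

lemma inner_residual:
  assumes "clinear_op T"
  shows "inner (T u - z *\<^sub>C u) v = inner u (adj T v - cnj z *\<^sub>C v)"
proof -
  have "inner (z *\<^sub>C u) v = inner u (cnj z *\<^sub>C v)"
    by (simp add: Re_cinner[symmetric] cinner_scaleC_left cinner_scaleC_right)
  then show ?thesis by (simp add: inner_simps inner_adj[OF assms])
qed

lemma bounded_linear_residual: "bounded_linear (\<lambda>v. blinfun_apply T v - z *\<^sub>C (v::'a::complex_hilbert))"
proof -
  have "bounded_linear (\<lambda>v::'a. z *\<^sub>C v)"
    by (rule bounded_linear_intro[of _ "cmod z"]) (simp_all add: scaleC_add_right scaleC_scaleR norm_scaleC)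
  then show ?thesis by (intro bounded_linear_sub blinfun.bounded_linear_right)
qed

text \<open>
  Write \<open>M\<^sub>i = T\<^sub>i - z\<^sub>i\<close>. Exactness at the top of the Koszul complex says that \<open>(w\<^sub>i) \<mapsto> \<Sum> M\<^sub>i w\<^sub>i\<close> is
  surjective; by uniform boundedness its adjoint \<open>y \<mapsto> (M\<^sub>i\<^sup>* y)\<close> is then bounded below, and by normality
  so is \<open>y \<mapsto> (M\<^sub>i y)\<close>. Conversely, if the latter is bounded below, then the operator \<open>\<Sum> M\<^sub>i\<^sup>* M\<^sub>i\<close> is
  invertible. It is homotopic to zero through the adjoint coboundary and commutes with the
  coboundary, so the complex is exact.
\<close>

theorem taylor_spectrum_doubly_commuting:
  fixes T :: "('a::complex_hilbert \<Rightarrow>\<^sub>L 'a)^('n::{finite,linorder})"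
  assumes normal: "\<And>i. normal_op (T $ i)" and comm: "\<And>i j. T $ i o\<^sub>L T $ j = T $ j o\<^sub>L T $ i"
    and dcomm: "\<And>i j. T $ i o\<^sub>L adj (T $ j) = adj (T $ j) o\<^sub>L T $ i"
  shows "taylor_spectrum T = joint_approx_spectrum T"
proof (intro set_eqI)
  fix z
  define M where "M i v = (T $ i) v - z $ i *\<^sub>C v" for i v
  define B where "B i v = adj (T $ i) v - cnj (z $ i) *\<^sub>C v" for i v
  have cl: "clinear_op (T $ i)" for i using normal normal_op_clinear by blast
  have blM: "bounded_linear (M i)" and blB: "bounded_linear (B i)" for i
    unfolding M_def B_def by (rule bounded_linear_residual)+
  have linM: "linear (M i)" and linB: "linear (B i)" for i
    using blM blB bounded_linear.linear by blast+
  have MB: "inner (M i u) v = inner u (B i v)" for i u v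
    unfolding M_def B_def by (rule inner_residual[OF cl])
  have nB: "norm (B i v) = norm (M i v)" for i v
    unfolding M_def B_def by (rule normal_residual[OF normal])
  have sc: "(T $ i) (c *\<^sub>C v) = c *\<^sub>C (T $ i) v" "adj (T $ i) (c *\<^sub>C v) = c *\<^sub>C adj (T $ i) v" for i c v
    using cl clinear_adj[OF cl] by (auto simp: clinear_op_def)
  have MM: "M k (M i v) = M i (M k v)" for i k v
    using commute_apply[OF comm[of k i]]
    by (simp add: M_def blinfun.diff_right scaleC_diff_right sc scaleC_scaleC mult.commute)
  have BM: "B k (M i v) = M i (B k v)" for i k v
    using commute_apply[OF dcomm[of i k]]
    by (simp add: M_def B_def blinfun.diff_right scaleC_diff_right sc scaleC_scaleC mult.commute)
  have kos: "koszul T z = koszul_d M"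
    by (intro ext) (simp add: koszul_def koszul_d_def ksign_def M_def)
  show "z \<in> taylor_spectrum T \<longleftrightarrow> z \<in> joint_approx_spectrum T"
  proof
    assume z: "z \<in> joint_approx_spectrum T"
    show "z \<in> taylor_spectrum T"
    proof (rule ccontr)
      assume "z \<notin> taylor_spectrum T"
      then have exact: "{x. koszul_d M x = (\<lambda>_. 0)} = range (koszul_d M)"
        by (simp add: taylor_spectrum_def kos)
      have row: "\<exists>w. (\<Sum>i\<in>UNIV. M i (w i)) = y" for y
      proof -
        define x :: "'n set \<Rightarrow> 'a" where "x S = (if S = UNIV then y else 0)" for S
        have "koszul_d M x = (\<lambda>_. 0)"
          unfolding koszul_d_def x_def by (intro ext sum.neutral ballI) (auto simp: linear_0[OF linM])
        then obtain w where w: "x = koszul_d M w" using exact by blast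
        have "y = (\<Sum>i\<in>UNIV. M i (ksign i UNIV *\<^sub>R w (UNIV - {i})))"
          using fun_cong[OF w, of UNIV] by (simp add: koszul_d_def x_def linear_scale[OF linM])
        then show ?thesis by metis
      qed
      have "\<exists>x. x \<noteq> 0 \<and> (\<forall>i. norm (M i x) \<le> (1/4) ^ n * norm x)" for n :: nat
        using z by (simp add: joint_approx_spectrum_def M_def)
      then obtain x where x: "\<And>n. x n \<noteq> 0" "\<And>n i. norm (M i (x n)) \<le> (1/4) ^ n * norm (x n)" by metis
      define y where "y n = (4 ^ n / norm (x n)) *\<^sub>R x n" for n
      have ny: "norm (y n) = 4 ^ n" for n using x(1) by (simp add: y_def)
      have My: "norm (M i (y n)) \<le> 1" for i n
      proof -
        have "norm (M i (y n)) = (4 ^ n / norm (x n)) * norm (M i (x n))"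
          by (simp add: y_def linear_scale[OF linM])
        also have "\<dots> \<le> (4 ^ n / norm (x n)) * ((1/4) ^ n * norm (x n))"
          by (intro mult_left_mono x) simp
        also have "\<dots> = 1" using x(1)[of n] by (simp add: power_divide)
        finally show ?thesis .
      qed
      obtain v where v: "\<And>K. \<exists>n. \<bar>inner (y n) v\<bar> > K" using gliding_hump[OF ny] by blast
      obtain w where w: "(\<Sum>i\<in>UNIV. M i (w i)) = v" using row by blast
      have "\<bar>inner (y n) v\<bar> \<le> (\<Sum>i\<in>UNIV. norm (w i))" for n
      proof -
        have "\<bar>inner (y n) v\<bar> = \<bar>\<Sum>i\<in>UNIV. inner (w i) (B i (y n))\<bar>"
          by (simp add: w[symmetric] inner_sum_right inner_commute[of "y n"] MB)
        also have "\<dots> \<le> (\<Sum>i\<in>UNIV. norm (w i) * norm (B i (y n)))"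
          by (rule order_trans[OF sum_abs]) (intro sum_mono Cauchy_Schwarz_ineq2)
        also have "\<dots> \<le> (\<Sum>i\<in>UNIV. norm (w i) * 1)"
          unfolding nB by (intro sum_mono mult_left_mono My) simp
        finally show ?thesis by simp
      qed
      then show False using v[of "\<Sum>i\<in>UNIV. norm (w i)"] by (meson not_less)
    qed
  next
    assume z: "z \<in> taylor_spectrum T"
    show "z \<in> joint_approx_spectrum T"
    proof (rule ccontr)
      assume "z \<notin> joint_approx_spectrum T"
      then obtain e where e: "e > 0" and below: "\<And>x. x \<noteq> 0 \<Longrightarrow> \<exists>i. norm (M i x) > e * norm x"
        by (auto simp: joint_approx_spectrum_def M_def not_le)
      define D where "D v = (\<Sum>i\<in>UNIV. B i (M i v))" for v
      have blD: "bounded_linear D"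
        unfolding D_def by (intro bounded_linear_sum bounded_linear_compose[OF blB blM])
      have coer: "e\<^sup>2 * (norm v)\<^sup>2 \<le> inner (D v) v" for v
      proof (cases "v = 0")
        case False
        then obtain i where i: "norm (M i v) > e * norm v" using below by blast
        have "(e * norm v)\<^sup>2 \<le> (norm (M i v))\<^sup>2" using i e by (intro power_mono) auto
        also have "\<dots> \<le> (\<Sum>i\<in>UNIV. (norm (M i v))\<^sup>2)" by (rule member_le_sum) auto
        also have "\<dots> = inner (D v) v"
          unfolding D_def inner_sum_left power2_norm_eq_inner by (simp add: MB inner_commute)
        finally show ?thesis by (simp add: power_mult_distrib)
      qed (simp add: linear_0[OF bounded_linear.linear[OF blD]])
      have surjD: "surj D" by (rule coercive_surjective[OF blD _ coer]) (use e in simp)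
      have injD: "v = w" if "D v = D w" for v w
      proof -
        have "D (v - w) = 0" using that by (simp add: linear_diff[OF bounded_linear.linear[OF blD]])
        then have "e\<^sup>2 * (norm (v - w))\<^sup>2 \<le> 0" using coer[of "v - w"] by simp
        then show ?thesis using e by (simp add: mult_le_0_iff)
      qed
      have DM: "D (M i v) = M i (D v)" for i v
        unfolding D_def by (simp add: linear_sum[OF linM] BM MM[of _ i])
      have Dd: "D (koszul_d M w S) = koszul_d M (\<lambda>S. D (w S)) S" for w S
        using bounded_linear.linear[OF blD]
        by (simp add: koszul_d_def linear_sum linear_scale DM)
      have "x \<in> range (koszul_d M)" if x: "koszul_d M x = (\<lambda>_. 0)" for x
      proof -
        define w where "w S = (SOME u. D u = koszul_h B x S)" for S
        have w: "D (w S) = koszul_h B x S" for S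
          unfolding w_def by (rule someI_ex) (metis surjD surjD surj_def)
        have "D (koszul_d M w S) = D (x S)" for S
        proof -
          have "koszul_h B (koszul_d M x) S = 0"
            unfolding x by (simp add: koszul_h_def linear_0[OF linB])
          then have "koszul_d M (koszul_h B x) S = D (x S)"
            using koszul_homotopy[of M B x S, OF linM linB BM] by (simp add: D_def)
          then show ?thesis by (simp add: Dd w)
        qed
        then have "x = koszul_d M w" using injD by (metis (no_types, lifting) ext)
        then show ?thesis by (metis rangeI)
      qed
      moreover have "koszul_d M (koszul_d M x) = (\<lambda>_. 0)" for x
        by (rule ext) (rule koszul_d_d[OF linM MM])
      ultimately have "{x. koszul_d M x = (\<lambda>_. 0)} = range (koszul_d M)" by auto
      then show False using z by (simp add: taylor_spectrum_def kos)
    qed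
  qed
qed

section \<open>Distinguished boundaries and peak functions\<close>

lemma vector_4 [simp]:
  "(vector [x1, x2, x3, x4] :: ('a::zero)^4) $ 1 = x1"
  "(vector [x1, x2, x3, x4] :: ('a::zero)^4) $ 2 = x2"
  "(vector [x1, x2, x3, x4] :: ('a::zero)^4) $ 3 = x3"
  "(vector [x1, x2, x3, x4] :: ('a::zero)^4) $ 4 = x4"
  unfolding vector_def by simp_all

lemma vector_4_eqI:
  fixes v w :: "'a^4"
  assumes "v $ 1 = w $ 1" "v $ 2 = w $ 2" "v $ 3 = w $ 3" "v $ 4 = w $ 4"
  shows "v = w"
  using assms by (simp add: vec_eq_iff forall_4)

text \<open>
  A closed boundary contains each point at which some function peaks, because that function attains
  its maximum modulus nowhere else.
\<close>

lemma distinguished_boundary_eqI: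
  assumes "closed K" "K \<subseteq> closure \<Omega>"
    and max: "\<And>f. continuous_on (closure \<Omega>) f \<Longrightarrow> analytic_several f \<Omega> \<Longrightarrow>
      \<exists>w\<in>K. \<forall>z\<in>closure \<Omega>. cmod (f z) \<le> cmod (f w)"
    and peak: "\<And>w. w \<in> K \<Longrightarrow> \<exists>f. continuous_on (closure \<Omega>) f \<and> analytic_several f \<Omega> \<and>
      (\<forall>z\<in>closure \<Omega>. z \<noteq> w \<longrightarrow> cmod (f z) < cmod (f w))"
  shows "distinguished_boundary \<Omega> = K"
  unfolding distinguished_boundary_def
proof (rule Least_equality)
  show "closed K \<and> K \<subseteq> closure \<Omega> \<and> (\<forall>f. continuous_on (closure \<Omega>) f \<longrightarrow> analytic_several f \<Omega> \<longrightarrow>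
        (\<exists>w\<in>K. \<forall>z\<in>closure \<Omega>. cmod (f z) \<le> cmod (f w)))"
    using assms(1,2) max by blast
  fix B assume B: "closed B \<and> B \<subseteq> closure \<Omega> \<and> (\<forall>f. continuous_on (closure \<Omega>) f \<longrightarrow> analytic_several f \<Omega> \<longrightarrow>
        (\<exists>w\<in>B. \<forall>z\<in>closure \<Omega>. cmod (f z) \<le> cmod (f w)))"
  show "K \<subseteq> B"
  proof
    fix w assume w: "w \<in> K"
    then obtain f where f: "continuous_on (closure \<Omega>) f" "analytic_several f \<Omega>"
      "\<And>z. z \<in> closure \<Omega> \<Longrightarrow> z \<noteq> w \<Longrightarrow> cmod (f z) < cmod (f w)"
      using peak by blast
    with B obtain w' where w': "w' \<in> B" "\<forall>z\<in>closure \<Omega>. cmod (f z) \<le> cmod (f w')" by blast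
    have "w' = w" using f(3)[of w'] w' B w assms(2) by (metis not_less subsetD)
    then show "w \<in> B" using w' by simp
  qed
qed

text \<open>
  The maximum principle is always applied along a complex line, where it reduces to one variable.
  Only the open disc has to lie in \<open>\<Omega>\<close>; its bounding circle may touch the boundary.
\<close>

lemma max_modulus_affine_disc:
  fixes f :: "complex^'n \<Rightarrow> complex"
  assumes cont: "continuous_on (closure \<Omega>) f" and an: "analytic_several f \<Omega>"
    and disc: "\<And>\<zeta>. cmod \<zeta> < r \<Longrightarrow> p + \<zeta> *s q \<in> \<Omega>" and r: "r > 0" and \<zeta>0: "cmod \<zeta>0 \<le> r"
  obtains \<zeta>1 where "cmod \<zeta>1 = r" "cmod (f (p + \<zeta>0 *s q)) \<le> cmod (f (p + \<zeta>1 *s q))"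
    "p + \<zeta>1 *s q \<in> closure \<Omega>"
proof -
  define \<phi> where "\<phi> \<zeta> = p + \<zeta> *s q" for \<zeta>
  have lin: "bounded_linear (\<lambda>\<zeta>::complex. \<zeta> *s q)"
    by (rule linear_conv_bounded_linear[THEN iffD1], rule linearI)
      (simp_all add: vec_eq_iff algebra_simps)
  have d\<phi>: "(\<phi> has_derivative (\<lambda>\<zeta>. \<zeta> *s q)) (at \<zeta>)" for \<zeta>
    unfolding \<phi>_def using bounded_linear.has_derivative[OF lin has_derivative_ident]
    by (auto intro!: derivative_eq_intros)
  have c\<phi>: "continuous_on S \<phi>" for S
    using d\<phi> has_derivative_continuous continuous_at_imp_continuous_on by blast
  have cl: "\<phi> \<zeta> \<in> closure \<Omega>" if "cmod \<zeta> \<le> r" for \<zeta>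
  proof -
    have "\<phi> ` closure (ball 0 r) \<subseteq> closure \<Omega>"
      by (rule image_closure_subset[OF c\<phi>]) (use disc in \<open>auto simp: \<phi>_def intro!: subsetD[OF closure_subset]\<close>)
    then show ?thesis using that r by auto
  qed
  have holo: "(\<lambda>\<zeta>. f (\<phi> \<zeta>)) holomorphic_on ball 0 r"
  proof (rule holomorphic_onI)
    fix \<zeta> :: complex assume "\<zeta> \<in> ball 0 r"
    then have "\<phi> \<zeta> \<in> \<Omega>" using disc by (auto simp: \<phi>_def)
    then obtain D where D: "(f has_derivative D) (at (\<phi> \<zeta>))" "\<And>c v. D (c *s v) = c * D v"
      using an by (auto simp: analytic_several_def)
    have "((\<lambda>\<zeta>. f (\<phi> \<zeta>)) has_derivative (\<lambda>h. D (h *s q))) (at \<zeta>)"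
      using has_derivative_compose[OF d\<phi> D(1)] .
    then have "((\<lambda>\<zeta>. f (\<phi> \<zeta>)) has_field_derivative D q) (at \<zeta>)"
      by (simp add: has_field_derivative_def D(2) mult.commute[of _ "D q"])
    then show "(\<lambda>\<zeta>. f (\<phi> \<zeta>)) field_differentiable at \<zeta> within ball 0 r"
      using field_differentiable_at_within field_differentiable_def by blast
  qed
  have cf: "continuous_on (cball 0 r) (\<lambda>\<zeta>. f (\<phi> \<zeta>))"
    by (rule continuous_on_compose2[OF cont c\<phi>]) (use cl in auto)
  have "sphere (0::complex) r \<noteq> {}" using r by simp
  moreover have "continuous_on (sphere 0 r) (\<lambda>\<zeta>. cmod (f (\<phi> \<zeta>)))"
    by (intro continuous_on_norm continuous_on_subset[OF cf]) auto
  ultimately obtain \<zeta>1 where \<zeta>1: "\<zeta>1 \<in> sphere 0 r"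
    "\<And>\<zeta>. \<zeta> \<in> sphere 0 r \<Longrightarrow> cmod (f (\<phi> \<zeta>)) \<le> cmod (f (\<phi> \<zeta>1))"
    using continuous_attains_sup[OF compact_sphere] by blast
  have "cmod (f (\<phi> \<zeta>0)) \<le> cmod (f (\<phi> \<zeta>1))"
  proof (rule maximum_modulus_frontier[where S = "cball 0 r" and f = "\<lambda>\<zeta>. f (\<phi> \<zeta>)"])
    show "(\<lambda>\<zeta>. f (\<phi> \<zeta>)) holomorphic_on interior (cball 0 r)" using holo by simp
    show "continuous_on (closure (cball 0 r)) (\<lambda>\<zeta>. f (\<phi> \<zeta>))" using cf by simp
    show "cmod (f (\<phi> z)) \<le> cmod (f (\<phi> \<zeta>1))" if "z \<in> frontier (cball 0 r)" for z
      using \<zeta>1(2) that r by (simp add: frontier_cball)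
  qed (use \<zeta>0 in auto)
  then show ?thesis using that[of \<zeta>1] \<zeta>1(1) cl[of \<zeta>1] by (auto simp: \<phi>_def)
qed

lemma affine_analytic_several:
  fixes w :: "complex^'n"
  shows "analytic_several (\<lambda>z. c + (\<Sum>i\<in>UNIV. w $ i * z $ i)) \<Omega>"
    and "continuous_on S (\<lambda>z. c + (\<Sum>i\<in>UNIV. w $ i * z $ i))"
proof -
  have "((\<lambda>z::complex^'n. c + (\<Sum>i\<in>UNIV. w $ i * z $ i)) has_derivative (\<lambda>v. (\<Sum>i\<in>UNIV. w $ i * v $ i))) (at z)" for z
    by (auto intro!: derivative_eq_intros bounded_linear.has_derivative[OF bounded_linear_vec_nth])
  moreover have "(\<Sum>i\<in>UNIV. w $ i * (d *s v) $ i) = d * (\<Sum>i\<in>UNIV. w $ i * v $ i)" for d v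
    by (simp add: sum_distrib_left mult_ac)
  ultimately show "analytic_several (\<lambda>z. c + (\<Sum>i\<in>UNIV. w $ i * z $ i)) \<Omega>"
    unfolding analytic_several_def by blast
  show "continuous_on S (\<lambda>z. c + (\<Sum>i\<in>UNIV. w $ i * z $ i))"
    by (intro continuous_intros)
qed

lemma unit_inner_eq_1:
  fixes x y :: "'a::real_inner"
  assumes "norm x \<le> 1" "norm y \<le> 1" "inner x y = 1"
  shows "x = y"
proof -
  have "(norm (x - y))\<^sup>2 = (norm x)\<^sup>2 + (norm y)\<^sup>2 - 2 * inner x y"
    unfolding power2_norm_eq_inner by (simp add: inner_simps inner_commute)
  moreover have "(norm x)\<^sup>2 \<le> 1" "(norm y)\<^sup>2 \<le> 1" using assms by (simp_all add: abs_square_le_1)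
  ultimately have "(norm (x - y))\<^sup>2 \<le> 0" using assms by linarith
  then show ?thesis by simp
qed

lemma sum_cnj_mult_inner: "Re (\<Sum>i\<in>UNIV. cnj (w $ i) * z $ i) = inner (w::complex^'n) z"
  by (simp add: inner_vec_def inner_complex_def)

lemma cmod_sum_cnj_mult_le: "cmod (\<Sum>i\<in>UNIV. cnj (w $ i) * z $ i) \<le> norm w * norm (z::complex^'n)"
proof -
  define s where "s = (\<Sum>i\<in>UNIV. cnj (w $ i) * z $ i)"
  show ?thesis
  proof (cases "s = 0")
    case False
    define c where "c = cnj s / cmod s"
    have c: "cmod c = 1" using False by (simp add: c_def norm_divide)
    have "norm (c *s z) = norm z"
      by (simp add: norm_vec_def norm_mult c)
    moreover have "(\<Sum>i\<in>UNIV. cnj (w $ i) * (c *s z) $ i) = c * s"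
      by (simp add: s_def sum_distrib_left mult_ac)
    moreover have "c * s = cmod s"
      using False by (simp add: c_def complex_norm_square[of s, simplified] power2_eq_square[symmetric] field_simps)
    ultimately show ?thesis
      using sum_cnj_mult_inner[of w "c *s z"] norm_cauchy_schwarz[of w "c *s z"] by (simp add: s_def)
  qed (use s_def in simp)
qed

text \<open>
  The midpoint of \<open>1\<close> and another point of the closed unit disc has modulus \<open>1\<close> only if the two points
  agree, so \<open>1 + p\<close> peaks where \<open>p\<close> takes the value \<open>1\<close>.
\<close>

lemma norm_midpoint_one_eq_1:
  fixes z :: complex
  assumes "cmod z \<le> 1" "1 \<le> cmod (1 + z) / 2"
  shows "z = 1"
proof -
  have "(cmod (1 + z))\<^sup>2 \<ge> 2\<^sup>2" using assms by (intro power_mono) auto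
  moreover have "(cmod (1 + z))\<^sup>2 = 1 + 2 * Re z + (cmod z)\<^sup>2"
    unfolding cmod_power2 by (simp add: power2_eq_square algebra_simps)
  moreover have "(cmod z)\<^sup>2 \<le> 1" using assms by (simp add: abs_square_le_1)
  ultimately have "inner 1 z \<ge> 1" by (simp add: inner_complex_def)
  moreover have "inner 1 z \<le> 1" using norm_cauchy_schwarz[of 1 z] assms by simp
  ultimately show ?thesis using unit_inner_eq_1[of 1 z] assms by simp
qed

text \<open>
  The maximum principle on the discs through the centre bounds every function by its values on the
  sphere, and \<open>1 + \<langle>z, w\<rangle>\<close> peaks at the point \<open>w\<close> of the sphere.
\<close>

theorem distinguished_boundary_ball2: "distinguished_boundary ball2 = sphere 0 1"
proof (rule distinguished_boundary_eqI)
  have cl: "closure ball2 = cball 0 1" by (simp add: ball2_def)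
  show "closed (sphere (0::complex^2) 1)" by simp
  show "sphere 0 1 \<subseteq> closure ball2" unfolding cl by auto
  show "\<exists>w\<in>sphere 0 1. \<forall>z\<in>closure ball2. cmod (f z) \<le> cmod (f w)"
    if f: "continuous_on (closure ball2) f" "analytic_several f ball2" for f
  proof -
    have "continuous_on (sphere 0 1) (\<lambda>z. cmod (f z))"
      by (intro continuous_on_norm continuous_on_subset[OF f(1)]) (auto simp: cl)
    moreover have "sphere (0::complex^2) 1 \<noteq> {}" by simp
    ultimately obtain w where w: "w \<in> sphere 0 1" "\<And>z. z \<in> sphere 0 1 \<Longrightarrow> cmod (f z) \<le> cmod (f w)"
      using continuous_attains_sup[OF compact_sphere] by blast
    have "cmod (f z) \<le> cmod (f w)" if z: "z \<in> closure ball2" for z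
    proof -
      obtain q :: "complex^2" and \<zeta>0 where q: "norm q = 1" "z = \<zeta>0 *s q" "cmod \<zeta>0 \<le> 1"
      proof (cases "z = 0")
        case True
        then show ?thesis using that[of "axis 1 1" 0] by (simp add: norm_eq_sqrt_inner inner_axis_axis)
      next
        case False
        have "of_real (norm z) *s ((1 / norm z) *\<^sub>R z) = z"
          using False by (simp add: vec_eq_iff) (simp add: scaleR_conv_of_real)
        then show ?thesis using that[of "(1 / norm z) *\<^sub>R z" "of_real (norm z)"] z False
          by (auto simp: cl)
      qed
      have ns: "norm (\<zeta> *s q) = cmod \<zeta>" for \<zeta>
        using q(1) by (simp add: norm_vec_def norm_mult L2_set_right_distrib[symmetric])
      obtain \<zeta>1 where "cmod \<zeta>1 = 1" "cmod (f (0 + \<zeta>0 *s q)) \<le> cmod (f (0 + \<zeta>1 *s q))"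
        using max_modulus_affine_disc[OF f, of 1 0 q \<zeta>0] q(3) by (auto simp: ball2_def ns)
      then show ?thesis using w(2)[of "\<zeta>1 *s q"] q(2) by (simp add: ns)
    qed
    then show ?thesis using w(1) by blast
  qed
  show "\<exists>f. continuous_on (closure ball2) f \<and> analytic_several f ball2 \<and>
      (\<forall>z\<in>closure ball2. z \<noteq> w \<longrightarrow> cmod (f z) < cmod (f w))" if w: "w \<in> sphere 0 1" for w
  proof -
    define s where "s z = (\<Sum>i\<in>UNIV. cnj (w $ i) * z $ i)" for z
    have s: "s z = (\<Sum>i\<in>UNIV. (\<chi> i. cnj (w $ i)) $ i * z $ i)" for z by (simp add: s_def)
    have sw: "s w = 1"
    proof (rule norm_midpoint_one_eq_1)
      show "cmod (s w) \<le> 1" using cmod_sum_cnj_mult_le[of w w] w by (simp add: s_def)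
      have "Re (1 + s w) \<le> cmod (1 + s w)" by (rule complex_Re_le_cmod)
      then show "1 \<le> cmod (1 + s w) / 2" using sum_cnj_mult_inner[of w w] w by (simp add: s_def dot_square_norm)
    qed
    have "cmod (1 + s z) < cmod (1 + s w)" if "z \<in> closure ball2" "z \<noteq> w" for z
    proof (rule ccontr)
      assume "\<not> ?thesis"
      then have 1: "1 \<le> cmod (1 + s z) / 2" using sw by simp
      have nz: "norm z \<le> 1" using that by (simp add: cl)
      then have "cmod (s z) \<le> 1" using cmod_sum_cnj_mult_le[of w z] w by (simp add: s_def)
      then have "s z = 1" using 1 by (rule norm_midpoint_one_eq_1)
      then have "inner w z = 1" using sum_cnj_mult_inner[of w z] by (simp add: s_def)
      then show False using unit_inner_eq_1[of w z] nz w that by auto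
    qed
    then show ?thesis
      using affine_analytic_several[where c = 1 and w = "\<chi> i. cnj (w $ i)"] unfolding s[symmetric] by blast
  qed
qed

section \<open>The tetrablock and the hexablock\<close>

text \<open>
  Throughout, the polynomial that defines the tetrablock is written as \<open>P - z\<^sub>1 Q\<close> with
  \<open>P = 1 - x\<^sub>2 z\<^sub>2\<close> and \<open>Q = x\<^sub>1 - x\<^sub>3 z\<^sub>2\<close>. This isolates the first variable, over which the supremum that
  defines the hexablock can be computed.
\<close>

lemma tetrablock_iff:
  "vector [x1, x2, x3] \<in> tetrablock \<longleftrightarrow>
    (\<forall>z1 z2. cmod z1 \<le> 1 \<longrightarrow> cmod z2 \<le> 1 \<longrightarrow> (1 - x2 * z2) - z1 * (x1 - x3 * z2) \<noteq> 0)"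
  unfolding tetrablock_def by (simp add: algebra_simps)

lemma tetrablock_swap:
  assumes "vector [x1, x2, x3] \<in> tetrablock"
  shows "vector [x2, x1, x3] \<in> tetrablock"
proof -
  have "1 - x2 * z1 - x1 * z2 + x3 * z1 * z2 \<noteq> 0" if "cmod z1 \<le> 1" "cmod z2 \<le> 1" for z1 z2
  proof -
    have "1 - x1 * z2 - x2 * z1 + x3 * z2 * z1 \<noteq> 0"
      using assms that by (simp add: tetrablock_def)
    then show ?thesis by (simp add: algebra_simps)
  qed
  then show ?thesis by (simp add: tetrablock_def)
qed

text \<open>
  Otherwise \<open>z\<^sub>1 = P / Q\<close> would be a zero of \<open>P - z\<^sub>1 Q\<close> in the closed disc; if \<open>Q = 0\<close>, then \<open>P = 0\<close>
  as well and every \<open>z\<^sub>1\<close> is a zero.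
\<close>

lemma tetrablock_num_less_den:
  assumes x: "vector [x1, x2, x3] \<in> tetrablock" and z: "cmod z \<le> 1"
  shows "cmod (x1 - x3 * z) < cmod (1 - x2 * z)"
proof (rule ccontr)
  let ?P = "1 - x2 * z" and ?Q = "x1 - x3 * z"
  assume "\<not> ?thesis"
  then have le: "cmod ?P \<le> cmod ?Q" by simp
  have nz: "?P - w * ?Q \<noteq> 0" if "cmod w \<le> 1" for w
    using x that z unfolding tetrablock_iff by blast
  have "?Q \<noteq> 0" using nz[of 0] le by auto
  then have "?P - (?P / ?Q) * ?Q = 0" "cmod (?P / ?Q) \<le> 1" using le by (auto simp: norm_divide divide_le_eq)
  then show False using nz by blast
qed

lemma cmod_diff_mult_square:
  "(cmod (p - q * w))\<^sup>2 = (cmod p)\<^sup>2 - 2 * Re (cnj p * q * w) + (cmod q)\<^sup>2 * (cmod w)\<^sup>2"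
proof -
  have "complex_of_real ((cmod (p - q * w))\<^sup>2) =
      of_real ((cmod p)\<^sup>2) - (cnj p * q * w + cnj (cnj p * q * w)) + of_real ((cmod q)\<^sup>2) * of_real ((cmod w)\<^sup>2)"
    unfolding complex_norm_square by (simp add: algebra_simps)
  also have "\<dots> = of_real ((cmod p)\<^sup>2 - 2 * Re (cnj p * q * w) + (cmod q)\<^sup>2 * (cmod w)\<^sup>2)"
    unfolding complex_add_cnj by simp
  finally show ?thesis using of_real_eq_iff by blast
qed

text \<open>
  The inequality \<open>|Q|\<^sup>2 < |P|\<^sup>2\<close> on the unit circle, at the point where the mixed term is largest.
\<close>

lemma tetrablock_discriminant:
  assumes x: "vector [x1, x2, x3] \<in> tetrablock"
  shows "2 * cmod (x2 - cnj x1 * x3) < 1 + (cmod x2)\<^sup>2 - (cmod x1)\<^sup>2 - (cmod x3)\<^sup>2"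
proof -
  define b where "b = x2 - cnj x1 * x3"
  define z where "z = (if b = 0 then 1 else cnj b / cmod b)"
  have z: "cmod z = 1" by (simp add: z_def norm_divide)
  have bz: "Re (b * z) = cmod b"
  proof (cases "b = 0")
    case False
    then have "b * z = cmod b"
      by (simp add: z_def complex_norm_square[of b, simplified, symmetric] power2_eq_square)
    then show ?thesis by simp
  qed simp
  have "(cmod (x1 - x3 * z))\<^sup>2 < (cmod (1 - x2 * z))\<^sup>2"
    using tetrablock_num_less_den[OF x, of z] z by (intro power_strict_mono) auto
  moreover have "Re (b * z) = Re (x2 * z) - Re (cnj x1 * x3 * z)"
    by (simp add: b_def left_diff_distrib)
  ultimately show ?thesis
    using bz z unfolding cmod_diff_mult_square b_def[symmetric] by simp
qed

text \<open>
  The sum of the previous inequality and of its image under exchanging \<open>x\<^sub>1\<close> and \<open>x\<^sub>2\<close>. It shows that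
  \<open>|x\<^sub>3| \<le> 1\<close>, and that \<open>|x\<^sub>3| = 1\<close> forces \<open>x\<^sub>2 = cnj x\<^sub>1 x\<^sub>3\<close> on the closure.
\<close>

lemma tetrablock_defect:
  assumes x: "vector [x1, x2, x3] \<in> tetrablock"
  shows "cmod (x2 - cnj x1 * x3) \<le> 1 - (cmod x3)\<^sup>2"
  using tetrablock_discriminant[OF x] tetrablock_discriminant[OF tetrablock_swap[OF x]]
    norm_ge_zero[of "x1 - cnj x2 * x3"] by linarith

lemma hexablock_iff:
  "vector [a, x1, x2, x3] \<in> hexablock \<longleftrightarrow> vector [x1, x2, x3] \<in> tetrablock \<and>
    (SUP (z1, z2) \<in> ball 0 1 \<times> ball 0 1.
      cmod (a * of_real (sqrt ((1 - (cmod z1)\<^sup>2) * (1 - (cmod z2)\<^sup>2))) /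
            (1 - x1 * z1 - x2 * z2 + x3 * z1 * z2))) < 1"
proof -
  have "vector [a, x1, x2, x3] = (vector [b, y1, y2, y3] :: complex^4) \<longleftrightarrow> a = b \<and> x1 = y1 \<and> x2 = y2 \<and> x3 = y3"
    for b y1 y2 y3
    by (simp add: vec_eq_iff forall_4)
  then show ?thesis unfolding hexablock_def by auto
qed

text \<open>
  The difference of the two sides is at least \<open>(|w| |p| - |q|)\<^sup>2\<close>. Together with the choice
  \<open>w = cnj (q / p)\<close>, which gives equality when \<open>|q| < |p|\<close>, it evaluates the supremum over the first
  disc variable in the definition of the hexablock.
\<close>

lemma hexablock_kernel_le:
  assumes "cmod w < 1"
  shows "(1 - (cmod w)\<^sup>2) * ((cmod p)\<^sup>2 - (cmod q)\<^sup>2) \<le> (cmod (p - w * q))\<^sup>2"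
proof -
  have "\<bar>cmod p - cmod w * cmod q\<bar> \<le> cmod (p - w * q)"
    using norm_triangle_ineq3[of p "w * q"] by (simp add: norm_mult)
  then have "(cmod p - cmod w * cmod q)\<^sup>2 \<le> (cmod (p - w * q))\<^sup>2"
    by (metis abs_le_square_iff abs_norm_cancel)
  moreover have "0 \<le> (cmod w * cmod p - cmod q)\<^sup>2" by simp
  moreover have "(cmod p - cmod w * cmod q)\<^sup>2 - (1 - (cmod w)\<^sup>2) * ((cmod p)\<^sup>2 - (cmod q)\<^sup>2)
      = (cmod w * cmod p - cmod q)\<^sup>2"
    by (simp add: power2_eq_square algebra_simps)
  ultimately show ?thesis by linarith
qed

lemma norm_sqr_le_1: "norm x \<le> 1 \<Longrightarrow> (norm x)\<^sup>2 \<le> 1"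
  by (simp add: abs_square_le_1)

text \<open>
  After the supremum over \<open>z\<^sub>1\<close> is taken, membership is an inequality in the single variable \<open>z = z\<^sub>2\<close>. The
  factor \<open>k < 1\<close> keeps the supremum over \<open>z\<close> away from \<open>1\<close>.
\<close>

lemma hexablockI:
  assumes x: "vector [x1, x2, x3] \<in> tetrablock" and k: "0 \<le> k" "k < 1"
    and bound: "\<And>z. cmod z < 1 \<Longrightarrow>
      (cmod a)\<^sup>2 * (1 - (cmod z)\<^sup>2) \<le> k * ((cmod (1 - x2 * z))\<^sup>2 - (cmod (x1 - x3 * z))\<^sup>2)"
  shows "vector [a, x1, x2, x3] \<in> hexablock"
proof -
  have "cmod (a * of_real (sqrt ((1 - (cmod z1)\<^sup>2) * (1 - (cmod z2)\<^sup>2))) /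
            (1 - x1 * z1 - x2 * z2 + x3 * z1 * z2)) \<le> sqrt k"
    if z: "cmod z1 < 1" "cmod z2 < 1" for z1 z2
  proof -
    define P where "P = 1 - x2 * z2"
    define Q where "Q = x1 - x3 * z2"
    have den: "1 - x1 * z1 - x2 * z2 + x3 * z1 * z2 = P - z1 * Q"
      by (simp add: P_def Q_def algebra_simps)
    have nz: "P - z1 * Q \<noteq> 0" using x z unfolding tetrablock_iff P_def Q_def by (meson less_imp_le)
    have z': "(cmod z1)\<^sup>2 \<le> 1" "(cmod z2)\<^sup>2 \<le> 1" using z by (auto intro: norm_sqr_le_1)
    have "(cmod a)\<^sup>2 * ((1 - (cmod z1)\<^sup>2) * (1 - (cmod z2)\<^sup>2))
        = (1 - (cmod z1)\<^sup>2) * ((cmod a)\<^sup>2 * (1 - (cmod z2)\<^sup>2))" by (simp add: mult_ac)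
    also have "\<dots> \<le> (1 - (cmod z1)\<^sup>2) * (k * ((cmod P)\<^sup>2 - (cmod Q)\<^sup>2))"
      unfolding P_def Q_def by (rule mult_left_mono[OF bound[OF z(2)]]) (use z' in linarith)
    also have "\<dots> = k * ((1 - (cmod z1)\<^sup>2) * ((cmod P)\<^sup>2 - (cmod Q)\<^sup>2))" by (simp add: mult_ac)
    also have "\<dots> \<le> k * (cmod (P - z1 * Q))\<^sup>2"
      by (rule mult_left_mono[OF hexablock_kernel_le[OF z(1)] k(1)])
    finally have le: "(cmod a)\<^sup>2 * ((1 - (cmod z1)\<^sup>2) * (1 - (cmod z2)\<^sup>2)) \<le> k * (cmod (P - z1 * Q))\<^sup>2" .
    have nn: "(1 - (cmod z1)\<^sup>2) * (1 - (cmod z2)\<^sup>2) \<ge> 0" using z' by simp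
    have "(cmod (a * of_real (sqrt ((1 - (cmod z1)\<^sup>2) * (1 - (cmod z2)\<^sup>2))) / (P - z1 * Q)))\<^sup>2
        = (cmod a)\<^sup>2 * ((1 - (cmod z1)\<^sup>2) * (1 - (cmod z2)\<^sup>2)) / (cmod (P - z1 * Q))\<^sup>2"
      unfolding norm_divide norm_mult norm_of_real power_divide power_mult_distrib power2_abs
      by (simp only: real_sqrt_pow2[OF nn])
    also have "\<dots> \<le> (sqrt k)\<^sup>2" using le nz k by (simp add: divide_le_eq)
    finally show ?thesis unfolding den by (rule power2_le_imp_le) (use k in simp)
  qed
  then have "(SUP (z1, z2) \<in> ball 0 1 \<times> ball 0 1.
      cmod (a * of_real (sqrt ((1 - (cmod z1)\<^sup>2) * (1 - (cmod z2)\<^sup>2))) /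
            (1 - x1 * z1 - x2 * z2 + x3 * z1 * z2))) \<le> sqrt k"
    by (intro cSUP_least) auto
  also have "\<dots> < 1" using k by simp
  finally show ?thesis using x hexablock_iff by blast
qed

lemma hexablockD:
  assumes "vector [a, x1, x2, x3] \<in> hexablock"
  shows "vector [x1, x2, x3] \<in> tetrablock"
    and "cmod z < 1 \<Longrightarrow> (cmod a)\<^sup>2 * (1 - (cmod z)\<^sup>2) \<le> (cmod (1 - x2 * z))\<^sup>2 - (cmod (x1 - x3 * z))\<^sup>2"
proof -
  show x: "vector [x1, x2, x3] \<in> tetrablock" using assms hexablock_iff by blast
  define G where "G z1 z2 = cmod (a * of_real (sqrt ((1 - (cmod z1)\<^sup>2) * (1 - (cmod z2)\<^sup>2))) /
            (1 - x1 * z1 - x2 * z2 + x3 * z1 * z2))" for z1 z2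
  assume z: "cmod z < 1"
  define P where "P = 1 - x2 * z"
  define Q where "Q = x1 - x3 * z"
  have QP: "cmod Q < cmod P" unfolding P_def Q_def by (rule tetrablock_num_less_den[OF x]) (use z in simp)
  then have P0: "P \<noteq> 0" by auto
  have sq: "(cmod Q)\<^sup>2 < (cmod P)\<^sup>2" using QP by (intro power_strict_mono) auto
  have le1: "G z1 z2 \<le> 1" if "cmod z1 < 1" "cmod z2 < 1" for z1 z2
  proof -
    have cont: "continuous_on (cball 0 1 \<times> cball 0 1) (\<lambda>(z1, z2). G z1 z2)"
    proof -
      have "(1 - x1 * fst w - x2 * snd w + x3 * fst w * snd w) \<noteq> 0" if "w \<in> cball 0 1 \<times> cball 0 1" for w
        using x that unfolding tetrablock_def by auto
      then show ?thesis unfolding G_def case_prod_unfold by (intro continuous_intros) auto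
    qed
    have "bdd_above ((\<lambda>(z1, z2). G z1 z2) ` (cball 0 1 \<times> cball 0 1))"
      by (intro bounded_imp_bdd_above compact_imp_bounded compact_continuous_image cont compact_Times) auto
    then have bdd: "bdd_above ((\<lambda>(z1, z2). G z1 z2) ` (ball 0 1 \<times> ball 0 1))"
      by (rule bdd_above_mono) auto
    have "(z1, z2) \<in> ball 0 1 \<times> ball 0 1" using that by auto
    from cSUP_upper[OF this bdd] have "G z1 z2 \<le> (SUP (z1, z2) \<in> ball 0 1 \<times> ball 0 1. G z1 z2)"
      by simp
    also have "\<dots> < 1" using assms unfolding hexablock_iff G_def by blast
    finally show ?thesis by simp
  qed
  \<comment> \<open>the supremum over the first disc is attained at \<open>z\<^sub>1 = cnj (Q / P)\<close>\<close>
  define w where "w = cnj Q / cnj P"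
  have w: "cmod w < 1" using QP P0 by (simp add: w_def norm_divide)
  define d where "d = (cmod P)\<^sup>2 - (cmod Q)\<^sup>2"
  have d: "d > 0" using sq by (simp add: d_def)
  have den: "1 - x1 * w - x2 * z + x3 * w * z = P - w * Q" by (simp add: P_def Q_def algebra_simps)
  have "complex_of_real d = P * cnj P - Q * cnj Q"
    unfolding d_def of_real_diff complex_norm_square ..
  then have "P - w * Q = of_real d / cnj P"
    using P0 by (simp add: w_def field_simps)
  then have nden: "(cmod (P - w * Q))\<^sup>2 = d\<^sup>2 / (cmod P)\<^sup>2"
    by (simp add: norm_divide power_divide)
  have nw: "1 - (cmod w)\<^sup>2 = d / (cmod P)\<^sup>2"
    using P0 by (simp add: w_def d_def norm_divide power_divide field_simps)
  have "(cmod z)\<^sup>2 \<le> 1" "(cmod w)\<^sup>2 \<le> 1" using z w by (auto intro: norm_sqr_le_1)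
  then have nn: "(1 - (cmod w)\<^sup>2) * (1 - (cmod z)\<^sup>2) \<ge> 0" by simp
  have "G w z \<ge> 0" by (simp add: G_def)
  then have "(G w z)\<^sup>2 \<le> 1" using le1[OF w z] by (simp add: abs_square_le_1)
  moreover have "(G w z)\<^sup>2 = (cmod a)\<^sup>2 * ((1 - (cmod w)\<^sup>2) * (1 - (cmod z)\<^sup>2)) / (cmod (P - w * Q))\<^sup>2"
    unfolding G_def den norm_divide norm_mult norm_of_real power_divide power_mult_distrib power2_abs
    by (simp only: real_sqrt_pow2[OF nn])
  moreover have "\<dots> = (cmod a)\<^sup>2 * (1 - (cmod z)\<^sup>2) / d"
    unfolding nden nw using d P0 by (simp add: power2_eq_square)
  ultimately have "(cmod a)\<^sup>2 * (1 - (cmod z)\<^sup>2) / d \<le> 1" by linarith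
  then have "(cmod a)\<^sup>2 * (1 - (cmod z)\<^sup>2) \<le> d" using d by (simp add: pos_divide_le_eq)
  then show "(cmod a)\<^sup>2 * (1 - (cmod z)\<^sup>2) \<le> (cmod (1 - x2 * z))\<^sup>2 - (cmod (x1 - x3 * z))\<^sup>2"
    unfolding d_def P_def Q_def .
qed

text \<open>
  The matrix with entries \<open>a11, a12, a21, a22\<close> maps \<open>(P, z a21)\<close> to \<open>(Q, a21)\<close>, where \<open>P\<close> and \<open>Q\<close> belong to
  \<open>x\<^sub>1 = a11\<close>, \<open>x\<^sub>2 = a22\<close> and the determinant \<open>x\<^sub>3\<close>. The contraction inequality at this vector is the
  inequality required for membership, with a positive margin \<open>k0\<close>.
\<close>

lemma strict_contraction_hexablock:
  assumes rho: "0 \<le> rho" "rho < 1"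
    and contr: "\<And>y1 y2. (cmod (a11 * y1 + a12 * y2))\<^sup>2 + (cmod (a21 * y1 + a22 * y2))\<^sup>2
      \<le> rho\<^sup>2 * ((cmod y1)\<^sup>2 + (cmod y2)\<^sup>2)"
  shows "vector [a21, a11, a22, a11 * a22 - a12 * a21] \<in> hexablock"
proof -
  let ?d = "a11 * a22 - a12 * a21"
  have rho2: "rho\<^sup>2 < 1" "rho\<^sup>2 \<ge> 0" using rho by (simp_all add: abs_square_less_1)
  have "(cmod a11)\<^sup>2 + (cmod a21)\<^sup>2 \<le> rho\<^sup>2" "(cmod a12)\<^sup>2 + (cmod a22)\<^sup>2 \<le> rho\<^sup>2"
    using contr[of 1 0] contr[of 0 1] by simp_all
  then have a21: "(cmod a21)\<^sup>2 \<le> 1" and a22': "(cmod a22)\<^sup>2 \<le> rho\<^sup>2"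
    using rho2 zero_le_power2[of "cmod a11"] zero_le_power2[of "cmod a12"] by linarith+
  from a22' have a22: "cmod a22 \<le> rho" by (rule power2_le_imp_le) (use rho in simp)
  define k0 where "k0 = (1 - rho\<^sup>2) * (1 - rho)\<^sup>2"
  have k0: "k0 > 0" using rho rho2 by (simp add: k0_def)
  have key: "(cmod a21)\<^sup>2 * (1 - (cmod z)\<^sup>2) + k0 \<le> (cmod (1 - a22 * z))\<^sup>2 - (cmod (a11 - ?d * z))\<^sup>2"
    if z: "cmod z \<le> 1" for z
  proof -
    define P where "P = 1 - a22 * z"
    define Q where "Q = a11 - ?d * z"
    have 1: "a11 * P + a12 * (z * a21) = Q" "a21 * P + a22 * (z * a21) = a21"
      by (simp_all add: P_def Q_def algebra_simps)
    have "(cmod Q)\<^sup>2 + (cmod a21)\<^sup>2 \<le> rho\<^sup>2 * ((cmod P)\<^sup>2 + (cmod (z * a21))\<^sup>2)"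
      using contr[of P "z * a21"] unfolding 1 .
    also have "\<dots> \<le> rho\<^sup>2 * (cmod P)\<^sup>2 + (cmod z)\<^sup>2 * (cmod a21)\<^sup>2"
      using rho2 mult_right_mono[of "rho\<^sup>2" 1 "(cmod z)\<^sup>2 * (cmod a21)\<^sup>2"]
      by (simp add: norm_mult power_mult_distrib distrib_left)
    finally have 2: "(cmod Q)\<^sup>2 + (cmod a21)\<^sup>2 \<le> rho\<^sup>2 * (cmod P)\<^sup>2 + (cmod z)\<^sup>2 * (cmod a21)\<^sup>2" .
    have "cmod (a22 * z) \<le> rho"
      using mult_mono[OF a22 z] rho by (simp add: norm_mult)
    then have "1 - rho \<le> cmod P"
      using norm_triangle_ineq2[of 1 "a22 * z"] by (simp add: P_def)
    then have "(1 - rho)\<^sup>2 \<le> (cmod P)\<^sup>2" using rho by (intro power_mono) auto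
    then have "k0 \<le> (1 - rho\<^sup>2) * (cmod P)\<^sup>2"
      unfolding k0_def by (rule mult_left_mono) (use rho2 in simp)
    then have "(cmod a21)\<^sup>2 * (1 - (cmod z)\<^sup>2) + k0 \<le> (cmod P)\<^sup>2 - (cmod Q)\<^sup>2"
      using 2 by (simp add: algebra_simps)
    then show ?thesis by (simp add: P_def Q_def)
  qed
  have tetra: "vector [a11, a22, ?d] \<in> tetrablock"
    unfolding tetrablock_iff
  proof (intro allI impI notI)
    fix z1 z2 assume z: "cmod z1 \<le> 1" "cmod z2 \<le> 1" and 0: "1 - a22 * z2 - z1 * (a11 - ?d * z2) = 0"
    have "0 \<le> (cmod a21)\<^sup>2 * (1 - (cmod z2)\<^sup>2)" using norm_sqr_le_1[OF z(2)] by simp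
    then have "(cmod (a11 - ?d * z2))\<^sup>2 < (cmod (1 - a22 * z2))\<^sup>2" using key[OF z(2)] k0 by linarith
    then have "cmod (a11 - ?d * z2) < cmod (1 - a22 * z2)" by (rule power2_less_imp_less) simp
    also have "1 - a22 * z2 = z1 * (a11 - ?d * z2)" using 0 by simp
    also have "cmod \<dots> \<le> 1 * cmod (a11 - ?d * z2)"
      unfolding norm_mult by (rule mult_right_mono[OF z(1)]) simp
    finally show False by simp
  qed
  show ?thesis
  proof (rule hexablockI[OF tetra, of "1 / (1 + k0)"])
    fix z :: complex assume z: "cmod z < 1"
    define s where "s = (cmod a21)\<^sup>2 * (1 - (cmod z)\<^sup>2)"
    have "s \<le> 1 * 1" unfolding s_def using norm_sqr_le_1[of z] z a21 by (intro mult_mono) auto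
    then have "s * k0 \<le> 1 * k0" using k0 by (intro mult_right_mono) auto
    then have "s * (1 + k0) \<le> s + k0" by (simp add: algebra_simps)
    also have "\<dots> \<le> (cmod (1 - a22 * z))\<^sup>2 - (cmod (a11 - ?d * z))\<^sup>2"
      unfolding s_def using key z by simp
    finally show "(cmod a21)\<^sup>2 * (1 - (cmod z)\<^sup>2) \<le> 1 / (1 + k0) * ((cmod (1 - a22 * z))\<^sup>2 - (cmod (a11 - ?d * z))\<^sup>2)"
      using k0 by (simp add: s_def[symmetric] pos_le_divide_eq)
  qed (use k0 in auto)
qed

section \<open>Analytic discs attached to the edge of the hexablock\<close>

text \<open>
  For unit vectors \<open>u\<close>, \<open>v\<close> let \<open>u'\<close>, \<open>v'\<close> be their orthogonal companions \<open>(- cnj u2, cnj u1)\<close> and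
  \<open>(- cnj v2, cnj v1)\<close>. The matrix \<open>r (u v\<^sup>* + \<zeta> u' v'\<^sup>*)\<close> is \<open>r\<close> times a contraction for \<open>|\<zeta>| \<le> 1\<close>, and \<open>r\<close>
  times a unitary for \<open>|\<zeta>| = 1\<close>. The disc consists of its entry \<open>a21\<close>, its diagonal and its determinant.
  It is affine in \<open>\<zeta>\<close>, and is written so that the maximum principle on affine discs applies.
\<close>

definition unitary_disc :: "real \<Rightarrow> complex \<Rightarrow> complex \<Rightarrow> complex \<Rightarrow> complex \<Rightarrow> complex \<Rightarrow> complex^4"
  where "unitary_disc r u1 u2 v1 v2 \<zeta> =
    vector [of_real r * (u2 * cnj v1), of_real r * (u1 * cnj v1), of_real r * (u2 * cnj v2), 0] +
    \<zeta> *s vector [- of_real r * (cnj u1 * v2), of_real r * (cnj u2 * v2), of_real r * (cnj u1 * v1), of_real (r\<^sup>2)]"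

lemma unitary_disc_nth [simp]:
  "unitary_disc r u1 u2 v1 v2 \<zeta> $ 1 = of_real r * (u2 * cnj v1 - \<zeta> * cnj u1 * v2)"
  "unitary_disc r u1 u2 v1 v2 \<zeta> $ 2 = of_real r * (u1 * cnj v1 + \<zeta> * cnj u2 * v2)"
  "unitary_disc r u1 u2 v1 v2 \<zeta> $ 3 = of_real r * (u2 * cnj v2 + \<zeta> * cnj u1 * v1)"
  "unitary_disc r u1 u2 v1 v2 \<zeta> $ 4 = of_real (r\<^sup>2) * \<zeta>"
  by (simp_all add: unitary_disc_def algebra_simps)

text \<open>
  The columns \<open>(u1, u2)\<close> and \<open>(cnj u2, - cnj u1)\<close> are orthogonal and have the same norm.
\<close>

lemma rotated_square_sum:
  "(cmod (u1 * p + cnj u2 * q))\<^sup>2 + (cmod (u2 * p - cnj u1 * q))\<^sup>2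
    = ((cmod u1)\<^sup>2 + (cmod u2)\<^sup>2) * ((cmod p)\<^sup>2 + (cmod q)\<^sup>2)"
proof -
  have "complex_of_real ((cmod (u1 * p + cnj u2 * q))\<^sup>2 + (cmod (u2 * p - cnj u1 * q))\<^sup>2)
      = of_real (((cmod u1)\<^sup>2 + (cmod u2)\<^sup>2) * ((cmod p)\<^sup>2 + (cmod q)\<^sup>2))"
    unfolding of_real_add of_real_mult complex_norm_square by (simp add: algebra_simps)
  then show ?thesis using of_real_eq_iff by blast
qed

lemma unitary_disc_in_hexablock:
  assumes u: "(cmod u1)\<^sup>2 + (cmod u2)\<^sup>2 = 1" and v: "(cmod v1)\<^sup>2 + (cmod v2)\<^sup>2 = 1"
    and r: "0 \<le> r" "r < 1" and \<zeta>: "cmod \<zeta> \<le> 1"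
  shows "unitary_disc r u1 u2 v1 v2 \<zeta> \<in> hexablock"
proof -
  define a11 where "a11 = of_real r * (u1 * cnj v1 + \<zeta> * cnj u2 * v2)"
  define a12 where "a12 = of_real r * (u1 * cnj v2 - \<zeta> * cnj u2 * v1)"
  define a21 where "a21 = of_real r * (u2 * cnj v1 - \<zeta> * cnj u1 * v2)"
  define a22 where "a22 = of_real r * (u2 * cnj v2 + \<zeta> * cnj u1 * v1)"
  have "a11 * a22 - a12 * a21 = of_real (r\<^sup>2) * \<zeta> *
      ((u1 * cnj u1 + u2 * cnj u2) * (v1 * cnj v1 + v2 * cnj v2))"
    by (simp add: a11_def a12_def a21_def a22_def power2_eq_square algebra_simps)
  also have "(u1 * cnj u1 + u2 * cnj u2) = of_real ((cmod u1)\<^sup>2 + (cmod u2)\<^sup>2)"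
    unfolding of_real_add complex_norm_square ..
  also have "(v1 * cnj v1 + v2 * cnj v2) = of_real ((cmod v1)\<^sup>2 + (cmod v2)\<^sup>2)"
    unfolding of_real_add complex_norm_square ..
  finally have det: "a11 * a22 - a12 * a21 = of_real (r\<^sup>2) * \<zeta>" unfolding u v by simp
  have "vector [a21, a11, a22, a11 * a22 - a12 * a21] \<in> hexablock"
  proof (rule strict_contraction_hexablock[OF r])
    fix y1 y2
    define p where "p = cnj v1 * y1 + cnj v2 * y2"
    define q where "q = v2 * y1 - v1 * y2"
    have "(cmod (a11 * y1 + a12 * y2))\<^sup>2 + (cmod (a21 * y1 + a22 * y2))\<^sup>2
        = r\<^sup>2 * ((cmod (u1 * p + cnj u2 * (\<zeta> * q)))\<^sup>2 + (cmod (u2 * p - cnj u1 * (\<zeta> * q)))\<^sup>2)"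
    proof -
      have e: "a11 * y1 + a12 * y2 = of_real r * (u1 * p + cnj u2 * (\<zeta> * q))"
        "a21 * y1 + a22 * y2 = of_real r * (u2 * p - cnj u1 * (\<zeta> * q))"
        by (simp_all add: a11_def a12_def a21_def a22_def p_def q_def algebra_simps)
      show ?thesis
        unfolding e norm_mult norm_of_real power_mult_distrib power2_abs by (rule distrib_left[symmetric])
    qed
    also have "\<dots> = r\<^sup>2 * ((cmod p)\<^sup>2 + (cmod \<zeta>)\<^sup>2 * (cmod q)\<^sup>2)"
      unfolding rotated_square_sum u by (simp add: norm_mult power_mult_distrib)
    also have "\<dots> \<le> r\<^sup>2 * ((cmod p)\<^sup>2 + 1 * (cmod q)\<^sup>2)"
      by (intro mult_left_mono add_left_mono mult_right_mono norm_sqr_le_1 \<zeta>) auto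
    also have "(cmod p)\<^sup>2 + 1 * (cmod q)\<^sup>2 = (cmod y1)\<^sup>2 + (cmod y2)\<^sup>2"
      using rotated_square_sum[of "cnj v1" y1 v2 y2] v by (simp add: p_def q_def)
    finally show "(cmod (a11 * y1 + a12 * y2))\<^sup>2 + (cmod (a21 * y1 + a22 * y2))\<^sup>2
      \<le> r\<^sup>2 * ((cmod y1)\<^sup>2 + (cmod y2)\<^sup>2)" .
  qed
  also have "vector [a21, a11, a22, a11 * a22 - a12 * a21] = unitary_disc r u1 u2 v1 v2 \<zeta>"
    unfolding det by (rule vector_4_eqI) (simp_all add: a11_def a21_def a22_def)
  finally show ?thesis .
qed

text \<open>
  The image of the unitary matrices under \<open>(a21, a11, a22, det)\<close>.
\<close>

definition hexablock_edge :: "(complex^4) set"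
  where "hexablock_edge = {w. cmod (w $ 4) = 1 \<and> w $ 2 = cnj (w $ 3) * w $ 4 \<and>
    (cmod (w $ 1))\<^sup>2 + (cmod (w $ 2))\<^sup>2 = 1}"

lemma unitary_disc_in_edge:
  assumes u: "(cmod u1)\<^sup>2 + (cmod u2)\<^sup>2 = 1" and v: "(cmod v1)\<^sup>2 + (cmod v2)\<^sup>2 = 1"
    and \<zeta>: "cmod \<zeta> = 1"
  shows "unitary_disc 1 u1 u2 v1 v2 \<zeta> \<in> hexablock_edge"
proof -
  have z: "cnj \<zeta> * \<zeta> = 1"
    using complex_norm_square[of \<zeta>] \<zeta> by (simp add: mult.commute)
  have 1: "(cmod (u2 * cnj v1 - \<zeta> * cnj u1 * v2))\<^sup>2 + (cmod (u1 * cnj v1 + \<zeta> * cnj u2 * v2))\<^sup>2 = 1"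
    using rotated_square_sum[of u1 "cnj v1" u2 "\<zeta> * v2"] u v \<zeta> by (simp add: norm_mult algebra_simps)
  have "cnj (u2 * cnj v2 + \<zeta> * cnj u1 * v1) * \<zeta> = cnj u2 * v2 * \<zeta> + u1 * cnj v1 * (cnj \<zeta> * \<zeta>)"
    by (simp add: algebra_simps)
  then have 2: "u1 * cnj v1 + \<zeta> * cnj u2 * v2 = cnj (u2 * cnj v2 + \<zeta> * cnj u1 * v1) * \<zeta>"
    unfolding z by (simp add: algebra_simps)
  show ?thesis using 1 2 \<zeta> by (simp add: hexablock_edge_def)
qed

text \<open>
  A unitary matrix is determined by its first column and its determinant, which corresponds to
  \<open>v = (1, 0)\<close>.
\<close>

lemma edge_in_unitary_disc:
  assumes w: "w \<in> hexablock_edge"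
  shows "w = unitary_disc 1 (w $ 2) (w $ 1) 1 0 (w $ 4)"
proof (rule vector_4_eqI)
  have z: "cnj (w $ 4) * (w $ 4) = 1"
    using complex_norm_square[of "w $ 4"] w by (simp add: mult.commute hexablock_edge_def)
  have "cnj (w $ 2) = w $ 3 * cnj (w $ 4)" using w by (simp add: hexablock_edge_def)
  then have "w $ 4 * cnj (w $ 2) = w $ 3 * (cnj (w $ 4) * w $ 4)" by (simp add: mult_ac)
  then show "w $ 3 = unitary_disc 1 (w $ 2) (w $ 1) 1 0 (w $ 4) $ 3" by (simp add: z)
qed simp_all

lemma continuous_on_unitary_disc: "continuous_on S (\<lambda>(r, \<zeta>). unitary_disc r u1 u2 v1 v2 \<zeta>)"
proof -
  have "continuous_on S (\<lambda>p. unitary_disc (fst p) u1 u2 v1 v2 (snd p) $ i)" for i :: 4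
    using exhaust_4[of i] by (elim disjE; simp) (intro continuous_intros)+
  then have "continuous_on S (\<lambda>p. \<chi> i. unitary_disc (fst p) u1 u2 v1 v2 (snd p) $ i)"
    by (rule continuous_on_vec_lambda)
  then show ?thesis by (simp add: case_prod_unfold)
qed

lemma shrink_tendsto_1: "(\<lambda>n. 1 - inverse (real (Suc n))) \<longlonglongrightarrow> 1"
  using tendsto_diff[OF tendsto_const[of "1::real"] LIMSEQ_inverse_real_of_nat] by simp

lemma shrink_bounds: "0 \<le> 1 - inverse (real (Suc n))" "1 - inverse (real (Suc n)) < 1"
  by (simp_all add: divide_simps)

lemma unitary_disc_in_closure:
  assumes u: "(cmod u1)\<^sup>2 + (cmod u2)\<^sup>2 = 1" and v: "(cmod v1)\<^sup>2 + (cmod v2)\<^sup>2 = 1"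
    and \<zeta>: "cmod \<zeta> \<le> 1"
  shows "unitary_disc 1 u1 u2 v1 v2 \<zeta> \<in> closure hexablock"
  unfolding closure_sequential
proof (intro exI conjI allI)
  let ?r = "\<lambda>n. 1 - inverse (real (Suc n))"
  show "unitary_disc (?r n) u1 u2 v1 v2 \<zeta> \<in> hexablock" for n
    by (rule unitary_disc_in_hexablock[OF u v shrink_bounds \<zeta>])
  have "(\<lambda>n. (?r n, \<zeta>)) \<longlonglongrightarrow> (1, \<zeta>)"
    by (intro tendsto_Pair shrink_tendsto_1 tendsto_const)
  from continuous_on_tendsto_compose[OF continuous_on_unitary_disc[of UNIV] this]
  show "(\<lambda>n. unitary_disc (?r n) u1 u2 v1 v2 \<zeta>) \<longlonglongrightarrow> unitary_disc 1 u1 u2 v1 v2 \<zeta>" by simp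
qed

lemma edge_subset_closure: "hexablock_edge \<subseteq> closure hexablock"
proof
  fix w assume w: "w \<in> hexablock_edge"
  have "unitary_disc 1 (w $ 2) (w $ 1) 1 0 (w $ 4) \<in> closure hexablock"
    by (rule unitary_disc_in_closure) (use w in \<open>auto simp: hexablock_edge_def add.commute\<close>)
  then show "w \<in> closure hexablock" using edge_in_unitary_disc[OF w] by simp
qed

lemma compact_hexablock_edge: "compact hexablock_edge"
proof (rule compact_eq_bounded_closed[THEN iffD2], rule conjI)
  show "closed hexablock_edge"
    unfolding hexablock_edge_def by (intro closed_Collect_conj closed_Collect_eq continuous_intros)
  have "norm w \<le> 4" if w: "w \<in> hexablock_edge" for w
  proof -
    have 1: "(cmod (w $ 1))\<^sup>2 + (cmod (w $ 2))\<^sup>2 = 1" "cmod (w $ 4) = 1" "w $ 2 = cnj (w $ 3) * w $ 4"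
      using w by (auto simp: hexablock_edge_def)
    have "(cmod (w $ 1))\<^sup>2 \<le> 1" "(cmod (w $ 2))\<^sup>2 \<le> 1"
      using 1(1) zero_le_power2[of "cmod (w $ 1)"] zero_le_power2[of "cmod (w $ 2)"] by linarith+
    then have "cmod (w $ 1) \<le> 1" "cmod (w $ 2) \<le> 1" by (simp_all add: abs_square_le_1)
    moreover have "cmod (w $ 3) = cmod (w $ 2)" unfolding 1(3) using 1(2) by (simp add: norm_mult)
    ultimately have "(\<Sum>i\<in>UNIV. cmod (w $ i)) \<le> 4" using 1(2) by (simp add: sum_4)
    moreover have "norm w \<le> (\<Sum>i\<in>UNIV. cmod (w $ i))"
      unfolding norm_vec_def by (rule L2_set_le_sum) simp
    ultimately show ?thesis by simp
  qed
  then show "bounded hexablock_edge" unfolding bounded_iff by blast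
qed

text \<open>
  Over a fixed point of the tetrablock the hexablock is a disc in the first coordinate. Its squared
  radius \<open>t\<close> is the minimum of \<open>(|P|\<^sup>2 - |Q|\<^sup>2) / (1 - |w|\<^sup>2)\<close>, which is attained in the open disc because
  the numerator is bounded below by a positive constant. The reciprocal quotient is continuous on the closed disc, so it is
  maximised instead.
\<close>

lemma tetrablock_extremal_radius:
  assumes x: "vector [x1, x2, x3] \<in> tetrablock"
  obtains t z where "t > 0" "cmod z < 1"
    "\<And>w. cmod w \<le> 1 \<Longrightarrow> t * (1 - (cmod w)\<^sup>2) \<le> (cmod (1 - x2 * w))\<^sup>2 - (cmod (x1 - x3 * w))\<^sup>2"
    "t * (1 - (cmod z)\<^sup>2) = (cmod (1 - x2 * z))\<^sup>2 - (cmod (x1 - x3 * z))\<^sup>2"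
proof -
  define h where "h w = (cmod (1 - x2 * w))\<^sup>2 - (cmod (x1 - x3 * w))\<^sup>2" for w
  have h: "h w > 0" if "cmod w \<le> 1" for w
    using tetrablock_num_less_den[OF x that] by (simp add: h_def power_strict_mono)
  define m where "m w = (1 - (cmod w)\<^sup>2) / h w" for w
  have "continuous_on (cball 0 1) m"
  proof -
    have "h w \<noteq> 0" if "w \<in> cball 0 1" for w using h[of w] that by auto
    then show ?thesis unfolding m_def by (intro continuous_intros) (auto simp: h_def intro!: continuous_intros)
  qed
  then obtain z where z: "z \<in> cball 0 1" "\<And>w. w \<in> cball 0 1 \<Longrightarrow> m w \<le> m z"
    using continuous_attains_sup[of "cball (0::complex) 1" m] by auto
  have "m 0 > 0" using h[of 0] by (simp add: m_def)
  then have mz: "m z > 0" using z(2)[of 0] by simp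
  have hz: "h z > 0" using h z by simp
  show ?thesis
  proof
    show "1 / m z > 0" using mz by simp
    have pos: "1 - (cmod z)\<^sup>2 > 0" using mz hz by (simp add: m_def zero_less_divide_iff)
    then show "cmod z < 1" by (simp add: abs_square_less_1)
    show "1 / m z * (1 - (cmod w)\<^sup>2) \<le> (cmod (1 - x2 * w))\<^sup>2 - (cmod (x1 - x3 * w))\<^sup>2" if "cmod w \<le> 1" for w
    proof -
      have "(1 - (cmod w)\<^sup>2) / h w \<le> m z" using z(2)[of w] that by (simp add: m_def)
      then have "1 - (cmod w)\<^sup>2 \<le> m z * h w" using h[OF that] by (simp add: pos_divide_le_eq)
      then have "1 / m z * (1 - (cmod w)\<^sup>2) \<le> h w" using mz by (simp add: divide_le_eq mult.commute)
      then show ?thesis by (simp add: h_def)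
    qed
    show "1 / m z * (1 - (cmod z)\<^sup>2) = (cmod (1 - x2 * z))\<^sup>2 - (cmod (x1 - x3 * z))\<^sup>2"
      using pos hz unfolding h_def[symmetric] by (simp add: m_def)
  qed
qed

text \<open>
  The derivative of \<open>|P|\<^sup>2 - |Q|\<^sup>2 - t (1 - |w|\<^sup>2)\<close> vanishes at its interior minimum \<open>z\<close>.
\<close>

lemma extremal_critical:
  assumes t: "\<And>w. cmod w \<le> 1 \<Longrightarrow> t * (1 - (cmod w)\<^sup>2) \<le> (cmod (1 - x2 * w))\<^sup>2 - (cmod (x1 - x3 * w))\<^sup>2"
    and z: "cmod z < 1" and eq: "t * (1 - (cmod z)\<^sup>2) = (cmod (1 - x2 * z))\<^sup>2 - (cmod (x1 - x3 * z))\<^sup>2"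
  shows "cnj x2 * (1 - x2 * z) = cnj x3 * (x1 - x3 * z) + of_real t * z"
proof -
  define P where "P = 1 - x2 * z"
  define Q where "Q = x1 - x3 * z"
  define g where "g = cnj Q * x3 + of_real t * cnj z - cnj P * x2"
  define k where "k = (cmod x2)\<^sup>2 - (cmod x3)\<^sup>2 + t"
  have expand: "0 \<le> 2 * Re (g * w) + k * (cmod w)\<^sup>2" if w: "cmod (z + w) \<le> 1" for w
  proof -
    have e1: "(cmod (1 - x2 * (z + w)))\<^sup>2 = (cmod P)\<^sup>2 - 2 * Re (cnj P * x2 * w) + (cmod x2)\<^sup>2 * (cmod w)\<^sup>2"
      using cmod_diff_mult_square[of P x2 w] by (simp add: P_def algebra_simps)
    have e2: "(cmod (x1 - x3 * (z + w)))\<^sup>2 = (cmod Q)\<^sup>2 - 2 * Re (cnj Q * x3 * w) + (cmod x3)\<^sup>2 * (cmod w)\<^sup>2"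
      using cmod_diff_mult_square[of Q x3 w] by (simp add: Q_def algebra_simps)
    have e3: "(cmod (z + w))\<^sup>2 = (cmod z)\<^sup>2 + 2 * Re (cnj z * w) + (cmod w)\<^sup>2"
      using cmod_diff_mult_square[of z "-1" w] by simp
    have "Re (g * w) = Re (cnj Q * x3 * w) + t * Re (cnj z * w) - Re (cnj P * x2 * w)"
      by (simp add: g_def distrib_right left_diff_distrib mult.assoc)
    moreover have "t * (1 - (cmod z)\<^sup>2) - 2 * (t * Re (cnj z * w)) - t * (cmod w)\<^sup>2
        \<le> (cmod P)\<^sup>2 - (cmod Q)\<^sup>2 - 2 * Re (cnj P * x2 * w) + 2 * Re (cnj Q * x3 * w)
          + (cmod x2)\<^sup>2 * (cmod w)\<^sup>2 - (cmod x3)\<^sup>2 * (cmod w)\<^sup>2"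
      using t[OF w] unfolding e1 e2 e3 by (simp add: algebra_simps)
    ultimately show ?thesis
      using eq unfolding P_def[symmetric] Q_def[symmetric] k_def by (simp add: algebra_simps)
  qed
  have "g = 0"
  proof (rule ccontr)
    assume g: "g \<noteq> 0"
    define s where "s = min ((1 - cmod z) / cmod g) (1 / (1 + \<bar>k\<bar>))"
    have s: "s > 0" using g z by (simp add: s_def add_pos_nonneg)
    \<comment> \<open>a step against the gradient, short enough to stay in the disc and to dominate the quadratic term\<close>
    define w where "w = - of_real s * cnj g"
    have "s \<le> (1 - cmod z) / cmod g" by (simp add: s_def)
    then have "s * cmod g \<le> 1 - cmod z" using g by (simp add: pos_le_divide_eq)
    then have "cmod (z + w) \<le> 1"
      using norm_triangle_ineq[of z w] s by (simp add: w_def norm_mult)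
    from expand[OF this] have "0 \<le> 2 * Re (g * w) + k * (cmod w)\<^sup>2" .
    moreover have "g * w = of_real (- s * (cmod g)\<^sup>2)"
      unfolding w_def of_real_mult complex_norm_square by (simp add: mult_ac)
    then have "Re (g * w) = - s * (cmod g)\<^sup>2" by (metis Re_complex_of_real)
    moreover have "(cmod w)\<^sup>2 = s\<^sup>2 * (cmod g)\<^sup>2" by (simp add: w_def norm_mult power_mult_distrib)
    ultimately have "2 * (s * (cmod g)\<^sup>2) \<le> (k * s) * (s * (cmod g)\<^sup>2)" by (simp add: power2_eq_square mult_ac)
    then have "2 \<le> k * s" using s g by simp
    also have "k * s \<le> (1 + \<bar>k\<bar>) * (1 / (1 + \<bar>k\<bar>))"
      by (intro mult_mono) (use s in \<open>auto simp: s_def\<close>)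
    also have "\<dots> = 1" by (simp add: add_pos_nonneg)
    finally show False by simp
  qed
  then have "cnj (cnj Q * x3 + of_real t * cnj z) = cnj (cnj P * x2)" by (simp add: g_def)
  then show ?thesis by (simp add: P_def[symmetric] Q_def[symmetric] mult_ac)
qed

text \<open>
  Suppose that a contraction with determinant \<open>x\<^sub>3\<close> realises the point. It maps \<open>(P, z a)\<close> to \<open>(Q, a)\<close>, and at
  the critical \<open>z\<close> these vectors have equal norm \<open>n\<close>. So the contraction is an isometry on the first one, and
  it has to be \<open>u v\<^sup>* + x\<^sub>3 u' v'\<^sup>*\<close> with \<open>u = (Q, a) / n\<close> and \<open>v = (P, z a) / n\<close>. That this matrix indeed has the
  prescribed entries follows from the critical equation and the equality of norms.
\<close>

lemma extremal_on_unitary_disc: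
  assumes crit: "cnj x2 * (1 - x2 * z) = cnj x3 * (x1 - x3 * z) + of_real t * z"
    and eq: "t * (1 - (cmod z)\<^sup>2) = (cmod (1 - x2 * z))\<^sup>2 - (cmod (x1 - x3 * z))\<^sup>2"
    and a: "(cmod a)\<^sup>2 = t" "t > 0"
  obtains u1 u2 v1 v2 where "(cmod u1)\<^sup>2 + (cmod u2)\<^sup>2 = 1" "(cmod v1)\<^sup>2 + (cmod v2)\<^sup>2 = 1"
    "vector [a, x1, x2, x3] = unitary_disc 1 u1 u2 v1 v2 x3"
proof -
  define P where "P = 1 - x2 * z"
  define Q where "Q = x1 - x3 * z"
  define n2 where "n2 = (cmod Q)\<^sup>2 + t"
  define n where "n = sqrt n2"
  have n2: "n2 > 0" using a by (simp add: n2_def add_nonneg_pos)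
  have n: "n > 0" "n * n = n2" using n2 by (simp_all add: n_def)
  have n2': "n2 = (cmod P)\<^sup>2 + t * (cmod z)\<^sup>2" using eq by (simp add: n2_def P_def Q_def algebra_simps)
  define T where "T = complex_of_real t"
  define N where "N = complex_of_real n2"
  have T: "T = a * cnj a" using a(1) complex_norm_square[of a] by (simp add: T_def)
  have N1: "N = Q * cnj Q + T"
    unfolding N_def n2_def of_real_add T_def complex_norm_square ..
  have N2: "N = P * cnj P + T * (z * cnj z)"
    unfolding N_def n2' of_real_add of_real_mult T_def complex_norm_square ..
  have c1: "cnj x2 * P = cnj x3 * Q + T * z" using crit by (simp add: P_def Q_def T_def)
  have "cnj (cnj x2 * P) = cnj (cnj x3 * Q + T * z)" using c1 by simp
  then have c2: "x2 * cnj P = x3 * cnj Q + T * cnj z" by (simp add: T_def)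
  have P: "P + x2 * z = 1" and Q: "Q + x3 * z = x1" by (simp_all add: P_def Q_def)
  have cP: "1 - P = x2 * z" by (simp add: P_def)
  have X1: "Q * cnj P + x3 * T * z = x1 * N"
  proof -
    have "x1 * N - (Q * cnj P + x3 * T * z) = Q * N + x3 * z * (N - T) - Q * cnj P"
      unfolding Q[symmetric] by (simp add: algebra_simps)
    also have "\<dots> = Q * (P * cnj P + T * (z * cnj z)) + x3 * z * (Q * cnj Q) - Q * cnj P"
      using N1 N2 by simp
    also have "\<dots> = Q * (z * (x3 * cnj Q + T * cnj z)) - Q * (1 - P) * cnj P"
      by (simp add: algebra_simps)
    also have "\<dots> = 0" unfolding c2[symmetric] cP by (simp add: algebra_simps)
    finally show ?thesis by simp
  qed
  have X2: "T * cnj z + x3 * cnj Q * P = x2 * N"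
  proof -
    have "x2 * N = P * (x2 * cnj P) + x2 * T * (z * cnj z)" unfolding N2 by (simp add: algebra_simps)
    also have "\<dots> = P * (x3 * cnj Q) + T * cnj z * (P + x2 * z)" unfolding c2 by (simp add: algebra_simps)
    finally show ?thesis unfolding P by (simp add: algebra_simps)
  qed
  have A: "cnj P - x3 * cnj Q * z = N"
  proof -
    have "N = P * cnj P + (T * cnj z) * z" unfolding N2 by (simp add: algebra_simps)
    also have "\<dots> = P * cnj P + (x2 * cnj P - x3 * cnj Q) * z" unfolding c2 by simp
    also have "\<dots> = (P + x2 * z) * cnj P - x3 * cnj Q * z" by (simp add: algebra_simps)
    finally show ?thesis unfolding P by simp
  qed
  have nn: "complex_of_real n * complex_of_real n = N" "complex_of_real n \<noteq> 0" "N \<noteq> 0"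
    using n n2 by (simp_all add: N_def flip: of_real_mult)
  have div: "p / of_real n * (q / of_real n) = p * q / N" for p q
    by (simp add: nn(1))
  show ?thesis
  proof
    show "(cmod (Q / n))\<^sup>2 + (cmod (a / n))\<^sup>2 = 1" "(cmod (P / n))\<^sup>2 + (cmod (z * a / n))\<^sup>2 = 1"
      using n n2 a n2' n2_def
      by (simp_all add: norm_divide norm_mult power_divide power_mult_distrib mult.commute
          power2_eq_square[of n] flip: add_divide_distrib)
    show "vector [a, x1, x2, x3] = unitary_disc 1 (Q / n) (a / n) (P / n) (z * a / n) x3"
    proof (rule vector_4_eqI)
      have "a * cnj P / N - x3 * (cnj Q * (z * a)) / N = a * (cnj P - x3 * cnj Q * z) / N"
        by (simp add: diff_divide_distrib[symmetric] algebra_simps)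
      also have "\<dots> = a" unfolding A using nn by simp
      finally show "(vector [a, x1, x2, x3] :: complex^4) $ 1 = unitary_disc 1 (Q / n) (a / n) (P / n) (z * a / n) x3 $ 1"
        by (simp add: nn(1) mult_ac)
      have "Q * cnj P / N + x3 * (cnj a * (z * a)) / N = (Q * cnj P + x3 * T * z) / N"
        unfolding T by (simp add: add_divide_distrib[symmetric] algebra_simps)
      also have "\<dots> = x1" unfolding X1 using nn by simp
      finally show "(vector [a, x1, x2, x3] :: complex^4) $ 2 = unitary_disc 1 (Q / n) (a / n) (P / n) (z * a / n) x3 $ 2"
        by (simp add: nn(1) mult_ac)
      have "a * (cnj z * cnj a) / N + x3 * (cnj Q * P) / N = (T * cnj z + x3 * cnj Q * P) / N"
        unfolding T by (simp add: add_divide_distrib[symmetric] algebra_simps)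
      also have "\<dots> = x2" unfolding X2 using nn by simp
      finally show "(vector [a, x1, x2, x3] :: complex^4) $ 3 = unitary_disc 1 (Q / n) (a / n) (P / n) (z * a / n) x3 $ 3"
        by (simp add: nn(1) mult_ac)
    qed simp
  qed
qed

section \<open>The distinguished boundary of the hexablock\<close>

text \<open>
  The disc with \<open>r = 1\<close> need not lie in the domain of analyticity. The maximum principle is applied to
  the discs with \<open>r < 1\<close>, and a limit point of the maximising boundary parameters is used as \<open>r\<close> tends to \<open>1\<close>.
\<close>

lemma unitary_disc_max_modulus:
  assumes f: "continuous_on (closure hexablock) f" "analytic_several f hexablock"
    and B: "\<And>w. w \<in> hexablock_edge \<Longrightarrow> cmod (f w) \<le> B"
    and u: "(cmod u1)\<^sup>2 + (cmod u2)\<^sup>2 = 1" and v: "(cmod v1)\<^sup>2 + (cmod v2)\<^sup>2 = 1"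
    and \<zeta>: "cmod \<zeta> \<le> 1"
  shows "cmod (f (unitary_disc 1 u1 u2 v1 v2 \<zeta>)) \<le> B"
proof -
  let ?D = "\<lambda>r. unitary_disc r u1 u2 v1 v2"
  let ?r = "\<lambda>n. 1 - inverse (real (Suc n))"
  let ?K = "{0..1::real} \<times> cball (0::complex) 1"
  have mem: "?D r \<eta> \<in> closure hexablock" if "0 \<le> r" "r \<le> 1" "cmod \<eta> \<le> 1" for r \<eta>
  proof (cases "r = 1")
    case True
    then show ?thesis using unitary_disc_in_closure[OF u v] that by simp
  next
    case False
    then show ?thesis
      using unitary_disc_in_hexablock[OF u v, of r \<eta>] that by (auto intro: subsetD[OF closure_subset])
  qed
  have cont: "continuous_on ?K (\<lambda>p. f (case p of (r, \<zeta>) \<Rightarrow> ?D r \<zeta>))"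
    by (rule continuous_on_compose2[OF f(1) continuous_on_unitary_disc]) (use mem in auto)
  have "\<exists>\<eta>. cmod \<eta> = 1 \<and> cmod (f (?D (?r n) \<zeta>)) \<le> cmod (f (?D (?r n) \<eta>))" for n
    unfolding unitary_disc_def
    by (rule max_modulus_affine_disc[OF f _ zero_less_one \<zeta>])
      (use unitary_disc_in_hexablock[OF u v shrink_bounds, unfolded unitary_disc_def] less_imp_le in blast)+
  then obtain \<eta> where \<eta>: "\<And>n. cmod (\<eta> n) = 1"
    "\<And>n. cmod (f (?D (?r n) \<zeta>)) \<le> cmod (f (?D (?r n) (\<eta> n)))" by metis
  have "\<forall>n. \<eta> n \<in> sphere 0 1" using \<eta>(1) by simp
  then obtain l s where l: "l \<in> sphere 0 1" and s: "strict_mono s" and lim: "(\<eta> \<circ> s) \<longlonglongrightarrow> l"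
    using compact_sphere[of "0::complex" 1] unfolding compact_def by blast
  have rs: "(\<lambda>n. ?r (s n)) \<longlonglongrightarrow> 1"
    using LIMSEQ_subseq_LIMSEQ[OF shrink_tendsto_1 s] by (simp add: o_def)
  have inK: "(?r n, \<xi>) \<in> ?K" if "cmod \<xi> \<le> 1" for n \<xi> using that shrink_bounds[of n] by auto
  have "(\<lambda>n. (?r (s n), \<zeta>)) \<longlonglongrightarrow> (1, \<zeta>)" "(\<lambda>n. (?r (s n), \<eta> (s n))) \<longlonglongrightarrow> (1, l)"
    using lim by (auto intro!: tendsto_Pair rs simp: o_def simp del: of_nat_Suc)
  then have "(\<lambda>n. f (?D (?r (s n)) \<zeta>)) \<longlonglongrightarrow> f (?D 1 \<zeta>)"
    "(\<lambda>n. f (?D (?r (s n)) (\<eta> (s n)))) \<longlonglongrightarrow> f (?D 1 l)"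
    using continuous_on_tendsto_compose[OF cont, of "\<lambda>n. (?r (s n), \<zeta>)" "(1, \<zeta>)" sequentially]
      continuous_on_tendsto_compose[OF cont, of "\<lambda>n. (?r (s n), \<eta> (s n))" "(1, l)" sequentially]
      \<zeta> \<eta>(1) l inK by (simp_all del: of_nat_Suc)
  then have "cmod (f (?D 1 \<zeta>)) \<le> cmod (f (?D 1 l))"
    by (rule LIMSEQ_le[OF tendsto_norm tendsto_norm]) (use \<eta>(2) in blast)
  also have "\<dots> \<le> B" using l by (intro B unitary_disc_in_edge[OF u v]) simp
  finally show ?thesis .
qed

text \<open>
  In two steps: the maximum principle in the first coordinate moves the point to extremal radius, where
  it lies on a disc whose boundary is in the edge.
\<close>

lemma hexablock_max_modulus:
  assumes f: "continuous_on (closure hexablock) f" "analytic_several f hexablock"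
    and B: "\<And>w. w \<in> hexablock_edge \<Longrightarrow> cmod (f w) \<le> B" and y: "y \<in> hexablock"
  shows "cmod (f y) \<le> B"
proof -
  obtain a x1 x2 x3 where yv: "y = vector [a, x1, x2, x3]"
    using y unfolding hexablock_def by blast
  note D = hexablockD[OF y[unfolded yv]]
  obtain t z where t: "t > 0" "cmod z < 1"
    "\<And>w. cmod w \<le> 1 \<Longrightarrow> t * (1 - (cmod w)\<^sup>2) \<le> (cmod (1 - x2 * w))\<^sup>2 - (cmod (x1 - x3 * w))\<^sup>2"
    "t * (1 - (cmod z)\<^sup>2) = (cmod (1 - x2 * z))\<^sup>2 - (cmod (x1 - x3 * z))\<^sup>2"
    by (rule tetrablock_extremal_radius[OF D(1)]) blast
  have "1 - (cmod z)\<^sup>2 > 0" using t(2) by (simp add: abs_square_less_1)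
  moreover have "(cmod a)\<^sup>2 * (1 - (cmod z)\<^sup>2) \<le> t * (1 - (cmod z)\<^sup>2)" using D(2)[OF t(2)] t(4) by simp
  ultimately have "(cmod a)\<^sup>2 \<le> t" by simp
  then have a: "cmod a \<le> sqrt t" by (simp add: real_le_rsqrt)
  define p where "p = (vector [0, x1, x2, x3] :: complex^4)"
  define q where "q = (vector [1, 0, 0, 0] :: complex^4)"
  have pq: "p + b *s q = vector [b, x1, x2, x3]" for b
    by (rule vector_4_eqI) (simp_all add: p_def q_def)
  have disc: "p + b *s q \<in> hexablock" if b: "cmod b < sqrt t" for b
    unfolding pq
  proof (rule hexablockI[OF D(1)])
    have "(cmod b)\<^sup>2 < (sqrt t)\<^sup>2" using b by (intro power_strict_mono) auto
    then have bt: "(cmod b)\<^sup>2 < t" using t(1) by simp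
    show "0 \<le> (cmod b)\<^sup>2 / t" "(cmod b)\<^sup>2 / t < 1" using t(1) bt by simp_all
    fix w :: complex assume w: "cmod w < 1"
    have "(cmod b)\<^sup>2 * (1 - (cmod w)\<^sup>2) = (cmod b)\<^sup>2 / t * (t * (1 - (cmod w)\<^sup>2))" using t(1) by simp
    also have "\<dots> \<le> (cmod b)\<^sup>2 / t * ((cmod (1 - x2 * w))\<^sup>2 - (cmod (x1 - x3 * w))\<^sup>2)"
      by (rule mult_left_mono[OF t(3)]) (use w t(1) in auto)
    finally show "(cmod b)\<^sup>2 * (1 - (cmod w)\<^sup>2) \<le> (cmod b)\<^sup>2 / t * ((cmod (1 - x2 * w))\<^sup>2 - (cmod (x1 - x3 * w))\<^sup>2)" .
  qed
  have st: "sqrt t > 0" using t(1) by simp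
  obtain b where b: "cmod b = sqrt t" "cmod (f (p + a *s q)) \<le> cmod (f (p + b *s q))"
    by (rule max_modulus_affine_disc[OF f disc st a])
  have bt: "(cmod b)\<^sup>2 = t" using b(1) t(1) by simp
  obtain u1 u2 v1 v2 where uv: "(cmod u1)\<^sup>2 + (cmod u2)\<^sup>2 = 1" "(cmod v1)\<^sup>2 + (cmod v2)\<^sup>2 = 1"
    "vector [b, x1, x2, x3] = unitary_disc 1 u1 u2 v1 v2 x3"
    by (rule extremal_on_unitary_disc[OF extremal_critical[OF t(3) t(2) t(4)] t(4) bt t(1)])
  have "(cmod x3)\<^sup>2 \<le> 1" using tetrablock_defect[OF D(1)] norm_ge_zero[of "x2 - cnj x1 * x3"] by linarith
  then have x3: "cmod x3 \<le> 1" by (simp add: abs_square_le_1)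
  have "cmod (f y) \<le> cmod (f (unitary_disc 1 u1 u2 v1 v2 x3))"
    using b(2) unfolding pq uv(3) yv .
  also have "\<dots> \<le> B" by (rule unitary_disc_max_modulus[OF f B uv(1,2) x3])
  finally show ?thesis .
qed

lemma closure_hexablock_bounds:
  assumes "z \<in> closure hexablock"
  shows "(cmod (z $ 1))\<^sup>2 + (cmod (z $ 2))\<^sup>2 \<le> 1"
    and "cmod (z $ 3 - cnj (z $ 2) * z $ 4) \<le> 1 - (cmod (z $ 4))\<^sup>2"
proof -
  let ?S = "{z::complex^4. (cmod (z $ 1))\<^sup>2 + (cmod (z $ 2))\<^sup>2 \<le> 1 \<and>
    cmod (z $ 3 - cnj (z $ 2) * z $ 4) \<le> 1 - (cmod (z $ 4))\<^sup>2}"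
  have "closed ?S" by (intro closed_Collect_conj closed_Collect_le continuous_intros)
  moreover have "hexablock \<subseteq> ?S"
  proof
    fix y assume y: "y \<in> hexablock"
    obtain a x1 x2 x3 where yv: "y = vector [a, x1, x2, x3]"
      using y unfolding hexablock_def by blast
    note D = hexablockD[OF y[unfolded yv]]
    show "y \<in> ?S" using D(2)[of 0] tetrablock_defect[OF D(1)] by (simp add: yv)
  qed
  ultimately have "closure hexablock \<subseteq> ?S" by (intro closure_minimal)
  then show "(cmod (z $ 1))\<^sup>2 + (cmod (z $ 2))\<^sup>2 \<le> 1"
    "cmod (z $ 3 - cnj (z $ 2) * z $ 4) \<le> 1 - (cmod (z $ 4))\<^sup>2" using assms by auto
qed

text \<open>
  Each of \<open>p = cnj w\<^sub>4 z\<^sub>4\<close> and \<open>q = cnj w\<^sub>1 z\<^sub>1 + cnj w\<^sub>2 z\<^sub>2\<close> has modulus at most \<open>1\<close> on the closure, so \<open>|2 + p + q| \<ge> 4\<close>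
  forces \<open>p = q = 1\<close>. This fixes \<open>z\<^sub>4\<close>, \<open>z\<^sub>1\<close> and \<open>z\<^sub>2\<close>, and \<open>|z\<^sub>4| = 1\<close> then determines \<open>z\<^sub>3\<close>.
\<close>

lemma edge_peak:
  assumes w: "w \<in> hexablock_edge" and z: "z \<in> closure hexablock" and
    large: "4 \<le> cmod (2 + (cnj (w $ 1) * z $ 1 + cnj (w $ 2) * z $ 2) + cnj (w $ 4) * z $ 4)"
  shows "z = w"
proof -
  define p where "p = cnj (w $ 4) * z $ 4"
  define q where "q = cnj (w $ 1) * z $ 1 + cnj (w $ 2) * z $ 2"
  note zb = closure_hexablock_bounds[OF z]
  have w4: "cmod (w $ 4) = 1" and w2: "w $ 2 = cnj (w $ 3) * w $ 4"
    and w12: "(cmod (w $ 1))\<^sup>2 + (cmod (w $ 2))\<^sup>2 = 1" using w by (auto simp: hexablock_edge_def)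
  have ww: "w $ 4 * cnj (w $ 4) = 1" using complex_norm_square[of "w $ 4"] w4 by simp
  have "(cmod (z $ 4))\<^sup>2 \<le> 1" using zb(2) norm_ge_zero[of "z $ 3 - cnj (z $ 2) * z $ 4"] by linarith
  then have p: "cmod p \<le> 1" using w4 by (simp add: p_def norm_mult abs_square_le_1)
  have "(cmod q)\<^sup>2 \<le> ((cmod (w $ 1))\<^sup>2 + (cmod (w $ 2))\<^sup>2) * ((cmod (z $ 1))\<^sup>2 + (cmod (z $ 2))\<^sup>2)"
    using rotated_square_sum[of "cnj (w $ 1)" "z $ 1" "w $ 2" "z $ 2"]
      zero_le_power2[of "cmod (w $ 2 * z $ 1 - cnj (cnj (w $ 1)) * z $ 2)"]
    unfolding q_def complex_mod_cnj by linarith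
  also have "\<dots> \<le> 1" unfolding w12 using zb(1) by simp
  finally have q: "cmod q \<le> 1" by (simp add: abs_square_le_1)
  have "4 \<le> cmod ((1 + p) + (1 + q))"
    using large by (simp add: p_def q_def add_ac)
  then have "4 \<le> cmod (1 + p) + cmod (1 + q)" using norm_triangle_ineq[of "1 + p" "1 + q"] by linarith
  moreover have "cmod (1 + p) \<le> 2" "cmod (1 + q) \<le> 2"
    using norm_triangle_ineq[of 1 p] norm_triangle_ineq[of 1 q] p q by simp_all
  ultimately have "1 \<le> cmod (1 + p) / 2" "1 \<le> cmod (1 + q) / 2" by simp_all
  then have p1: "p = 1" and q1: "q = 1" using norm_midpoint_one_eq_1 p q by blast+
  have "z $ 4 = (w $ 4 * cnj (w $ 4)) * z $ 4" by (simp add: ww)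
  also have "\<dots> = w $ 4 * p" by (simp add: p_def)
  finally have z4: "z $ 4 = w $ 4" using p1 by simp
  have "(cmod (z $ 1 - w $ 1))\<^sup>2 + (cmod (z $ 2 - w $ 2))\<^sup>2 =
     ((cmod (z $ 1))\<^sup>2 + (cmod (z $ 2))\<^sup>2) + ((cmod (w $ 1))\<^sup>2 + (cmod (w $ 2))\<^sup>2) - 2 * Re q"
    using cmod_diff_mult_square[of "z $ 1" "w $ 1" 1] cmod_diff_mult_square[of "z $ 2" "w $ 2" 1]
    by (simp add: q_def algebra_simps)
  also have "\<dots> \<le> 0" using zb(1) w12 q1 by simp
  finally have "(cmod (z $ 1 - w $ 1))\<^sup>2 + (cmod (z $ 2 - w $ 2))\<^sup>2 \<le> 0" .
  then have z12: "z $ 1 = w $ 1" "z $ 2 = w $ 2" by (simp_all add: sum_power2_le_zero_iff)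
  have "z $ 3 = cnj (z $ 2) * z $ 4" using zb(2) w4 unfolding z4 by simp
  also have "\<dots> = w $ 3 * (w $ 4 * cnj (w $ 4))" unfolding z12 z4 w2 by simp
  finally have "z $ 3 = w $ 3" by (simp add: ww)
  then show ?thesis using z12 z4 by (intro vector_4_eqI)
qed

text \<open>
  The peak function at \<open>w\<close> is the affine function \<open>2 + cnj w\<^sub>1 z\<^sub>1 + cnj w\<^sub>2 z\<^sub>2 + cnj w\<^sub>4 z\<^sub>4\<close>.
\<close>

theorem distinguished_boundary_hexablock: "distinguished_boundary hexablock = hexablock_edge"
proof (rule distinguished_boundary_eqI)
  show "closed hexablock_edge" by (rule compact_imp_closed[OF compact_hexablock_edge])
  show "hexablock_edge \<subseteq> closure hexablock" by (rule edge_subset_closure)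
  show "\<exists>w\<in>hexablock_edge. \<forall>z\<in>closure hexablock. cmod (f z) \<le> cmod (f w)"
    if f: "continuous_on (closure hexablock) f" "analytic_several f hexablock" for f
  proof -
    have "vector [0, 1, 1, 1] \<in> hexablock_edge" by (simp add: hexablock_edge_def)
    then have "hexablock_edge \<noteq> {}" by blast
    moreover have "continuous_on hexablock_edge (\<lambda>z. cmod (f z))"
      by (intro continuous_on_norm continuous_on_subset[OF f(1) edge_subset_closure])
    ultimately obtain w where w: "w \<in> hexablock_edge" "\<And>z. z \<in> hexablock_edge \<Longrightarrow> cmod (f z) \<le> cmod (f w)"
      using continuous_attains_sup[OF compact_hexablock_edge] by blast
    have "cmod (f z) \<le> cmod (f w)" if "z \<in> closure hexablock" for z
      by (rule continuous_on_closure_norm_le[OF f(1) _ that])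
        (use hexablock_max_modulus[OF f w(2)] in blast)
    then show ?thesis using w(1) by blast
  qed
  show "\<exists>f. continuous_on (closure hexablock) f \<and> analytic_several f hexablock \<and>
      (\<forall>z\<in>closure hexablock. z \<noteq> w \<longrightarrow> cmod (f z) < cmod (f w))" if w: "w \<in> hexablock_edge" for w
  proof -
    define c where "c = (vector [cnj (w $ 1), cnj (w $ 2), 0, cnj (w $ 4)] :: complex^4)"
    define f where "f z = 2 + (\<Sum>i\<in>UNIV. c $ i * z $ i)" for z
    have f: "f z = 2 + (cnj (w $ 1) * z $ 1 + cnj (w $ 2) * z $ 2) + cnj (w $ 4) * z $ 4" for z
      by (simp add: f_def c_def sum_4)
    have "f w = 2 + of_real ((cmod (w $ 1))\<^sup>2 + (cmod (w $ 2))\<^sup>2) + of_real ((cmod (w $ 4))\<^sup>2)"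
      unfolding f of_real_add complex_norm_square by (simp add: mult.commute)
    moreover have "(cmod (w $ 1))\<^sup>2 + (cmod (w $ 2))\<^sup>2 = 1" "(cmod (w $ 4))\<^sup>2 = 1"
      using w unfolding hexablock_edge_def mem_Collect_eq by (blast, simp)
    ultimately have "f w = 4" by (simp only:) simp
    then have lt: "cmod (f z) < cmod (f w)" if "z \<in> closure hexablock" "z \<noteq> w" for z
      using edge_peak[OF w that(1)] that(2) unfolding f[symmetric] by force
    have "continuous_on (closure hexablock) f" "analytic_several f hexablock"
      unfolding f_def by (rule affine_analytic_several)+
    with lt show ?thesis by blast
  qed
qed

section \<open>Adjoining a unitary to the approximate spectrum\<close>

text \<open>
  The vectors \<open>g\<^sub>k = \<Sum>\<^sub>j \<omega>\<^sub>k\<^sup>j U\<^sup>j v\<close>, with \<open>\<omega>\<^sub>k\<close> running through the \<open>m\<close>-th roots of unity, are nearly eigenvectors: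
  by telescoping, \<open>\<parallel>\<omega>\<^sub>k U g\<^sub>k - g\<^sub>k\<parallel> = \<parallel>U\<^sup>m v - v\<parallel> \<le> 2 \<parallel>v\<parallel>\<close>, while \<open>\<Sum> \<parallel>g\<^sub>k\<parallel>\<^sup>2 = m\<^sup>2 \<parallel>v\<parallel>\<^sup>2\<close> by Parseval. As \<open>R\<^sub>i\<close> commutes
  with \<open>U\<close>, Parseval also gives \<open>\<Sum> \<parallel>R\<^sub>i g\<^sub>k\<parallel>\<^sup>2 = m\<^sup>2 \<parallel>R\<^sub>i v\<parallel>\<^sup>2\<close>. So the claim holds on average over \<open>k\<close>, hence for
  some \<open>k\<close>.
\<close>

lemma unitary_averaging:
  fixes R :: "'n::finite \<Rightarrow> 'a::complex_hilbert \<Rightarrow> 'a"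
  assumes U: "unitary_op U"
    and R_add: "\<And>i x y. R i (x + y) = R i x + R i y" and R_sc: "\<And>i c x. R i (c *\<^sub>C x) = c *\<^sub>C R i x"
    and R_U: "\<And>i x. R i (U x) = U (R i x)"
    and v: "v \<noteq> 0" "\<And>i. norm (R i v) \<le> e * norm v" and m: "m > 0"
  obtains u x where "cmod u = 1" "x \<noteq> 0"
    "(\<Sum>i\<in>UNIV. (norm (R i x))\<^sup>2) + (norm (U x - u *\<^sub>C x))\<^sup>2 \<le> (real CARD('n) * e\<^sup>2 + 4 / real m) * (norm x)\<^sup>2"
proof -
  have clU: "U (c *\<^sub>C x) = c *\<^sub>C U x" for c x
    using U by (simp add: unitary_op_def clinear_op_def)
  have R0: "R i 0 = 0" for i using R_add[of i 0 0] by simp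
  have R_sum: "R i (\<Sum>j\<in>J. f j) = (\<Sum>j\<in>J. R i (f j))" for i J and f :: "nat \<Rightarrow> 'a"
    by (induction J rule: infinite_finite_induct) (simp_all add: R0 R_add)
  define V where "V y j = ((blinfun_apply U) ^^ j) y" for y j
  have nV: "norm (V y j) = norm y" for y j
    unfolding V_def by (induction j) (simp_all add: norm_unitary[OF U])
  have RV: "R i (V y j) = V (R i y) j" for i y j
    unfolding V_def by (induction j) (simp_all add: R_U)
  define g where "g k y = (\<Sum>j<m. unity_root m k ^ j *\<^sub>C V y j)" for k y
  have Rg: "R i (g k y) = g k (R i y)" for i k y by (simp add: g_def R_sum R_sc RV)
  have parseval: "(\<Sum>k<m. (norm (g k y))\<^sup>2) = (real m)\<^sup>2 * (norm y)\<^sup>2" for y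
    unfolding g_def discrete_parseval by (simp add: nV power2_eq_square)
  have Ug: "norm (U (g k v) - cnj (unity_root m k) *\<^sub>C g k v) \<le> 2 * norm v" for k
  proof -
    let ?w = "unity_root m k"
    have w: "cnj ?w * ?w = 1" using complex_norm_square[of ?w] by (simp add: mult.commute)
    have "?w *\<^sub>C U (g k v) = (\<Sum>j<m. ?w ^ Suc j *\<^sub>C V v (Suc j))"
      by (simp add: g_def blinfun.sum_right clU scaleC_sum_right scaleC_scaleC V_def)
    also have "\<dots> = g k v + (?w ^ m *\<^sub>C V v m - v)"
      using sum.lessThan_Suc_shift[of "\<lambda>j. ?w ^ j *\<^sub>C V v j" m]
      by (simp add: g_def V_def algebra_simps)
    finally have 1: "?w *\<^sub>C U (g k v) = g k v + (V v m - v)" by (simp add: unity_root_power_order[OF m])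
    have "U (g k v) - cnj ?w *\<^sub>C g k v = cnj ?w *\<^sub>C (?w *\<^sub>C U (g k v) - g k v)"
      by (simp add: scaleC_diff_right scaleC_scaleC w)
    also have "norm \<dots> = norm (V v m - v)" by (simp add: norm_scaleC 1)
    also have "\<dots> \<le> norm (V v m) + norm v" by (rule norm_triangle_ineq4)
    finally show ?thesis by (simp add: nV)
  qed
  define F where "F k = (\<Sum>i\<in>UNIV. (norm (R i (g k v)))\<^sup>2) + (norm (U (g k v) - cnj (unity_root m k) *\<^sub>C g k v))\<^sup>2" for k
  define d where "d = real CARD('n) * e\<^sup>2 + 4 / real m"
  have "(\<Sum>k<m. F k) = (\<Sum>i\<in>UNIV. \<Sum>k<m. (norm (R i (g k v)))\<^sup>2)
      + (\<Sum>k<m. (norm (U (g k v) - cnj (unity_root m k) *\<^sub>C g k v))\<^sup>2)"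
    unfolding F_def sum.distrib by (subst sum.swap) simp
  also have "\<dots> \<le> (\<Sum>i\<in>(UNIV::'n set). (real m)\<^sup>2 * (e * norm v)\<^sup>2) + (\<Sum>k<m. (2 * norm v)\<^sup>2)"
    unfolding Rg parseval by (intro add_mono sum_mono mult_left_mono power_mono v Ug) auto
  also have "\<dots> = d * ((real m)\<^sup>2 * (norm v)\<^sup>2)"
    using m by (simp add: d_def power_mult_distrib field_simps power2_eq_square)
  also have "\<dots> = (\<Sum>k<m. d * (norm (g k v))\<^sup>2)"
    unfolding parseval[symmetric] by (simp add: sum_distrib_left)
  finally have le: "(\<Sum>k<m. F k) \<le> (\<Sum>k<m. d * (norm (g k v))\<^sup>2)" .
  have "\<exists>k<m. g k v \<noteq> 0 \<and> F k \<le> d * (norm (g k v))\<^sup>2"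
  proof (rule ccontr)
    assume no: "\<not> ?thesis"
    have ge: "d * (norm (g k v))\<^sup>2 \<le> F k" if "k < m" for k
    proof (cases "g k v = 0")
      case True
      then show ?thesis by (simp add: F_def R0 sum_nonneg)
    qed (use no that in force)
    have "(\<Sum>k<m. (norm (g k v))\<^sup>2) \<noteq> 0" unfolding parseval using m v(1) by simp
    then obtain k where k: "k < m" "g k v \<noteq> 0" by (metis (no_types, lifting) lessThan_iff norm_zero sum.neutral zero_power2)
    have "(\<Sum>k<m. d * (norm (g k v))\<^sup>2) < (\<Sum>k<m. F k)"
      by (rule sum_strict_mono_ex1) (use ge k no in \<open>auto intro!: bexI[of _ k]\<close>)
    then show False using le by simp
  qed
  then obtain k where "k < m" "g k v \<noteq> 0" "F k \<le> d * (norm (g k v))\<^sup>2" by blast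
  then show ?thesis using that[of "cnj (unity_root m k)" "g k v"] by (simp add: F_def d_def)
qed

text \<open>
  A projection property: a point of the approximate spectrum of a tuple extends to one of the tuple
  with \<open>U\<close> adjoined. Averaging produces approximate eigenvalues on the unit circle, which have a limit
  point.
\<close>

lemma joint_approx_spectrum_extend:
  fixes T :: "('a::complex_hilbert \<Rightarrow>\<^sub>L 'a)^'n::finite"
  assumes z: "z \<in> joint_approx_spectrum T" and U: "unitary_op U"
    and cl: "\<And>i. clinear_op (T $ i)" and comm: "\<And>i. T $ i o\<^sub>L U = U o\<^sub>L T $ i"
  shows "\<exists>u. \<forall>e>0. \<exists>x. x \<noteq> 0 \<and>
    (\<forall>i. norm ((T $ i) x - z $ i *\<^sub>C x) \<le> e * norm x) \<and> norm (U x - u *\<^sub>C x) \<le> e * norm x"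
proof -
  define R where "R i x = (T $ i) x - z $ i *\<^sub>C x" for i x
  have clU: "U (c *\<^sub>C x) = c *\<^sub>C U x" for c x
    using U by (simp add: unitary_op_def clinear_op_def)
  have R: "R i (x + y) = R i x + R i y" "R i (c *\<^sub>C x) = c *\<^sub>C R i x" "R i (U x) = U (R i x)" for i x y c
    using cl[of i] commute_apply[OF comm[of i]]
    by (simp_all add: R_def blinfun.add_right blinfun.diff_right clinear_op_def scaleC_add_right
        scaleC_diff_right scaleC_scaleC mult.commute clU)
  have pt: "\<exists>u x. cmod u = 1 \<and> x \<noteq> 0 \<and> (\<forall>i. norm (R i x) \<le> e * norm x) \<and> norm (U x - u *\<^sub>C x) \<le> e * norm x"
    if e: "e > 0" for e
  proof -
    define N where "N = real CARD('n)"
    have N: "N > 0" by (simp add: N_def)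
    \<comment> \<open>\<open>e'\<close> and \<open>m\<close> are chosen so that each of the two error terms in the average is at most \<open>e\<^sup>2 / 2\<close>\<close>
    define e' where "e' = sqrt (e\<^sup>2 / (2 * N))"
    have e': "e' > 0" "N * e'\<^sup>2 = e\<^sup>2 / 2" using e N by (simp_all add: e'_def)
    obtain v where v: "v \<noteq> 0" "\<And>i. norm (R i v) \<le> e' * norm v"
      using z e'(1) by (auto simp: joint_approx_spectrum_def R_def)
    obtain m :: nat where m0: "8 / e\<^sup>2 < real m" using reals_Archimedean2 by blast
    then have m: "m > 0" using e by (cases m) (auto simp: not_less[symmetric])
    have "8 < real m * e\<^sup>2" using m0 e by (simp add: pos_divide_less_eq)
    then have "4 / real m \<le> e\<^sup>2 / 2" using m by (simp add: pos_divide_le_eq field_simps)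
    then have d: "N * e'\<^sup>2 + 4 / real m \<le> e\<^sup>2" using e' by simp
    obtain u x where ux: "cmod u = 1" "x \<noteq> 0"
      "(\<Sum>i\<in>UNIV. (norm (R i x))\<^sup>2) + (norm (U x - u *\<^sub>C x))\<^sup>2 \<le> (N * e'\<^sup>2 + 4 / real m) * (norm x)\<^sup>2"
      by (rule unitary_averaging[OF U R v m]) (simp add: N_def)
    have "(\<Sum>i\<in>UNIV. (norm (R i x))\<^sup>2) + (norm (U x - u *\<^sub>C x))\<^sup>2 \<le> (e * norm x)\<^sup>2"
      using ux(3) mult_right_mono[OF d, of "(norm x)\<^sup>2"] by (simp add: power_mult_distrib)
    moreover have "(norm (R i x))\<^sup>2 \<le> (\<Sum>i\<in>UNIV. (norm (R i x))\<^sup>2)" for i by (rule member_le_sum) auto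
    moreover have "(\<Sum>i\<in>UNIV. (norm (R i x))\<^sup>2) \<ge> 0" by (simp add: sum_nonneg)
    ultimately have sq: "(norm (R i x))\<^sup>2 \<le> (e * norm x)\<^sup>2" "(norm (U x - u *\<^sub>C x))\<^sup>2 \<le> (e * norm x)\<^sup>2" for i
      using zero_le_power2[of "norm (U x - u *\<^sub>C x)"] by (smt (verit))+
    have "norm (R i x) \<le> e * norm x" for i
      by (rule power2_le_imp_le[OF sq(1)]) (use e in simp)
    moreover have "norm (U x - u *\<^sub>C x) \<le> e * norm x"
      by (rule power2_le_imp_le[OF sq(2)]) (use e in simp)
    ultimately show ?thesis using ux by blast
  qed
  have "\<forall>n::nat. \<exists>u x. cmod u = 1 \<and> x \<noteq> 0 \<and> (\<forall>i. norm (R i x) \<le> inverse (real (Suc n)) * norm x)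
      \<and> norm (U x - u *\<^sub>C x) \<le> inverse (real (Suc n)) * norm x"
    using pt by (simp del: of_nat_Suc)
  then obtain u x where ux: "\<And>n. cmod (u n) = 1" "\<And>n. x n \<noteq> 0"
    "\<And>n i. norm (R i (x n)) \<le> inverse (real (Suc n)) * norm (x n)"
    "\<And>n. norm (U (x n) - u n *\<^sub>C x n) \<le> inverse (real (Suc n)) * norm (x n)" by metis
  have "\<forall>n. u n \<in> sphere 0 1" using ux(1) by simp
  then obtain l s where s: "strict_mono s" and lim: "(u \<circ> s) \<longlonglongrightarrow> l"
    using compact_sphere[of "0::complex" 1] unfolding compact_def by blast
  have inv: "(\<lambda>n. inverse (real (Suc (s n)))) \<longlonglongrightarrow> 0"
    using LIMSEQ_subseq_LIMSEQ[OF LIMSEQ_inverse_real_of_nat s] by (simp add: o_def)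
  have "\<exists>x. x \<noteq> 0 \<and> (\<forall>i. norm ((T $ i) x - z $ i *\<^sub>C x) \<le> e * norm x) \<and> norm (U x - l *\<^sub>C x) \<le> e * norm x"
    if e: "e > 0" for e
  proof -
    have "eventually (\<lambda>n. inverse (real (Suc (s n))) < e / 2) sequentially"
      using order_tendstoD(2)[OF inv, of "e / 2"] e by simp
    moreover have "eventually (\<lambda>n. cmod (u (s n) - l) < e / 2) sequentially"
      using tendstoD[OF lim, of "e / 2"] e by (simp add: dist_norm)
    ultimately obtain n where n: "inverse (real (Suc (s n))) < e / 2" "cmod (u (s n) - l) < e / 2"
      using eventually_conj eventually_happens'[OF sequentially_bot] by (metis (no_types, lifting))
    let ?x = "x (s n)"
    have h: "inverse (real (Suc (s n))) * norm ?x \<le> (e / 2) * norm ?x" using n(1) by (intro mult_right_mono) auto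
    have "norm (R i ?x) \<le> e * norm ?x" for i
    proof -
      have "(e / 2) * norm ?x \<le> e * norm ?x" using e by (intro mult_right_mono) auto
      then show ?thesis by (rule order_trans[OF order_trans[OF ux(3) h]])
    qed
    moreover have "norm (U ?x - l *\<^sub>C ?x) \<le> e * norm ?x"
    proof -
      have "norm (U ?x - l *\<^sub>C ?x) = norm ((U ?x - u (s n) *\<^sub>C ?x) + (u (s n) - l) *\<^sub>C ?x)"
        by (simp add: scaleC_diff_left)
      also have "\<dots> \<le> (e / 2) * norm ?x + (e / 2) * norm ?x"
      proof (rule order_trans[OF norm_triangle_ineq add_mono])
        show "norm (U ?x - u (s n) *\<^sub>C ?x) \<le> (e / 2) * norm ?x" by (rule order_trans[OF ux(4) h])
        show "norm ((u (s n) - l) *\<^sub>C ?x) \<le> (e / 2) * norm ?x"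
          unfolding norm_scaleC by (rule mult_right_mono) (use n(2) in auto)
      qed
      finally show ?thesis by simp
    qed
    ultimately show ?thesis using ux(2)[of "s n"] unfolding R_def by blast
  qed
  then show ?thesis by blast
qed

section \<open>Comparison of the three kinds of unitaries\<close>

text \<open>
  Fuglede's theorem makes commuting normal operators doubly commuting.
\<close>

corollary taylor_spectrum_commuting_normal:
  fixes T :: "('a::complex_hilbert \<Rightarrow>\<^sub>L 'a)^('n::{finite,linorder})"
  assumes normal: "\<And>i. normal_op (T $ i)" and comm: "\<And>i j. T $ i o\<^sub>L T $ j = T $ j o\<^sub>L T $ i"
  shows "taylor_spectrum T = joint_approx_spectrum T"
  by (rule taylor_spectrum_doubly_commuting[OF assms])
    (rule fuglede[OF normal normal_op_clinear[OF normal] comm])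

lemma domain_unitary_iff_approx:
  "domain_unitary \<Omega> T \<longleftrightarrow> (\<forall>i. normal_op (T $ i)) \<and> (\<forall>i j. T $ i o\<^sub>L T $ j = T $ j o\<^sub>L T $ i) \<and>
    joint_approx_spectrum T \<subseteq> distinguished_boundary \<Omega>"
  unfolding domain_unitary_def using taylor_spectrum_commuting_normal[of T] by auto

lemma mem_sphere_2: "(z :: complex^2) \<in> sphere 0 1 \<longleftrightarrow> (cmod (z $ 1))\<^sup>2 + (cmod (z $ 2))\<^sup>2 = 1"
  by (simp add: norm_vec_def L2_set_def sum_2)

text \<open>
  Relations between the coordinates of a point of the approximate spectrum are all derived by exhibiting two
  values with the same approximate eigenvectors. The factor \<open>K\<close> absorbs the constants of the error estimates.
\<close>

lemma approx_eigenvalue_unique: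
  fixes z w :: complex
  assumes "\<And>e. e > 0 \<Longrightarrow> \<exists>x::'a::complex_hilbert. x \<noteq> 0 \<and> norm (z *\<^sub>C x - w *\<^sub>C x) \<le> K * e * norm x"
  shows "z = w"
proof (rule ccontr)
  assume "z \<noteq> w"
  then have pos: "cmod (z - w) > 0" by simp
  have le: "cmod (z - w) \<le> K * e" if e: "e > 0" for e
  proof -
    obtain x :: 'a where x: "x \<noteq> 0" "norm (z *\<^sub>C x - w *\<^sub>C x) \<le> K * e * norm x" using assms[OF e] by blast
    then have "cmod (z - w) * norm x \<le> (K * e) * norm x" by (simp add: scaleC_diff_left[symmetric] norm_scaleC)
    then show ?thesis using x(1) by (simp add: mult_le_cancel_right)
  qed
  define c where "c = 1 + \<bar>K\<bar>"
  have c: "c > 0" "K \<le> c" by (simp_all add: c_def)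
  define e where "e = cmod (z - w) / (2 * c)"
  have e: "e > 0" using pos c by (simp add: e_def)
  have "K * e \<le> c * e" using e c by (intro mult_right_mono) auto
  also have "\<dots> = cmod (z - w) / 2" using c by (simp add: e_def)
  finally show False using le[OF e] pos by simp
qed

abbreviation approx_spectrum_pair ::
    "('a::complex_hilbert \<Rightarrow>\<^sub>L 'a) \<Rightarrow> ('a \<Rightarrow>\<^sub>L 'a) \<Rightarrow> (complex^2) set"
  where "approx_spectrum_pair A X \<equiv> joint_approx_spectrum (vector [A, X])"

abbreviation approx_spectrum_quadruple ::
    "('a::complex_hilbert \<Rightarrow>\<^sub>L 'a) \<Rightarrow> ('a \<Rightarrow>\<^sub>L 'a) \<Rightarrow> ('a \<Rightarrow>\<^sub>L 'a) \<Rightarrow> ('a \<Rightarrow>\<^sub>L 'a) \<Rightarrow> (complex^4) set"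
  where "approx_spectrum_quadruple A X Y Z \<equiv> joint_approx_spectrum (vector [A, X, Y, Z])"

lemma ball2_unitary_iff:
  "domain_unitary ball2 (vector [A, X]) \<longleftrightarrow> normal_op A \<and> normal_op X \<and> A o\<^sub>L X = X o\<^sub>L A \<and>
    (\<forall>z\<in>approx_spectrum_pair A X. (cmod (z $ 1))\<^sup>2 + (cmod (z $ 2))\<^sup>2 = 1)"
  unfolding domain_unitary_iff_approx distinguished_boundary_ball2
  by (auto simp: forall_2 subset_iff mem_sphere_2 simp del: mem_sphere mem_sphere_0)

lemma hexablock_unitary_iff:
  fixes A X Y Z :: "'a::complex_hilbert \<Rightarrow>\<^sub>L 'a"
  shows "domain_unitary hexablock (vector [A, X, Y, Z]) \<longleftrightarrow>
    (normal_op A \<and> normal_op X \<and> normal_op Y \<and> normal_op Z) \<and>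
    (A o\<^sub>L X = X o\<^sub>L A \<and> A o\<^sub>L Y = Y o\<^sub>L A \<and> A o\<^sub>L Z = Z o\<^sub>L A \<and> X o\<^sub>L Y = Y o\<^sub>L X \<and> X o\<^sub>L Z = Z o\<^sub>L X \<and> Y o\<^sub>L Z = Z o\<^sub>L Y) \<and>
    approx_spectrum_quadruple A X Y Z \<subseteq> hexablock_edge"
  unfolding domain_unitary_iff_approx distinguished_boundary_hexablock
  by (simp add: forall_4) metis

text \<open>
  The approximate spectrum of \<open>(A, X, X\<^sup>*, 1)\<close> is the image of that of \<open>(A, X)\<close> under
  \<open>(a, x) \<mapsto> (a, x, cnj x, 1)\<close>, and such a point is in the edge exactly when \<open>|a|\<^sup>2 + |x|\<^sup>2 = 1\<close>.
\<close>

lemma ball2_unitary_iff_hexablock_unitary: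
  "domain_unitary ball2 (vector [A, X]) \<longleftrightarrow> domain_unitary hexablock (vector [A, X, adj X, id_blinfun])"
proof
  assume 1: "domain_unitary ball2 (vector [A, X])"
  then have A: "normal_op A" and X: "normal_op X" and AX: "A o\<^sub>L X = X o\<^sub>L A"
    and sph: "\<And>z. z \<in> approx_spectrum_pair A X \<Longrightarrow> (cmod (z $ 1))\<^sup>2 + (cmod (z $ 2))\<^sup>2 = 1"
    unfolding ball2_unitary_iff by blast+
  have "z \<in> hexablock_edge" if z: "z \<in> approx_spectrum_quadruple A X (adj X) id_blinfun" for z
  proof -
    have ap: "\<exists>x. x \<noteq> 0 \<and> norm (A x - z $ 1 *\<^sub>C x) \<le> e * norm x \<and> norm (X x - z $ 2 *\<^sub>C x) \<le> e * norm x
        \<and> norm (adj X x - z $ 3 *\<^sub>C x) \<le> e * norm x \<and> norm (x - z $ 4 *\<^sub>C x) \<le> e * norm x" if "e > 0" for e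
      using z that by (simp add: joint_approx_spectrum_def forall_4)
    have "1 = z $ 4"
    proof (rule approx_eigenvalue_unique[where K = 1])
      fix e :: real assume "e > 0"
      from ap[OF this] show "\<exists>x::'a. x \<noteq> 0 \<and> norm (1 *\<^sub>C x - z $ 4 *\<^sub>C x) \<le> 1 * e * norm x" by auto
    qed
    moreover have "z $ 3 = cnj (z $ 2)"
    proof (rule approx_eigenvalue_unique[where K = 2])
      fix e :: real assume "e > 0"
      then obtain x where x: "x \<noteq> 0" "norm (X x - z $ 2 *\<^sub>C x) \<le> e * norm x" "norm (adj X x - z $ 3 *\<^sub>C x) \<le> e * norm x"
        using ap by blast
      have "norm (z $ 3 *\<^sub>C x - cnj (z $ 2) *\<^sub>C x)
          \<le> norm (adj X x - z $ 3 *\<^sub>C x) + norm (adj X x - cnj (z $ 2) *\<^sub>C x)"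
        using norm_triangle_ineq4[of "adj X x - cnj (z $ 2) *\<^sub>C x" "adj X x - z $ 3 *\<^sub>C x"] by simp
      then show "\<exists>x::'a. x \<noteq> 0 \<and> norm (z $ 3 *\<^sub>C x - cnj (z $ 2) *\<^sub>C x) \<le> 2 * e * norm x"
        using x unfolding normal_residual[OF X] by (intro exI[of _ x]) auto
    qed
    moreover have "(cmod (z $ 1))\<^sup>2 + (cmod (z $ 2))\<^sup>2 = 1"
    proof -
      have "vector [z $ 1, z $ 2] \<in> approx_spectrum_pair A X"
        using ap by (simp add: joint_approx_spectrum_def forall_2) blast
      from sph[OF this] show ?thesis by simp
    qed
    ultimately show ?thesis by (simp add: hexablock_edge_def)
  qed
  then show "domain_unitary hexablock (vector [A, X, adj X, id_blinfun])"
    unfolding hexablock_unitary_iff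
    using A X AX fuglede[OF X normal_op_clinear[OF A] AX] X[unfolded normal_op_def]
    by (auto simp: normal_adj normal_id intro!: commuteI)
next
  assume 2: "domain_unitary hexablock (vector [A, X, adj X, id_blinfun])"
  then have A: "normal_op A" and X: "normal_op X" and AX: "A o\<^sub>L X = X o\<^sub>L A"
    and edge: "\<And>z. z \<in> approx_spectrum_quadruple A X (adj X) id_blinfun \<Longrightarrow> z \<in> hexablock_edge"
    unfolding hexablock_unitary_iff by blast+
  have "(cmod (z $ 1))\<^sup>2 + (cmod (z $ 2))\<^sup>2 = 1" if z: "z \<in> approx_spectrum_pair A X" for z
  proof -
    have "vector [z $ 1, z $ 2, cnj (z $ 2), 1] \<in> approx_spectrum_quadruple A X (adj X) id_blinfun"
      using z by (simp add: joint_approx_spectrum_def forall_4 forall_2 normal_residual[OF X])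
    from edge[OF this] show ?thesis by (simp add: hexablock_edge_def)
  qed
  then show "domain_unitary ball2 (vector [A, X])"
    unfolding ball2_unitary_iff using A X AX by blast
qed

text \<open>
  A point \<open>(a, x, p, u)\<close> of the approximate spectrum of \<open>(A, X, P, U)\<close>, with \<open>P\<close> the modulus of \<open>X\<close>, has
  \<open>|u| = 1\<close>, \<open>p\<close> real and \<open>x = p u\<close>, so again it is in the edge exactly when \<open>|a|\<^sup>2 + |x|\<^sup>2 = 1\<close>. To return from the
  quadruple to the pair, a point \<open>(a, x)\<close> has to be extended by a value \<open>u\<close>, which \<open>U\<close> need not determine when
  \<open>x = 0\<close>; the projection property supplies one, and \<open>p = x cnj u\<close> follows from \<open>P = U\<^sup>* X\<close>.
\<close>

lemma polar_hexablock_unitary_iff_ball2_unitary: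
  assumes X: "normal_op X" and pol: "polar_unitary X U"
  shows "domain_unitary hexablock (vector [A, X, abs_op X, U]) \<longleftrightarrow> domain_unitary ball2 (vector [A, X])"
proof -
  define P where "P = abs_op X"
  note clX = normal_op_clinear[OF X]
  have U: "unitary_op U" and XUP: "X = U o\<^sub>L P" and XPU: "X = P o\<^sub>L U"
    and polc: "\<And>S. clinear_op S \<Longrightarrow> S o\<^sub>L X = X o\<^sub>L S \<Longrightarrow> S o\<^sub>L U = U o\<^sub>L S"
    using pol unfolding polar_unitary_def P_def by blast+
  have posP: "positive_op P" using abs_op_positive_square[OF clX] by (simp add: P_def)
  have clP: "clinear_op P" and saP: "adj P = P"
    using posP positive_op_clinear adj_positive_op by blast+
  have Xx: "X x = U (P x)" "X x = P (U x)" for x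
    using arg_cong[OF XUP, of "\<lambda>Z. blinfun_apply Z x"] arg_cong[OF XPU, of "\<lambda>Z. blinfun_apply Z x"] by simp_all
  have UU: "adj U (U x) = x" for x
    using U unfolding unitary_op_def by (metis blinfun_apply_blinfun_compose id_blinfun.rep_eq)
  have Px: "P x = adj U (X x)" for x by (simp add: Xx(1) UU)
  have clU: "clinear_op U" using U by (simp add: unitary_op_def)
  have nU: "normal_op U" by (rule unitary_normal[OF U])
  have nP: "normal_op P" by (rule selfadjoint_normal[OF clP saP])
  have XU: "X o\<^sub>L U = U o\<^sub>L X" by (rule polc[OF clX refl])
  show ?thesis
    unfolding P_def[symmetric]
  proof
    assume 3: "domain_unitary hexablock (vector [A, X, P, U])"
    then have A: "normal_op A" and AX: "A o\<^sub>L X = X o\<^sub>L A" and AU: "A o\<^sub>L U = U o\<^sub>L A"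
      and edge: "\<And>z. z \<in> approx_spectrum_quadruple A X P U \<Longrightarrow> z \<in> hexablock_edge"
      unfolding hexablock_unitary_iff by blast+
    have "(cmod (z $ 1))\<^sup>2 + (cmod (z $ 2))\<^sup>2 = 1" if z: "z \<in> approx_spectrum_pair A X" for z
    proof -
      have cl2: "clinear_op ((vector [A, X] :: ('a \<Rightarrow>\<^sub>L 'a)^2) $ i)" for i
        using exhaust_2[of i] clX normal_op_clinear[OF A] by auto
      have comm2: "(vector [A, X] :: ('a \<Rightarrow>\<^sub>L 'a)^2) $ i o\<^sub>L U = U o\<^sub>L (vector [A, X] :: ('a \<Rightarrow>\<^sub>L 'a)^2) $ i" for i
        using exhaust_2[of i] XU AU by auto
      obtain u where u: "\<forall>e>0. \<exists>x. x \<noteq> 0 \<and>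
          (\<forall>i. norm (((vector [A, X] :: ('a \<Rightarrow>\<^sub>L 'a)^2) $ i) x - z $ i *\<^sub>C x) \<le> e * norm x) \<and> norm (U x - u *\<^sub>C x) \<le> e * norm x"
        using joint_approx_spectrum_extend[OF z U cl2 comm2] ..
      have "vector [z $ 1, z $ 2, z $ 2 * cnj u, u] \<in> approx_spectrum_quadruple A X P U"
        unfolding joint_approx_spectrum_def mem_Collect_eq
      proof (intro allI impI)
        fix e :: real assume e: "e > 0"
        define K where "K = 1 + cmod (z $ 2)"
        have K: "K \<ge> 1" by (simp add: K_def)
        have dK: "d + cmod (z $ 2) * d = d * K" for d by (simp add: K_def algebra_simps)
        obtain x where x: "x \<noteq> 0" "norm (A x - z $ 1 *\<^sub>C x) \<le> e / K * norm x"
          "norm (X x - z $ 2 *\<^sub>C x) \<le> e / K * norm x" "norm (U x - u *\<^sub>C x) \<le> e / K * norm x"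
          using u[rule_format, of "e / K"] e K by (auto simp: forall_2)
        have "e / K \<le> e" using e K by (simp add: divide_le_eq)
        then have eK: "e / K * norm x \<le> e * norm x" by (intro mult_right_mono) auto
        have "P x - (z $ 2 * cnj u) *\<^sub>C x = adj U (X x - z $ 2 *\<^sub>C x) + z $ 2 *\<^sub>C (adj U x - cnj u *\<^sub>C x)"
          using clinear_adj[OF clU] by (simp add: Px blinfun.diff_right clinear_op_def scaleC_diff_right scaleC_scaleC)
        then have "norm (P x - (z $ 2 * cnj u) *\<^sub>C x) \<le> norm (adj U (X x - z $ 2 *\<^sub>C x)) + cmod (z $ 2) * norm (adj U x - cnj u *\<^sub>C x)"
          using norm_triangle_ineq by (metis norm_scaleC)
        also have "norm (adj U (X x - z $ 2 *\<^sub>C x)) = norm (X x - z $ 2 *\<^sub>C x)"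
          using normal_residual[OF nU, of _ 0] by (simp add: norm_unitary[OF U])
        also have "norm (adj U x - cnj u *\<^sub>C x) = norm (U x - u *\<^sub>C x)" by (rule normal_residual[OF nU])
        also have "norm (X x - z $ 2 *\<^sub>C x) + cmod (z $ 2) * norm (U x - u *\<^sub>C x)
            \<le> e / K * norm x + cmod (z $ 2) * (e / K * norm x)"
          by (intro add_mono mult_left_mono x) simp
        also have "\<dots> = (e / K * norm x) * K" by (rule dK)
        also have "\<dots> = e * norm x" using K by simp
        finally have "norm (P x - (z $ 2 * cnj u) *\<^sub>C x) \<le> e * norm x" .
        then show "\<exists>x. x \<noteq> 0 \<and> (\<forall>i. norm (((vector [A, X, P, U] :: ('a \<Rightarrow>\<^sub>L 'a)^4) $ i) x
            - (vector [z $ 1, z $ 2, z $ 2 * cnj u, u] :: complex^4) $ i *\<^sub>C x) \<le> e * norm x)"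
          using x eK by (intro exI[of _ x]) (auto simp: forall_4)
      qed
      from edge[OF this] show ?thesis by (simp add: hexablock_edge_def)
    qed
    then show "domain_unitary ball2 (vector [A, X])"
      unfolding ball2_unitary_iff using A X AX by blast
  next
    assume 1: "domain_unitary ball2 (vector [A, X])"
    then have A: "normal_op A" and AX: "A o\<^sub>L X = X o\<^sub>L A"
      and sph: "\<And>z. z \<in> approx_spectrum_pair A X \<Longrightarrow> (cmod (z $ 1))\<^sup>2 + (cmod (z $ 2))\<^sup>2 = 1"
      unfolding ball2_unitary_iff by blast+
    have AU: "A o\<^sub>L U = U o\<^sub>L A" by (rule polc[OF normal_op_clinear[OF A] AX])
    have AaU: "A o\<^sub>L adj U = adj U o\<^sub>L A" by (rule fuglede[OF nU normal_op_clinear[OF A] AU])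
    have AP: "A o\<^sub>L P = P o\<^sub>L A"
      by (rule commuteI) (simp add: Px commute_apply[OF AaU] commute_apply[OF AX])
    have XP: "X o\<^sub>L P = P o\<^sub>L X"
      by (rule commuteI) (metis Xx)
    have PU: "P o\<^sub>L U = U o\<^sub>L P" using XUP XPU by simp
    have "z \<in> hexablock_edge" if z: "z \<in> approx_spectrum_quadruple A X P U" for z
    proof -
      have ap: "\<exists>x. x \<noteq> 0 \<and> norm (A x - z $ 1 *\<^sub>C x) \<le> e * norm x \<and> norm (X x - z $ 2 *\<^sub>C x) \<le> e * norm x
          \<and> norm (P x - z $ 3 *\<^sub>C x) \<le> e * norm x \<and> norm (U x - z $ 4 *\<^sub>C x) \<le> e * norm x" if "e > 0" for e
        using z that by (simp add: joint_approx_spectrum_def forall_4)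
      have "of_real (cmod (z $ 4)) = (1::complex)"
      proof (rule approx_eigenvalue_unique[where K = 1])
        fix e :: real assume "e > 0"
        then obtain x where x: "x \<noteq> 0" "norm (U x - z $ 4 *\<^sub>C x) \<le> e * norm x" using ap by blast
        have "of_real (cmod (z $ 4)) *\<^sub>C x - 1 *\<^sub>C x = (cmod (z $ 4) - 1) *\<^sub>R x"
          by (simp add: scaleC_of_real scaleR_diff_left)
        then have "norm (of_real (cmod (z $ 4)) *\<^sub>C x - 1 *\<^sub>C x) = \<bar>(cmod (z $ 4) - 1) * norm x\<bar>"
          by (simp add: abs_mult)
        also have "\<dots> = \<bar>norm (U x) - norm (z $ 4 *\<^sub>C x)\<bar>"
          by (simp add: norm_scaleC norm_unitary[OF U] left_diff_distrib abs_minus_commute)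
        also have "\<dots> \<le> norm (U x - z $ 4 *\<^sub>C x)"
          by (rule norm_triangle_ineq3)
        finally show "\<exists>x::'a. x \<noteq> 0 \<and> norm (of_real (cmod (z $ 4)) *\<^sub>C x - 1 *\<^sub>C x) \<le> 1 * e * norm x"
          using x by (intro exI[of _ x]) simp
      qed
      then have z4: "cmod (z $ 4) = 1" by (metis of_real_eq_1_iff)
      have z3: "z $ 3 = cnj (z $ 3)"
      proof (rule approx_eigenvalue_unique[where K = 2])
        fix e :: real assume "e > 0"
        then obtain x where x: "x \<noteq> 0" "norm (P x - z $ 3 *\<^sub>C x) \<le> e * norm x" using ap by blast
        have "norm (P x - cnj (z $ 3) *\<^sub>C x) \<le> e * norm x"
          using normal_residual[OF nP, of x "z $ 3"] x(2) by (simp add: saP)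
        then have "norm (z $ 3 *\<^sub>C x - cnj (z $ 3) *\<^sub>C x) \<le> 2 * e * norm x"
          using norm_triangle_ineq4[of "P x - cnj (z $ 3) *\<^sub>C x" "P x - z $ 3 *\<^sub>C x"] x(2) by simp
        then show "\<exists>x::'a. x \<noteq> 0 \<and> norm (z $ 3 *\<^sub>C x - cnj (z $ 3) *\<^sub>C x) \<le> 2 * e * norm x" using x by blast
      qed
      have z2: "z $ 2 = z $ 3 * z $ 4"
      proof (rule approx_eigenvalue_unique[where K = "2 + cmod (z $ 3)"])
        fix e :: real assume "e > 0"
        then obtain x where x: "x \<noteq> 0" "norm (X x - z $ 2 *\<^sub>C x) \<le> e * norm x"
          "norm (P x - z $ 3 *\<^sub>C x) \<le> e * norm x" "norm (U x - z $ 4 *\<^sub>C x) \<le> e * norm x" using ap by blast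
        have "z $ 2 *\<^sub>C x - (z $ 3 * z $ 4) *\<^sub>C x =
            (U (P x - z $ 3 *\<^sub>C x) - (X x - z $ 2 *\<^sub>C x)) + z $ 3 *\<^sub>C (U x - z $ 4 *\<^sub>C x)"
          using clU by (simp add: Xx(1) blinfun.diff_right clinear_op_def scaleC_diff_right scaleC_scaleC)
        also have "norm \<dots> \<le> (norm (P x - z $ 3 *\<^sub>C x) + norm (X x - z $ 2 *\<^sub>C x)) + cmod (z $ 3) * norm (U x - z $ 4 *\<^sub>C x)"
          by (rule order_trans[OF norm_triangle_ineq add_mono[OF order_trans[OF norm_triangle_ineq4]]])
            (simp_all add: norm_unitary[OF U] norm_scaleC)
        also have "\<dots> \<le> (e * norm x + e * norm x) + cmod (z $ 3) * (e * norm x)"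
          by (intro add_mono mult_left_mono x) simp
        also have "\<dots> = (2 + cmod (z $ 3)) * e * norm x" by (simp add: algebra_simps)
        finally show "\<exists>x::'a. x \<noteq> 0 \<and> norm (z $ 2 *\<^sub>C x - (z $ 3 * z $ 4) *\<^sub>C x) \<le> (2 + cmod (z $ 3)) * e * norm x"
          using x(1) by blast
      qed
      have "vector [z $ 1, z $ 2] \<in> approx_spectrum_pair A X"
        using ap by (simp add: joint_approx_spectrum_def forall_2) blast
      from sph[OF this] show ?thesis using z2 z3 z4 by (simp add: hexablock_edge_def)
    qed
    then show "domain_unitary hexablock (vector [A, X, P, U])"
      unfolding hexablock_unitary_iff using A X nP nU AX AP AU XP XU PU by blast
  qed
qed

theorem proposition3p10:
  fixes A X1 :: "'a::complex_hilbert \<Rightarrow>\<^sub>L 'a"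
  assumes "clinear_op A" and "clinear_op X1"
  shows "(domain_unitary ball2 (vector [A, X1]) \<longleftrightarrow>
            domain_unitary hexablock (vector [A, X1, adj X1, id_blinfun])) \<and>
         (\<forall>U. (normal_op X1 \<longrightarrow> polar_unitary X1 U) \<longrightarrow>
            (domain_unitary hexablock (vector [A, X1, adj X1, id_blinfun]) \<longleftrightarrow>
             normal_op X1 \<and> domain_unitary hexablock (vector [A, X1, abs_op X1, U])))"
  using ball2_unitary_iff_hexablock_unitary[of A X1] polar_hexablock_unitary_iff_ball2_unitary[of X1 _ A]
    ball2_unitary_iff[of A X1] by blast

end
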